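(* Let $k\geq 2$. Let $p_k:S_k\to S_{1,2}$ be the $k$-sheeted cyclic branched cover, $\mathrm{LMod}_{p_k}(S_{1,2})\leq \mathrm{Mod}(S_{1,2})$ its liftable mapping class group, $\Psi:\mathrm{Mod}(S_{1,2})\to \mathrm{GL}_3(\mathbb{Z})$ the homology representation, $a,b,c$ the simple closed curves and $\iota$ the hyperelliptic involution, all as specified in the context. Then $$\Psi(\mathrm{LMod}_{p_k}(S_{1,2}))=\langle \Psi(T_a),\Psi(T_b),\Psi(T_c^k),\Psi(\iota)\rangle.$$
   Context: $S_{g,n}$ is the closed oriented surface of genus $g$ with $n$ marked points, $S_g=S_{g,0}$, and $S_{g,n}^{\circ}$ is $S_{g,n}$ with the marked points removed. $\mathrm{Mod}(S_{g,n})$ is the group of isotopy classes (relative to the marked points) of orientation-preserving self-homeomorphisms of $S_{g,n}$ preserving the set of marked points (possibly permuting them). $T_x$ denotes the left-handed Dehn twist about a simple closed curve $x$. Products of mapping classes are compositions of functions, applied right to left. Curves on $S_{1,2}$: $a,b,c$ are essential simple closed curves in $S_{1,2}^{\circ}$ such that $a\cap c=\emptyset$, $b$ meets each of $a$ and $c$ transversally in exactly one point, and $a\cup c$ cuts the torus into two annuli each containing exactly one marked point (such a triple is unique up to homeomorphism). The curve $d$ is a small simple loop around one marked point. Orient them so that the algebraic intersection number of $a$ with $b$ is $+1$, $c$ is parallel to $a$ in the unmarked torus, and $[c]=[a]+[d]$ in $H_1(S_{1,2}^{\circ};\mathbb{Z})$. Put $c_1=[a]$, $c_2=[b]$, $c_3=[d]$,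 a basis of $H_1(S_{1,2}^{\circ};\mathbb{Z})\cong\mathbb{Z}^3$. An explicit model: torus $\mathbb{R}^2/\mathbb{Z}^2$, marked points $(\pm 1/4,0)$, $a=\{x=0\}$, $c=\{x=1/2\}$, $b=\{y=1/2\}$. The hyperelliptic involution $\iota\in\mathrm{Mod}(S_{1,2})$ is the class of the involution (in the model, $(x,y)\mapsto(-x,-y)$) that maps each of $a,b,c$ to itself reversing its orientation and swaps the two marked points. Homology representation: $\Psi:\mathrm{Mod}(S_{1,2})\to\mathrm{GL}_3(\mathbb{Z})$ is the action on $H_1(S_{1,2}^{\circ};\mathbb{Z})$ in the basis $(c_1,c_2,c_3)$ (matrices acting on column vectors). Cover: for $k\geq 2$, $\eta_k:H_1(S_{1,2}^{\circ};\mathbb{Z})\to\mathbb{Z}_k=\mathbb{Z}/k\mathbb{Z}$ is $n_1c_1+n_2c_2+n_3c_3\mapsto n_3 \bmod k$. The regular cyclic $k$-sheeted cover of $S_{1,2}^{\circ}$ corresponding to the kernel of $\pi_1(S_{1,2}^{\circ})\to H_1(S_{1,2}^{\circ};\mathbb{Z})\xrightarrow{\eta_k}\mathbb{Z}_k$, with punctures filled in, is the branched cover $p_k:S_k\to S_{1,2}$ (branched over the two marked points, total space of genus $k$). $\mathrm{LMod}_{p_k}(S_{1,2})$ is the subgroup of $\mathrm{Mod}(S_{1,2})$ of mapping classes represented by homeomorphisms $f$ that lift under $p_k$, i.e. for which there is a homeomorphism $\tilde f$ of $S_k$ with $p_k\tilde f=fp_k$. *)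

theory Defs
  imports "HOL-Homology.Homology" "HOL-Complex_Analysis.Complex_Analysis"
begin

section \<open>The torus with two marked points\<close>

text \<open>The torus \<open>\<real>\<^sup>2/\<int>\<^sup>2\<close> is realised as the product of two unit circles; \<^term>\<open>torus_cover\<close> below
  is the universal covering, with \<open>\<real>\<^sup>2\<close> identified with the complex plane.  The torus carries the
  orientation that it inherits from the plane.\<close>

definition torus :: "(complex \<times> complex) set" where
  "torus = sphere 0 1 \<times> sphere 0 1"

definition torus_cover :: "complex \<Rightarrow> complex \<times> complex" where
  "torus_cover z = (cis (2 * pi * Re z), cis (2 * pi * Im z))"

definition marked :: "(complex \<times> complex) set" where
  "marked = {torus_cover (1/4), torus_cover (- (1/4))}"

definition punctured_torus :: "(complex \<times> complex) set" where
  "punctured_torus = torus - marked"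

text \<open>A map \<open>g\<close> from an open subset of the plane to the torus preserves orientation if, near each
  point \<open>z\<close>, a lift of \<open>g\<close> to the plane has local degree 1 at \<open>z\<close>.  This is only used for locally
  injective \<open>g\<close>, for which the local degree does not depend on the radius of the circle.\<close>

definition orientation_preserving_on :: "complex set \<Rightarrow> (complex \<Rightarrow> complex \<times> complex) \<Rightarrow> bool" where
  "orientation_preserving_on U g \<longleftrightarrow>
     (\<forall>z\<in>U. \<exists>r>0. \<exists>l. cball z r \<subseteq> U \<and> continuous_on (cball z r) l \<and>
        (\<forall>w\<in>cball z r. torus_cover (l w) = g w) \<and>
        l z \<notin> path_image (l \<circ> circlepath z r) \<and>
        winding_number (l \<circ> circlepath z r) (l z) = 1)"


section \<open>The mapping class group\<close>

text \<open>Self-maps of the torus are made extensional, so that they are determined by their values on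
  the torus.\<close>

definition marked_homeos :: "(complex \<times> complex \<Rightarrow> complex \<times> complex) set" where
  "marked_homeos =
     {f \<in> extensional torus. (\<exists>g. homeomorphism torus torus f g) \<and> f ` marked = marked}"

definition homeo_group :: "(complex \<times> complex \<Rightarrow> complex \<times> complex) monoid" where
  "homeo_group =
     \<lparr>carrier = {f \<in> marked_homeos. orientation_preserving_on UNIV (f \<circ> torus_cover)},
      monoid.mult = compose torus,
      one = (\<lambda>q\<in>torus. q)\<rparr>"

definition isotopy_rel ::
    "((complex \<times> complex \<Rightarrow> complex \<times> complex) \<times> (complex \<times> complex \<Rightarrow> complex \<times> complex)) set" where
  "isotopy_rel =
     {(f, g). f \<in> carrier homeo_group \<and> g \<in> carrier homeo_group \<and>
        (\<exists>h. continuous_on ({0..1::real} \<times> torus) h \<and>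
           (\<forall>t\<in>{0..1}. (\<lambda>q\<in>torus. h (t, q)) \<in> marked_homeos) \<and>
           (\<forall>q\<in>torus. h (0, q) = f q \<and> h (1, q) = g q))}"

definition mapping_class ::
    "(complex \<times> complex \<Rightarrow> complex \<times> complex) \<Rightarrow> (complex \<times> complex \<Rightarrow> complex \<times> complex) set" where
  "mapping_class f = isotopy_rel `` {f}"

text \<open>As in a quotient group, the product of two isotopy classes is their elementwise product.\<close>

definition Mod_group :: "(complex \<times> complex \<Rightarrow> complex \<times> complex) set monoid" where
  "Mod_group =
     \<lparr>carrier = carrier homeo_group // isotopy_rel,
      monoid.mult = (\<lambda>\<phi> \<psi>. \<phi> <#>\<^bsub>homeo_group\<^esub> \<psi>),
      one = mapping_class \<one>\<^bsub>homeo_group\<^esub>\<rparr>"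


section \<open>Curves, Dehn twists, and the hyperelliptic involution\<close>

text \<open>The curves are \<open>a = {x = 0}\<close>, \<open>b = {y = 1/2}\<close>, \<open>c = {x = 1/2}\<close>, and \<open>d\<close> is a small
  circle around the marked point \<open>(1/4, 0)\<close>.  The tangent directions of \<open>a\<close> and \<open>b\<close>,
  in this order, are \<open>(0, 1)\<close> and \<open>(-1, 0)\<close>, a positive basis of the plane.  The part
  \<open>{0 \<le> x \<le> 1/2}\<close> of the torus, with the disc inside \<open>d\<close> removed, has oriented boundary
  \<open>c - a - d\<close>, whence \<open>[c] = [a] + [d]\<close>.\<close>

definition curve_a :: "real \<Rightarrow> complex \<times> complex" where
  "curve_a t = torus_cover (Complex 0 t)"

definition curve_b :: "real \<Rightarrow> complex \<times> complex" where
  "curve_b t = torus_cover (Complex (- t) (1/2))"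

definition curve_c :: "real \<Rightarrow> complex \<times> complex" where
  "curve_c t = torus_cover (Complex (1/2) t)"

definition curve_d :: "real \<Rightarrow> complex \<times> complex" where
  "curve_d t = torus_cover (1/4 + 1/8 * cis (2 * pi * t))"

text \<open>The model annulus lies in the plane and has the orientation of the plane.  The twist
  turns left as one crosses the annulus, in either direction.\<close>

definition annulus :: "complex set" where
  "annulus = {z. 1 \<le> cmod z \<and> cmod z \<le> 2}"

definition annulus_twist :: "complex \<Rightarrow> complex" where
  "annulus_twist z = z * cis (2 * pi * (cmod z - 1))"

text \<open>An orientation preserving parametrisation of an annular neighbourhood, in the punctured
  torus, of the simple closed curve \<open>x\<close>.\<close>

definition annular_chart :: "(real \<Rightarrow> complex \<times> complex) \<Rightarrow> (complex \<Rightarrow> complex \<times> complex) \<Rightarrow> bool" where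
  "annular_chart x \<phi> \<longleftrightarrow>
     continuous_on annulus \<phi> \<and> inj_on \<phi> annulus \<and> \<phi> ` annulus \<subseteq> punctured_torus \<and>
     \<phi> ` sphere 0 (3/2) = path_image x \<and>
     orientation_preserving_on (interior annulus) \<phi>"

definition left_twist :: "(complex \<Rightarrow> complex \<times> complex) \<Rightarrow> complex \<times> complex \<Rightarrow> complex \<times> complex" where
  "left_twist \<phi> =
     (\<lambda>q\<in>torus. if q \<in> \<phi> ` annulus then \<phi> (annulus_twist (inv_into annulus \<phi> q)) else q)"

text \<open>The left-handed Dehn twist about \<open>x\<close> is the class of \<^term>\<open>left_twist \<phi>\<close> for any
  annular chart \<open>\<phi>\<close> of \<open>x\<close>.  For \<open>a\<close>, \<open>b\<close> and \<open>c\<close> we use straight annuli of width 1/4: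
  \<^term>\<open>strip_chart p \<beta>\<close> sends the radial coordinate to the direction \<open>\<beta>\<close>, and the angular one
  to \<open>\<i>\<beta>\<close>.  Lemma \<open>annular_chart_strips\<close> at the end
  shows that these are annular charts of the three curves.\<close>

definition strip_chart :: "complex \<Rightarrow> complex \<Rightarrow> complex \<Rightarrow> complex \<times> complex" where
  "strip_chart p \<beta> z = torus_cover (p + \<beta> * Complex ((cmod z - 3/2) / 4) (Arg z / (2 * pi)))"

definition T_a :: "(complex \<times> complex \<Rightarrow> complex \<times> complex) set" where
  "T_a = mapping_class (left_twist (strip_chart 0 1))"

definition T_b :: "(complex \<times> complex \<Rightarrow> complex \<times> complex) set" where
  "T_b = mapping_class (left_twist (strip_chart (\<i> / 2) \<i>))"

definition T_c :: "(complex \<times> complex \<Rightarrow> complex \<times> complex) set" where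
  "T_c = mapping_class (left_twist (strip_chart (1/2) 1))"

definition hyperelliptic :: "(complex \<times> complex \<Rightarrow> complex \<times> complex) set" where
  "hyperelliptic = mapping_class (\<lambda>q\<in>torus. (cnj (fst q), cnj (snd q)))"


section \<open>The homology representation\<close>

abbreviation H1 :: "(complex \<times> complex) chain set monoid" where
  "H1 \<equiv> homology_group 1 (top_of_set punctured_torus)"

text \<open>A path is a singular 1-simplex after the standard 1-simplex has been identified with the unit
  interval by its second barycentric coordinate.\<close>

definition loop_class :: "(real \<Rightarrow> complex \<times> complex) \<Rightarrow> (complex \<times> complex) chain set" where
  "loop_class g =
     homologous_rel_set 1 (top_of_set punctured_torus) {}
       (frag_of (\<lambda>x\<in>standard_simplex 1. g (x 1)))"

definition H1_basis :: "3 \<Rightarrow> (complex \<times> complex) chain set" where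
  "H1_basis i = loop_class (if i = 1 then curve_a else if i = 2 then curve_b else curve_d)"

text \<open>The element \<open>n\<^sub>1c\<^sub>1 + n\<^sub>2c\<^sub>2 + n\<^sub>3c\<^sub>3\<close>; the library writes homology groups multiplicatively.\<close>

definition H1_comb :: "int ^ 3 \<Rightarrow> (complex \<times> complex) chain set" where
  "H1_comb n = (\<Otimes>\<^bsub>H1\<^esub>i\<in>UNIV. H1_basis i [^]\<^bsub>H1\<^esub> (n $ i))"

definition Psi :: "(complex \<times> complex \<Rightarrow> complex \<times> complex) set \<Rightarrow> int ^ 3 ^ 3" where
  "Psi \<phi> = (THE A. \<forall>f\<in>\<phi>. \<forall>j.
     hom_induced 1 (top_of_set punctured_torus) {} (top_of_set punctured_torus) {} f (H1_basis j)
       = H1_comb (column j A))"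

definition GL3Z :: "(int ^ 3 ^ 3) monoid" where
  "GL3Z = \<lparr>carrier = {A. invertible A}, monoid.mult = (**), one = mat 1\<rparr>"


section \<open>The cyclic branched cover and liftable mapping classes\<close>

text \<open>\<open>\<int>\<^sub>k\<close> is represented by the residues \<open>{0..<k}\<close>.\<close>

definition eta :: "nat \<Rightarrow> (complex \<times> complex) chain set \<Rightarrow> int" where
  "eta k x = (THE n. x = H1_comb n) $ 3 mod int k"

definition closed_surface :: "'a::real_normed_vector set \<Rightarrow> bool" where
  "closed_surface S \<longleftrightarrow>
     S \<noteq> {} \<and> compact S \<and> connected S \<and>
     (\<forall>x\<in>S. \<exists>U. x \<in> U \<and> openin (top_of_set S) U \<and> U homeomorphic (UNIV :: complex set))"

text \<open>Away from the finitely many points over the marked points, \<open>p\<close> is the connected covering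
  whose group is the kernel of \<^term>\<open>eta k\<close>: a loop in the punctured torus lies in that kernel iff
  its lifts are closed.  As \<^term>\<open>eta k\<close> is onto \<open>\<int>\<^sub>k\<close>, the covering is regular and cyclic with
  \<open>k\<close> sheets.  Being a closed surface, \<open>S\<close> is obtained from it by filling in the punctures.\<close>

definition cyclic_branched_cover ::
    "nat \<Rightarrow> 'a::real_normed_vector set \<Rightarrow> ('a \<Rightarrow> complex \<times> complex) \<Rightarrow> bool" where
  "cyclic_branched_cover k S p \<longleftrightarrow>
     closed_surface S \<and> continuous_on S p \<and> p ` S = torus \<and> finite (S \<inter> p -` marked) \<and>
     path_connected (S \<inter> p -` punctured_torus) \<and>
     covering_space (S \<inter> p -` punctured_torus) p punctured_torus \<and>
     (\<forall>g. path g \<and> path_image g \<subseteq> S \<inter> p -` punctured_torus \<and>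
          pathfinish (p \<circ> g) = pathstart (p \<circ> g) \<longrightarrow>
            (pathfinish g = pathstart g \<longleftrightarrow> eta k (loop_class (p \<circ> g)) = 0))"

definition lifts ::
    "'a::real_normed_vector set \<Rightarrow> ('a \<Rightarrow> complex \<times> complex) \<Rightarrow>
     (complex \<times> complex \<Rightarrow> complex \<times> complex) \<Rightarrow> bool" where
  "lifts S p f \<longleftrightarrow> (\<exists>h h'. homeomorphism S S h h' \<and> (\<forall>s\<in>S. p (h s) = f (p s)))"

definition LMod ::
    "'a::real_normed_vector set \<Rightarrow> ('a \<Rightarrow> complex \<times> complex) \<Rightarrow>
     (complex \<times> complex \<Rightarrow> complex \<times> complex) set set" where
  "LMod S p = {\<phi> \<in> carrier Mod_group. \<exists>f\<in>\<phi>. lifts S p f}"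


section \<open>The strips are annular charts of the three curves\<close>

lemma torus_cover_eq_iff:
  "torus_cover z = torus_cover w \<longleftrightarrow> Re z - Re w \<in> \<int> \<and> Im z - Im w \<in> \<int>"
proof -
  have *: "cis (2 * pi * s) = cis (2 * pi * t) \<longleftrightarrow> s - t \<in> \<int>" for s t :: real
  proof -
    have "cis (2 * pi * s) = cis (2 * pi * t) \<longleftrightarrow> exp (\<i> * of_real (2 * pi * s)) = exp (\<i> * of_real (2 * pi * t))"
      by (simp add: cis_conv_exp)
    also have "\<dots> \<longleftrightarrow> (\<exists>n::int. \<i> * of_real (2 * pi * s) = \<i> * of_real (2 * pi * t) + (of_int (2 * n) * pi) * \<i>)"
      by (rule exp_eq)
    also have "\<dots> \<longleftrightarrow> (\<exists>n::int. s = t + of_int n)"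
    proof (rule arg_cong[where f = Ex], rule ext)
      fix n :: int
      have "\<i> * of_real (2 * pi * s) = \<i> * of_real (2 * pi * t) + (of_int (2 * n) * pi) * \<i>
         \<longleftrightarrow> 2 * pi * s = 2 * pi * t + of_int (2*n)*pi"
        by (simp add: complex_eq_iff)
      also have "\<dots> \<longleftrightarrow> 2 * pi * s = 2 * pi * (t + of_int n)"
        by (simp add: algebra_simps)
      also have "\<dots> \<longleftrightarrow> s = t + of_int n"
        by (metis mult_cancel_left mult_eq_0_iff pi_neq_zero zero_neq_numeral)
      finally show "\<i> * of_real (2 * pi * s) = \<i> * of_real (2 * pi * t) + (of_int (2 * n) * pi) * \<i>
         \<longleftrightarrow> s = t + of_int n" .
    qed
    also have "\<dots> \<longleftrightarrow> s - t \<in> \<int>"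
      by (auto simp: Ints_def algebra_simps)
    finally show ?thesis .
  qed
  show ?thesis by (simp add: torus_cover_def *)
qed

lemma torus_cover_in_torus: "torus_cover z \<in> torus"
  by (simp add: torus_cover_def torus_def)

lemma winding_number_scaled_circle:
  assumes "\<kappa> \<noteq> 0" "r > 0"
  shows "winding_number (\<lambda>t. \<kappa> * (circlepath z r t - z)) 0 = 1"
proof -
  define \<alpha> where "\<alpha> = Ln \<kappa>"
  have k: "\<kappa> = exp \<alpha>" using assms by (simp add: \<alpha>_def)
  have "homotopic_loops (- {0}) (circlepath 0 r) (\<lambda>t. \<kappa> * (circlepath z r t - z))"
    unfolding homotopic_loops
  proof (intro exI conjI ballI)
    let ?h = "\<lambda>y::real\<times>real. exp (of_real (fst y) * \<alpha>) * (of_real r * exp (2 * of_real pi * \<i> * of_real (snd y)))"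
    show "continuous_on ({0..1} \<times> {0..1}) ?h"
      by (intro continuous_intros)
    show "?h \<in> {0..1} \<times> {0..1} \<rightarrow> - {0}"
      using assms by auto
  qed (auto simp: circlepath k pathfinish_def pathstart_def exp_eq_1)
  then have "winding_number (circlepath 0 r) 0 = winding_number (\<lambda>t. \<kappa> * (circlepath z r t - z)) 0"
    by (rule winding_number_homotopic_loops)
  with assms show ?thesis by (simp add: winding_number_circlepath_centre)
qed

lemma polar_sign:
  fixes u :: complex
  assumes "cmod u < 1" "u \<noteq> 0" "A > 0" "B > 0"
  shows "0 \<notin> closed_segment u (Complex (A * (cmod (1 + u) - 1)) (B * Im (Ln (1 + u))))"
proof
  assume "0 \<in> closed_segment u (Complex (A * (cmod (1 + u) - 1)) (B * Im (Ln (1 + u))))"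
  then obtain s where s: "0 \<le> s" "s \<le> 1"
    and eq: "0 = (1 - s) *\<^sub>R u + s *\<^sub>R Complex (A * (cmod (1 + u) - 1)) (B * Im (Ln (1 + u)))"
    by (auto simp: in_segment)
  have re: "Re (1 + u) > 0"
    using assms(1) abs_Re_le_cmod[of u] by simp
  then have nz: "1 + u \<noteq> 0" by (metis less_irrefl zero_complex.sel(1))
  have e1: "0 = (1 - s) * Re u + s * (A * (cmod (1 + u) - 1))"
    and e2: "0 = (1 - s) * Im u + s * (B * Im (Ln (1 + u)))"
    using eq by (simp_all add: complex_eq_iff)
  consider "Im u > 0" | "Im u < 0" | "Im u = 0" by linarith
  then show False
  proof cases
    case 1
    then have "Im (Ln (1 + u)) > 0"
      using Im_Ln_pos_lt[OF nz] Im_Ln_pos_lt_imp nz re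
      by (smt (verit) Im_Ln_eq_0 Im_Ln_pos_le nz plus_complex.sel(2) one_complex.sel(2) complex_is_Real_iff)
    with 1 s e2 assms show False
      by (smt (verit) mult_nonneg_nonneg mult_pos_pos zero_less_mult_iff)
  next
    case 2
    then have "Im (Ln (1 + u)) < 0"
      using Im_Ln_pos_le[OF nz] by (smt (verit) plus_complex.sel(2) one_complex.sel(2) Im_Ln_le_pi mpi_less_Im_Ln nz)
    with 2 s e2 assms show False
      by (smt (verit) mult_nonneg_nonneg mult_pos_pos zero_less_mult_iff mult_pos_neg)
  next
    case 3
    have "cmod (1 + u) = 1 + Re u"
    proof -
      have "1 + u = of_real (1 + Re u)" using 3 by (simp add: complex_eq_iff)
      then show ?thesis using re by (metis norm_of_real abs_of_pos plus_complex.sel(1) one_complex.sel(1))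
    qed
    with e1 have "0 = Re u * ((1 - s) + s * A)" by (simp add: algebra_simps)
    moreover have "Re u \<noteq> 0" using 3 assms(2) by (simp add: complex_eq_iff)
    moreover have "(1 - s) + s * A > 0"
      using s assms(3) by (cases "s = 1") (auto intro: add_pos_nonneg)
    ultimately show False by simp
  qed
qed

lemma orientation_preserving_strip_chart:
  assumes "\<beta> = 1 \<or> \<beta> = \<i>"
  shows "orientation_preserving_on (interior annulus) (strip_chart p \<beta>)"
  unfolding orientation_preserving_on_def
proof (intro ballI)
  fix z assume z: "z \<in> interior annulus"
  obtain r where r: "r > 0" "cball z r \<subseteq> interior annulus"
    using z open_contains_cball[of "interior annulus"] by auto
  have sub: "cball z r \<subseteq> annulus" using r interior_subset by blast
  have zann: "cmod z \<ge> 1" using z interior_subset[of annulus] by (auto simp: annulus_def)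
  then have z0: "z \<noteq> 0" by auto
  have rz: "r < cmod z"
  proof (rule ccontr)
    assume "\<not> r < cmod z"
    then have "0 \<in> cball z r" by (simp add: dist_norm)
    with sub have "0 \<in> annulus" by blast
    then show False by (simp add: annulus_def)
  qed
  have b0: "\<beta> \<noteq> 0" using assms by auto
  define L where "L w = Im (Ln (w / z))" for w
  define l where "l w = p + \<beta> * Complex ((cmod w - 3/2) / 4) ((Arg z + L w) / (2 * pi))" for w
  have small: "cmod (w / z - 1) < 1" if "w \<in> cball z r" for w
  proof -
    have "w / z - 1 = (w - z) / z" using z0 by (simp add: field_simps)
    moreover have "cmod (w - z) \<le> r" using that by (simp add: dist_norm norm_minus_commute)
    ultimately show ?thesis using rz z0 by (simp add: norm_divide)
  qed
  have pos: "Re (w / z) > 0" if "w \<in> cball z r" for w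
    using small[OF that] abs_Re_le_cmod[of "w / z - 1"] by simp
  have npos: "w / z \<notin> \<real>\<^sub>\<le>\<^sub>0" if "w \<in> cball z r" for w
    using pos[OF that] by (auto simp: complex_nonpos_Reals_iff)
  have cont: "continuous_on (cball z r) l"
    unfolding l_def L_def Complex_eq using npos z0
    by (intro continuous_intros) auto
  have lift: "torus_cover (l w) = strip_chart p \<beta> w" if w: "w \<in> cball z r" for w
  proof -
    have w0: "w \<noteq> 0" using pos[OF w] by auto
    have "cis (L w) = sgn (w / z)"
      using w0 z0 by (simp add: L_def flip: Arg_eq_Im_Ln add: cis_Arg)
    then have "cis (Arg z + L w) = cis (Arg w)"
      using w0 z0 by (simp add: cis_Arg sgn_divide sgn_zero_iff flip: cis_mult)
    then have "cis (2*pi*((Arg z + L w)/(2*pi))) = cis (2*pi*(Arg w/(2*pi)))"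
      by simp
    then have "torus_cover (Complex 0 ((Arg z + L w)/(2*pi))) = torus_cover (Complex 0 (Arg w/(2*pi)))"
      by (simp add: torus_cover_def)
    then have "(Arg z + L w)/(2*pi) - Arg w/(2*pi) \<in> \<int>"
      unfolding torus_cover_eq_iff by simp
    then have "Arg w/(2*pi) - (Arg z + L w)/(2*pi) \<in> \<int>" "(Arg z + L w)/(2*pi) - Arg w/(2*pi) \<in> \<int>"
      by (metis Ints_minus minus_diff_eq, assumption)
    then show ?thesis
      unfolding strip_chart_def l_def torus_cover_eq_iff
      using assms by auto
  qed
  define \<kappa> where "\<kappa> = \<beta> / z"
  have k0: "\<kappa> \<noteq> 0" using b0 z0 by (simp add: \<kappa>_def)
  have incball: "circlepath z r t \<in> cball z r" for t
    using r by (simp add: circlepath dist_norm norm_mult norm_exp_eq_Re)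
  have avoid: "0 \<notin> closed_segment (\<kappa> * (circlepath z r t - z)) (l (circlepath z r t) - l z)" for t
  proof -
    define w where "w = circlepath z r t"
    have w: "w \<in> cball z r" using incball by (simp add: w_def)
    define u where "u = w / z - 1"
    have wu: "w = z * (1 + u)" using z0 by (simp add: u_def)
    have "w \<noteq> z" using r by (simp add: w_def circlepath)
    then have u0: "u \<noteq> 0" using z0 by (simp add: u_def)
    have L: "L w = Im (Ln (1 + u))" by (simp add: L_def u_def)
    have Lz: "L z = 0" using z0 by (simp add: L_def)
    have eqs: "l w - l z = \<beta> * Complex (cmod z / 4 * (cmod (1 + u) - 1)) (1 / (2*pi) * Im (Ln (1 + u)))"
    proof -
      have "l w - l z = \<beta> * (Complex ((cmod w - 3/2) / 4) ((Arg z + L w) / (2 * pi))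
          - Complex ((cmod z - 3/2) / 4) ((Arg z + L z) / (2 * pi)))"
        by (simp add: l_def right_diff_distrib)
      also have "Complex ((cmod w - 3/2) / 4) ((Arg z + L w) / (2 * pi))
          - Complex ((cmod z - 3/2) / 4) ((Arg z + L z) / (2 * pi))
          = Complex (cmod z / 4 * (cmod (1 + u) - 1)) (1 / (2*pi) * Im (Ln (1 + u)))"
      proof -
        have "cmod w = cmod z * cmod (1 + u)" by (simp only: wu norm_mult)
        then show ?thesis unfolding L Lz by (simp add: complex_eq_iff right_diff_distrib diff_divide_distrib add_divide_distrib)
      qed
      finally show ?thesis .
    qed
    have eqk: "\<kappa> * (w - z) = \<beta> * u"
      using z0 by (simp add: \<kappa>_def u_def field_simps)
    have "0 \<notin> closed_segment u (Complex (cmod z / 4 * (cmod (1 + u) - 1)) (1 / (2*pi) * Im (Ln (1 + u))))"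
      using small[OF w] u0 z0 by (intro polar_sign) (auto simp: u_def)
    then have "0 \<notin> (\<lambda>v. \<beta> * v) ` closed_segment u (Complex (cmod z / 4 * (cmod (1 + u) - 1)) (1 / (2*pi) * Im (Ln (1 + u))))"
      using b0 by auto
    moreover have "(\<lambda>v. \<beta> * v) ` closed_segment x y = closed_segment (\<beta> * x) (\<beta> * y)" for x y
      by (rule closed_segment_linear_image[symmetric]) (simp add: bounded_linear.linear bounded_linear_mult_right)
    ultimately show ?thesis
      unfolding w_def[symmetric] eqk eqs by simp
  qed
  have "l (circlepath z r t) \<noteq> l z" for t
    using avoid[of t] by auto
  then have notin: "l z \<notin> path_image (l \<circ> circlepath z r)"
    by (auto simp: path_image_def) (metis)
  have "homotopic_loops (- {0}) (\<lambda>t. \<kappa> * (circlepath z r t - z)) (\<lambda>t. l (circlepath z r t) - l z)"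
  proof (rule homotopic_loops_linear)
    show "path (\<lambda>t. \<kappa> * (circlepath z r t - z))"
      unfolding path_def circlepath by (intro continuous_intros)
    have "continuous_on {0..1} (\<lambda>t. l (circlepath z r t))"
      by (rule continuous_on_compose2[OF cont]) (use incball in \<open>auto simp: circlepath intro!: continuous_intros\<close>)
    then show "path (\<lambda>t. l (circlepath z r t) - l z)"
      unfolding path_def by (intro continuous_intros)
    have e: "circlepath z r 1 = circlepath z r 0"
      by (simp add: circlepath)
    show "pathfinish (\<lambda>t. \<kappa> * (circlepath z r t - z)) = pathstart (\<lambda>t. \<kappa> * (circlepath z r t - z))"
      "pathfinish (\<lambda>t. l (circlepath z r t) - l z) = pathstart (\<lambda>t. l (circlepath z r t) - l z)"
      by (simp_all add: pathfinish_def pathstart_def e)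
  qed (use avoid in auto)
  then have "winding_number (\<lambda>t. l (circlepath z r t) - l z) 0 = 1"
    using winding_number_homotopic_loops winding_number_scaled_circle[OF k0 r(1)] by metis
  then have "winding_number (l \<circ> circlepath z r) (l z) = 1"
    by (subst winding_number_offset) (simp add: o_def)
  with r cont lift notin
  show "\<exists>r>0. \<exists>l. cball z r \<subseteq> interior annulus \<and> continuous_on (cball z r) l \<and>
        (\<forall>w\<in>cball z r. torus_cover (l w) = strip_chart p \<beta> w) \<and>
        l z \<notin> path_image (l \<circ> circlepath z r) \<and>
        winding_number (l \<circ> circlepath z r) (l z) = 1"
    by blast
qed

lemma strip_chart_1:
  assumes "z \<noteq> 0"
  shows "strip_chart p 1 z = (cis (2 * pi * (Re p + (cmod z - 3/2) / 4)), cis (2 * pi * Im p) * sgn z)"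
proof -
  have "sgn z = cis (Arg z)" using assms by (simp add: cis_Arg)
  then show ?thesis by (simp add: strip_chart_def torus_cover_def distrib_left cis_mult)
qed

lemma strip_chart_i:
  assumes "z \<noteq> 0"
  shows "strip_chart p \<i> z = (cis (2 * pi * Re p) * cnj (sgn z), cis (2 * pi * (Im p + (cmod z - 3/2) / 4)))"
proof -
  have "sgn z = cis (Arg z)" using assms by (simp add: cis_Arg)
  then show ?thesis
    by (simp add: strip_chart_def torus_cover_def right_diff_distrib cis_mult cis_cnj)
qed

lemma continuous_on_strip_chart:
  assumes "\<beta> = 1 \<or> \<beta> = \<i>"
  shows "continuous_on annulus (strip_chart p \<beta>)"
proof -
  have nz: "z \<noteq> 0" if "z \<in> annulus" for z using that by (auto simp: annulus_def)
  have "continuous_on annulus (\<lambda>z. (cis (2 * pi * (Re p + (cmod z - 3/2) / 4)), cis (2 * pi * Im p) * sgn z))"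
    "continuous_on annulus (\<lambda>z. (cis (2 * pi * Re p) * cnj (sgn z), cis (2 * pi * (Im p + (cmod z - 3/2) / 4))))"
    unfolding sgn_div_norm by (intro continuous_intros; use nz in simp)+
  then show ?thesis
    using assms nz by (auto simp: strip_chart_1 strip_chart_i cong: continuous_on_cong)
qed

lemma inj_on_strip_chart:
  assumes "\<beta> = 1 \<or> \<beta> = \<i>"
  shows "inj_on (strip_chart p \<beta>) annulus"
proof (rule inj_onI)
  fix z w assume z: "z \<in> annulus" and w: "w \<in> annulus"
    and eq: "strip_chart p \<beta> z = strip_chart p \<beta> w"
  have small: "x = 0" if "x \<in> \<int>" "\<bar>x\<bar> < 1" for x :: real
    using that by (auto elim!: Ints_cases)
  define R where "R = (cmod z - 3/2) / 4 - (cmod w - 3/2) / 4"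
  define D where "D = Arg z / (2 * pi) - Arg w / (2 * pi)"
  have "R \<in> \<int> \<and> D \<in> \<int>"
    using assms eq Ints_minus[of D] Ints_minus[of "-D"]
    unfolding strip_chart_def torus_cover_eq_iff R_def D_def
    by (auto simp: minus_diff_eq)
  moreover have "\<bar>R\<bar> < 1"
    using z w unfolding R_def annulus_def mem_Collect_eq abs_less_iff by (simp add: field_simps)
  moreover have "\<bar>D\<bar> < 1"
  proof -
    have "\<bar>Arg z - Arg w\<bar> < 2 * pi"
      using Arg_bounded[of z] Arg_bounded[of w] by auto
    then show ?thesis
      by (simp add: D_def flip: diff_divide_distrib)
  qed
  ultimately have "R = 0" "D = 0" using small by blast+
  then have "cmod z = cmod w" "Arg z = Arg w" by (simp_all add: R_def D_def)
  then show "z = w"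
    by (metis rcis_cmod_Arg)
qed

lemma annular_chart_strips:
  "annular_chart curve_a (strip_chart 0 1)"
  "annular_chart curve_b (strip_chart (\<i> / 2) \<i>)"
  "annular_chart curve_c (strip_chart (1/2) 1)"
proof -
  have nint: "x \<notin> \<int>" if "n < x" "x < n + 1" "n \<in> \<int>" for x n :: real
    using that by (auto elim!: Ints_cases)
  have sphere: "f ` sphere 0 (3/2) = path_image g"
    if g: "\<And>t. g t = f (of_real (3/2) * cis (2 * pi * t))" for f g
  proof -
    have "sphere 0 (3/2) = (\<lambda>t. of_real (3/2) * cis (2 * pi * t)) ` {0..1}"
    proof (intro equalityI subsetI)
      fix z :: complex assume z: "z \<in> sphere 0 (3/2)"
      define t where "t = Arg2pi z / (2 * pi)"
      have "t \<in> {0..1}"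
        using Arg2pi_ge_0[of z] Arg2pi_lt_2pi[of z] by (auto simp: t_def)
      moreover have "z = of_real (3/2) * cis (2 * pi * t)"
        proof -
        have "cmod z = 3/2" using z by simp
        then show ?thesis
          using Arg2pi_eq[of z] by (simp only: t_def cis_conv_exp) simp
      qed
      ultimately show "z \<in> (\<lambda>t. of_real (3/2) * cis (2 * pi * t)) ` {0..1}" by blast
    qed (auto simp: norm_mult)
    then show ?thesis by (auto simp: path_image_def g image_image)
  qed
  have sg: "sgn (of_real (3/2) * cis (2 * pi * t)) = cis (2 * pi * t)"
    "cmod (of_real (3/2) * cis (2 * pi * t)) = 3/2"
    "of_real (3/2) * cis (2 * pi * t) \<noteq> 0" for t
    by (simp_all add: sgn_mult norm_mult sgn_div_norm scaleR_conv_of_real)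
  have avoid: "strip_chart p \<beta> ` annulus \<subseteq> punctured_torus"
    if "\<And>z. z \<in> annulus \<Longrightarrow> strip_chart p \<beta> z \<notin> marked" for p \<beta>
    using that torus_cover_in_torus by (auto simp: punctured_torus_def strip_chart_def)
  have core: "strip_chart 0 1 ` sphere 0 (3/2) = path_image curve_a"
    "strip_chart (\<i> / 2) \<i> ` sphere 0 (3/2) = path_image curve_b"
    "strip_chart (1/2) 1 ` sphere 0 (3/2) = path_image curve_c"
    by (rule sphere; simp only: strip_chart_1[OF sg(3)] strip_chart_i[OF sg(3)] sg;
        simp add: curve_a_def curve_b_def curve_c_def torus_cover_def cis_cnj)+
  have miss: "strip_chart 0 1 z \<notin> marked" "strip_chart (\<i> / 2) \<i> z \<notin> marked"
      "strip_chart (1/2) 1 z \<notin> marked" if "z \<in> annulus" for z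
  proof -
    have c: "1 \<le> cmod z" "cmod z \<le> 2" using that by (auto simp: annulus_def)
    have n: "(cmod z - 3/2) / 4 - 1/4 \<notin> \<int>" "(cmod z - 3/2) / 4 + 1/4 \<notin> \<int>"
      "1/4 + (cmod z - 3/2) / 4 \<notin> \<int>" "1/2 + (cmod z - 3/2) / 4 \<notin> \<int>"
      "3/4 + (cmod z - 3/2) / 4 \<notin> \<int>"
      by ((rule nint[of "-1"] nint[of 0]; use c in \<open>simp add: field_simps\<close>))+
    show "strip_chart 0 1 z \<notin> marked" "strip_chart (\<i> / 2) \<i> z \<notin> marked"
      "strip_chart (1/2) 1 z \<notin> marked"
      using n by (auto simp: strip_chart_def marked_def torus_cover_eq_iff)
  qed
  have b: "(1::complex) = 1 \<or> (1::complex) = \<i>" "\<i> = 1 \<or> \<i> = \<i>" by simp_all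
  note charts = continuous_on_strip_chart inj_on_strip_chart orientation_preserving_strip_chart
  show "annular_chart curve_a (strip_chart 0 1)"
    unfolding annular_chart_def using charts[OF b(1)] core(1) avoid[OF miss(1)] by blast
  show "annular_chart curve_b (strip_chart (\<i> / 2) \<i>)"
    unfolding annular_chart_def using charts[OF b(2)] core(2) avoid[OF miss(2)] by blast
  show "annular_chart curve_c (strip_chart (1/2) 1)"
    unfolding annular_chart_def using charts[OF b(1)] core(3) avoid[OF miss(3)] by blast
qed

end

theory Submission
  imports Defs
begin

text \<open>
  Three maps \<open>\<phi>\<^sub>1, \<phi>\<^sub>2, \<phi>\<^sub>3\<close> from the punctured torus to the punctured plane have winding numbers dual to
  \<open>a\<close>, \<open>b\<close>, \<open>d\<close>.  The punctured torus is the union of the two vertical annuli around \<open>a\<close> and \<open>c\<close> and the horizontal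
  annulus around \<open>b\<close>, any two of which meet in a simply connected set or not at all; so \<open>a\<close>, \<open>b\<close>, \<open>c\<close> generate the homology classes of loops,
  and every loop is determined up to homology by its three winding numbers.

  Hence a homeomorphism \<open>f\<close> acts by a matrix with rows \<open>(A, 0)\<close> and \<open>(v, e)\<close>: the loop \<open>d\<close> is null
  homotopic in the torus, and \<open>e = \<plusminus>1\<close>, \<open>det A = \<plusminus>1\<close> by invertibility.  The block \<open>A\<close> is the linear part
  of the lift of \<open>f\<close> to the plane, so \<open>f\<close> preserves orientation iff \<open>det A = 1\<close>.  By the lifting criterion
  \<open>f\<close> lifts to the unbranched part of the cover iff \<open>k\<close> divides \<open>v\<close>; such a lift extends
  over the branch points, because small punctured discs are connected and the fibres are finite.
  The given generators generate all matrices with \<open>det A = 1\<close>, \<open>e = \<plusminus>1\<close> and \<open>k\<close> dividing \<open>v\<close>: the twists \<open>T_a\<close>, \<open>T_b\<close>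
  give \<open>SL\<^sub>2(\<int>)\<close>, whose orbit of the vector \<open>v = (0, -k)\<close> spans \<open>(k\<int>)\<^sup>2\<close>.
\<close>

section \<open>Paths and chains\<close>

text \<open>The functional \<open>eta k\<close> vanishes on \<open>a\<close> and \<open>b\<close>,
  so a lift forces their images into its kernel, and the third coordinates of these images are the
  entries of \<open>v\<close>. The row \<open>v\<close> enters through \<open>T_c\<close>: the
  twists \<open>T_a\<close> and \<open>T_c\<close> have the same block, but they send
  \<open>b\<close> to \<open>b - a\<close> and \<open>b - c\<close>, which differ by the class of
  \<open>d\<close>. Hence cancelling the block of the \<open>k\<close>-th power of
  \<open>T_c\<close> leaves the pure shear with \<open>v = (0, - k)\<close>. The sign
  \<open>e = -1\<close> comes from the involution, multiplied by the central element
  \<open>-1\<close> of the block group. The homology of the punctured torus is approached from two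
  sides. Generation by curves is a potential argument with segments in the plane; segments are not
  cycles, so it is carried out with chains instead of homology classes. Independence comes from
  winding numbers, which are additive on chains and vanish on boundaries. Being invariant under free
  homotopy, they are also constant on isotopy classes, so that \<open>Psi\<close>, orientation and
  liftability all become properties of the matrix \<open>homology_matrix f\<close> of a single
  map.\<close>

definition path_simplex :: "(real \<Rightarrow> 'a) \<Rightarrow> (nat \<Rightarrow> real) \<Rightarrow> 'a" where
  "path_simplex g = (\<lambda>x\<in>standard_simplex 1. g (x 1))"

definition path_chain :: "(real \<Rightarrow> 'a) \<Rightarrow> 'a chain" where
  "path_chain g = frag_of (path_simplex g)"

abbreviation null_homologous :: "'a::topological_space set \<Rightarrow> 'a chain \<Rightarrow> bool" where
  "null_homologous X c \<equiv> singular_relboundary 1 (top_of_set X) {} c"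

lemma loop_class_eq:
  "loop_class g = homologous_rel_set 1 (top_of_set punctured_torus) {} (path_chain g)"
  by (simp add: loop_class_def path_chain_def path_simplex_def)

lemma standard_simplex_1_iff:
  "x \<in> standard_simplex (Suc 0) \<longleftrightarrow>
    x 0 = 1 - x (Suc 0) \<and> 0 \<le> x (Suc 0) \<and> x (Suc 0) \<le> 1 \<and> (\<forall>i>Suc 0. x i = 0)"
proof -
  have "0 \<le> x i \<and> x i \<le> 1"
    if "x 0 = 1 - x (Suc 0)" "0 \<le> x (Suc 0)" "x (Suc 0) \<le> 1" "\<forall>i>Suc 0. x i = 0" for i
    using that by (cases "i = 0"; cases "i = Suc 0") auto
  then show ?thesis
    unfolding standard_simplex_def by auto
qed

lemma continuous_on_coordinate [continuous_intros]:
  "continuous_on S (\<lambda>x :: 'i \<Rightarrow> 'b::topological_space. x i)"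
  by (rule continuous_on_subset[OF continuous_on_product_coordinates]) simp

lemma path_simplex_cong: "(\<And>t. t \<in> {0..1} \<Longrightarrow> g t = h t) \<Longrightarrow> path_simplex g = path_simplex h"
  unfolding path_simplex_def by (rule restrict_ext) (simp add: standard_simplex_1_iff)

lemma path_chain_cong: "(\<And>t. t \<in> {0..1} \<Longrightarrow> g t = h t) \<Longrightarrow> path_chain g = path_chain h"
  using path_simplex_cong[of g h] by (simp add: path_chain_def)

lemma singular_simplex_euclidean:
  fixes X :: "'a::topological_space set"
  shows "singular_simplex p (top_of_set X) f \<longleftrightarrow>
    continuous_on (standard_simplex p) f \<and> f ` standard_simplex p \<subseteq> X \<and> f \<in> extensional (standard_simplex p)"
  by (auto simp: singular_simplex_def euclidean_product_topology image_subset_iff_funcset)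

lemma singular_simplex_path_simplex:
  assumes "path g" "path_image g \<subseteq> X"
  shows "singular_simplex 1 (top_of_set X) (path_simplex g)"
proof -
  have "continuous_on (standard_simplex 1) (\<lambda>x. g (x 1))"
    by (rule continuous_on_compose2[OF assms(1)[unfolded path_def]])
       (auto simp: standard_simplex_1_iff intro!: continuous_intros)
  then have "continuous_on (standard_simplex 1) (path_simplex g)"
    by (rule continuous_on_eq) (simp add: path_simplex_def)
  then show ?thesis
    using assms(2) unfolding singular_simplex_euclidean
    by (auto simp: path_simplex_def path_image_def standard_simplex_1_iff)
qed

lemma singular_chain_path_chain:
  assumes "path g" "path_image g \<subseteq> X"
  shows "singular_chain 1 (top_of_set X) (path_chain g)"
  using singular_simplex_path_simplex[OF assms] by (simp add: path_chain_def singular_chain_of)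

lemma singular_relcycle_loop:
  assumes "path g" "path_image g \<subseteq> X" "pathfinish g = pathstart g"
  shows "singular_relcycle 1 (top_of_set X) {} (path_chain g)"
proof -
  \<comment> \<open>The two faces of the simplex are the endpoints of the path, which coincide for a
    loop.\<close>
  have "singular_face 1 0 (path_simplex g) = singular_face 1 1 (path_simplex g)"
  proof
    fix x :: "nat \<Rightarrow> real"
    show "singular_face 1 0 (path_simplex g) x = singular_face 1 1 (path_simplex g) x"
      using assms(3) simplical_face_in_standard_simplex[of 1 0 x] simplical_face_in_standard_simplex[of 1 1 x]
      by (auto simp: singular_face_def path_simplex_def simplical_face_def pathfinish_def pathstart_def standard_simplex_0 restrict_def)
  qed
  then have "chain_boundary 1 (path_chain g) = 0"
    by (simp add: path_chain_def chain_boundary_of)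
  then show ?thesis
    using singular_chain_path_chain[OF assms(1,2)] by (simp add: singular_cycle)
qed

text \<open>The chain is the boundary of one singular 2-simplex: \<open>F\<close> after the affine
  map from the standard simplex onto the triangle. The homologies between paths used below are
  assembled from such triangles.\<close>

lemma null_homologous_triangle:
  fixes F :: "'b::real_normed_vector \<Rightarrow> 'a::topological_space"
  assumes cont: "continuous_on (convex hull {p, q, r}) F" and im: "F ` (convex hull {p, q, r}) \<subseteq> X"
  shows "null_homologous X (path_chain (F \<circ> linepath p q) + path_chain (F \<circ> linepath q r)
                              - path_chain (F \<circ> linepath p r))"
proof -
  define l where "l x = x 0 *\<^sub>R p + x 1 *\<^sub>R q + x 2 *\<^sub>R r" for x :: "nat \<Rightarrow> real"
  define \<sigma> where "\<sigma> = (\<lambda>x\<in>standard_simplex 2. F (l x))"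
  have l: "l x \<in> convex hull {p, q, r}" if "x \<in> standard_simplex 2" for x
  proof -
    have "x 0 + x 1 + x 2 = 1" "0 \<le> x 0" "0 \<le> x 1" "0 \<le> x 2"
      using that by (auto simp: standard_simplex_def numeral_2_eq_2)
    then show ?thesis unfolding convex_hull_3 l_def by blast
  qed
  have "continuous_on (standard_simplex 2) (\<lambda>x. F (l x))"
    by (rule continuous_on_compose2[OF cont])
       (auto simp: l_def[abs_def] intro!: continuous_intros continuous_on_product_coordinates,
        use l in \<open>simp add: l_def\<close>)
  then have sing: "singular_simplex 2 (top_of_set X) \<sigma>"
    using im l unfolding singular_simplex_euclidean \<sigma>_def by (auto cong: continuous_on_cong)
  have face: "singular_face 2 k \<sigma> = path_simplex (F \<circ> linepath u v)"
    if "k \<le> 2" "\<And>x. x \<in> standard_simplex 1 \<Longrightarrow> l (simplical_face k x) = linepath u v (x 1)" for k u v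
    unfolding singular_face_def path_simplex_def
    using that simplical_face_in_standard_simplex[of 2 k]
    by (auto simp: \<sigma>_def restrict_def fun_eq_iff)
  have "singular_face 2 0 \<sigma> = path_simplex (F \<circ> linepath q r)"
    "singular_face 2 1 \<sigma> = path_simplex (F \<circ> linepath p r)"
    "singular_face 2 2 \<sigma> = path_simplex (F \<circ> linepath p q)"
    by (rule face; simp add: l_def simplical_face_def linepath_def standard_simplex_1_iff)+
  then have "chain_boundary 2 (frag_of \<sigma>) = path_chain (F \<circ> linepath p q) + path_chain (F \<circ> linepath q r)
                              - path_chain (F \<circ> linepath p r)"
    by (simp add: chain_boundary_of numeral_2_eq_2 path_chain_def)
  then show ?thesis
    unfolding singular_boundary using sing by (metis singular_chain_of Suc_1)
qed

text \<open>A degenerate triangle: its boundary is \<open>c + c - c\<close>.\<close>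

lemma null_homologous_const:
  assumes "x \<in> X"
  shows "null_homologous X (path_chain (\<lambda>_. x))"
proof -
  have "null_homologous X (path_chain ((\<lambda>_::real. x) \<circ> linepath 0 0) + path_chain ((\<lambda>_::real. x) \<circ> linepath 0 0)
                              - path_chain ((\<lambda>_::real. x) \<circ> linepath 0 0))"
    by (rule null_homologous_triangle) (use assms in auto)
  then show ?thesis by (simp add: o_def)
qed

text \<open>The straight-line homotopy inside \<open>K\<close> from \<open>l\<close> to its chord is
  a map of the square. The diagonal cuts the square into two triangles; the two sides on which the
  homotopy is constant are null homologous.\<close>

lemma null_homologous_convex:
  fixes l :: "real \<Rightarrow> 'b::real_normed_vector" and F :: "'b \<Rightarrow> 'a::topological_space"
  assumes "convex K" "path l" "path_image l \<subseteq> K" "continuous_on K F" "F ` K \<subseteq> X"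
  shows "null_homologous X (path_chain (F \<circ> l) - path_chain (F \<circ> linepath (l 0) (l 1)))"
proof -
  define H where "H z = F ((1 - snd z) *\<^sub>R l (fst z) + snd z *\<^sub>R linepath (l 0) (l 1) (fst z))" for z :: "real \<times> real"
  have lK: "l t \<in> K" if "t \<in> {0..1}" for t
    using assms(3) that by (auto simp: path_image_def)
  have in_K: "(1 - s) *\<^sub>R l t + s *\<^sub>R linepath (l 0) (l 1) t \<in> K" if "t \<in> {0..1}" "s \<in> {0..1}" for s t
  proof -
    have "linepath (l 0) (l 1) t \<in> K"
      using that lK[of 0] lK[of 1] assms(1) by (auto simp: linepath_def convex_alt)
    then show ?thesis using that lK[of t] assms(1) by (auto simp: convex_alt)
  qed
  have contH: "continuous_on ({0..1} \<times> {0..1}) H"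
    unfolding H_def
  proof (rule continuous_on_compose2[OF assms(4)])
    show "continuous_on ({0..1} \<times> {0..1}) (\<lambda>z. (1 - snd z) *\<^sub>R l (fst z) + snd z *\<^sub>R linepath (l 0) (l 1) (fst z))"
      unfolding linepath_def
      by (intro continuous_intros continuous_on_compose2[OF assms(2)[unfolded path_def]]) auto
  qed (use in_K in auto)
  have imH: "H ` ({0..1} \<times> {0..1}) \<subseteq> X"
    using in_K assms(5) by (auto simp: H_def)
  have tri: "null_homologous X (path_chain (H \<circ> linepath p q) + path_chain (H \<circ> linepath q r)
                              - path_chain (H \<circ> linepath p r))"
    if "{p, q, r} \<subseteq> {0..1} \<times> {0..1}" for p q r
  proof (rule null_homologous_triangle)
    have "convex hull {p, q, r} \<subseteq> {0..1} \<times> {0..1}"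
      using that by (intro hull_minimal convex_Times) auto
    then show "continuous_on (convex hull {p, q, r}) H" "H ` (convex hull {p, q, r}) \<subseteq> X"
      using contH imH continuous_on_subset by blast+
  qed
  have 1: "null_homologous X (path_chain (F \<circ> l) + path_chain (\<lambda>_. F (l 1)) - path_chain (H \<circ> linepath (0,0) (1,1)))"
  proof -
    have "H \<circ> linepath (0,0) (1,0) = F \<circ> l" "H \<circ> linepath (1,0) (1,1) = (\<lambda>_. F (l 1))"
      by (auto simp: H_def linepath_def fun_eq_iff algebra_simps simp flip: scaleR_add_left)
    then show ?thesis using tri[of "(0,0)" "(1,0)" "(1,1)"] by simp
  qed
  have 2: "null_homologous X (path_chain (\<lambda>_. F (l 0)) + path_chain (F \<circ> linepath (l 0) (l 1)) - path_chain (H \<circ> linepath (0,0) (1,1)))"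
  proof -
    have "H \<circ> linepath (0,0) (0,1) = (\<lambda>_. F (l 0))" "H \<circ> linepath (0,1) (1,1) = F \<circ> linepath (l 0) (l 1)"
      by (auto simp: H_def linepath_def fun_eq_iff algebra_simps simp flip: scaleR_add_left)
    then show ?thesis using tri[of "(0,0)" "(0,1)" "(1,1)"] by simp
  qed
  have "F (l 0) \<in> X" "F (l 1) \<in> X" using lK[of 0] lK[of 1] assms(5) by auto
  note 3 = this[THEN null_homologous_const]
  show ?thesis
    using singular_relboundary_add[OF singular_relboundary_diff[OF 1 2] singular_relboundary_diff[OF 3]]
    by simp
qed

text \<open>The linear extension of the winding number from paths to chains. The inner function of
  \<open>i\<close> is the point of the standard 1-simplex with parameter \<open>t\<close>. Values
  are complex because the winding number of a path that is not closed need not be an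
  integer.\<close>

definition chain_winding :: "('a \<Rightarrow> complex) \<Rightarrow> 'a chain \<Rightarrow> complex" where
  "chain_winding \<phi> c = (\<Sum>\<sigma>\<in>Poly_Mapping.keys c. of_int (Poly_Mapping.lookup c \<sigma>) *
     winding_number (\<lambda>t. \<phi> (\<sigma> (\<lambda>i. if i = 0 then 1 - t else if i = 1 then t else 0))) 0)"

text \<open>Simplices may cancel in a sum of chains, so additivity is proved by summing over a
  common finite set of simplices.\<close>

lemma chain_winding_superset:
  assumes "finite K" "Poly_Mapping.keys c \<subseteq> K"
  shows "chain_winding \<phi> c = (\<Sum>\<sigma>\<in>K. of_int (Poly_Mapping.lookup c \<sigma>) *
     winding_number (\<lambda>t. \<phi> (\<sigma> (\<lambda>i. if i = 0 then 1 - t else if i = 1 then t else 0))) 0)"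
  unfolding chain_winding_def
  by (rule sum.mono_neutral_left) (use assms in \<open>auto simp: in_keys_iff\<close>)

lemma chain_winding_add: "chain_winding \<phi> (c + d) = chain_winding \<phi> c + chain_winding \<phi> d"
proof -
  let ?K = "Poly_Mapping.keys c \<union> Poly_Mapping.keys d"
  have "Poly_Mapping.keys (c + d) \<subseteq> ?K" by (rule Poly_Mapping.keys_add)
  then show ?thesis
    by (simp add: chain_winding_superset[of ?K] lookup_add distrib_right sum.distrib)
qed

lemma chain_winding_minus: "chain_winding \<phi> (- c) = - chain_winding \<phi> c"
  by (simp add: chain_winding_def sum_negf)

lemma chain_winding_diff: "chain_winding \<phi> (c - d) = chain_winding \<phi> c - chain_winding \<phi> d"
  using chain_winding_add[of \<phi> c "-d"] by (simp add: chain_winding_minus)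

lemma chain_winding_0 [simp]: "chain_winding \<phi> 0 = 0"
  by (simp add: chain_winding_def)

lemma chain_winding_cmul: "chain_winding \<phi> (frag_cmul n c) = of_int n * chain_winding \<phi> c"
proof -
  have "Poly_Mapping.keys (frag_cmul n c) \<subseteq> Poly_Mapping.keys c" by (rule keys_cmul)
  then show ?thesis
    by (subst chain_winding_superset[of "Poly_Mapping.keys c"])
       (simp_all add: chain_winding_def sum_distrib_left mult.assoc)
qed

lemma chain_winding_path_chain: "chain_winding \<phi> (path_chain g) = winding_number (\<phi> \<circ> g) 0"
proof -
  have "chain_winding \<phi> (path_chain g) =
    winding_number (\<lambda>t. \<phi> (path_simplex g (\<lambda>i. if i = 0 then 1 - t else if i = 1 then t else 0))) 0"
    by (simp add: chain_winding_def path_chain_def)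
  also have "\<dots> = winding_number (\<phi> \<circ> g) 0"
    by (rule winding_number_cong) (simp add: path_simplex_def standard_simplex_1_iff)
  finally show ?thesis .
qed

text \<open>On a 2-simplex \<open>\<phi>\<close> has a continuous logarithm. Along each edge the
  winding number is then the difference of the logarithm at the two ends, up to the factor
  \<open>2 * pi * \<i>\<close>, and the three differences cancel with the signs of the
  boundary.\<close>

lemma chain_winding_null_homologous:
  assumes \<phi>: "continuous_on X \<phi>" "\<And>x. x \<in> X \<Longrightarrow> \<phi> x \<noteq> 0" and c: "null_homologous X c"
  shows "chain_winding \<phi> c = 0"
proof -
  define edge where "edge t = (\<lambda>i::nat. if i = 0 then 1 - t else if i = 1 then t else 0)" for t :: real
  have single: "chain_winding \<phi> (frag_of \<sigma>) = winding_number (\<lambda>t. \<phi> (\<sigma> (\<lambda>i. if i = 0 then 1 - t else if i = 1 then t else 0))) 0" for \<sigma>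
    by (simp add: chain_winding_def)
  have tri: "chain_winding \<phi> (chain_boundary 2 (frag_of \<sigma>)) = 0" if "singular_simplex 2 (top_of_set X) \<sigma>" for \<sigma>
  proof -
    have cont: "continuous_on (standard_simplex 2) \<sigma>" and im: "\<sigma> ` standard_simplex 2 \<subseteq> X"
      using that by (auto simp: singular_simplex_euclidean)
    \<comment> \<open>The logarithm is taken on a plane triangle \<open>D\<close>, mapped by
      \<open>v\<close> to the standard simplex, whose own points are infinite sequences.\<close>
    define D :: "(real \<times> real) set" where "D = {(s, t). 0 \<le> s \<and> 0 \<le> t \<and> s + t \<le> 1}"
    define v where "v z = (\<lambda>i::nat. if i = 0 then 1 - fst z - snd z else if i = 1 then fst z else if i = 2 then snd z else 0 :: real)" for z :: "real \<times> real"
    have vD: "v z \<in> standard_simplex 2" if "z \<in> D" for z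
      using that by (auto simp: D_def v_def standard_simplex_def numeral_2_eq_2)
    have "continuous_on D (\<lambda>z. \<phi> (\<sigma> (v z)))"
    proof (rule continuous_on_compose2[OF \<phi>(1)])
      show "continuous_on D (\<lambda>z. \<sigma> (v z))"
      proof (rule continuous_on_compose2[OF cont])
        show "continuous_on D v"
        proof (rule continuous_on_coordinatewise_then_product)
          fix i :: nat
          consider "i = 0" | "i = 1" | "i = 2" | "i > 2" by linarith
          then show "continuous_on D (\<lambda>x. v x i)"
            by cases (auto simp: v_def intro!: continuous_intros)
        qed
      qed (use vD in auto)
    qed (use vD im in auto)
    moreover have "convex D"
    proof -
      have "D = {z. inner (-1, 0) z \<le> 0} \<inter> {z. inner (0, -1) z \<le> 0} \<inter> {z. inner (1, 1) z \<le> 1}"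
        by (auto simp: D_def)
      then show ?thesis by (simp add: convex_Int convex_halfspace_le)
    qed
    ultimately obtain g where g: "continuous_on D g" "\<And>z. z \<in> D \<Longrightarrow> \<phi> (\<sigma> (v z)) = exp (g z)"
      using continuous_logarithm_on_contractible[of D "\<lambda>z. \<phi> (\<sigma> (v z))"] convex_imp_contractible \<phi>(2) vD im
      by (metis image_subset_iff)
    have face: "chain_winding \<phi> (frag_of (singular_face 2 k \<sigma>)) = (g (l 1) - g (l 0)) / (2 * of_real pi * \<i>)"
      if l: "continuous_on {0..1} l" "\<And>t. t \<in> {0..1} \<Longrightarrow> l t \<in> D \<and> v (l t) = simplical_face k (edge t)" for k l
    proof -
      have "chain_winding \<phi> (frag_of (singular_face 2 k \<sigma>)) = winding_number (exp \<circ> (g \<circ> l)) 0"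
        unfolding single
      proof (rule winding_number_cong)
        fix t :: real assume t: "0 \<le> t" "t \<le> 1"
        then have "edge t \<in> standard_simplex 1" by (auto simp: standard_simplex_1_iff edge_def)
        then show "\<phi> (singular_face 2 k \<sigma> (\<lambda>i. if i = 0 then 1 - t else if i = 1 then t else 0)) = (exp \<circ> (g \<circ> l)) t"
          using l(2)[of t] g(2)[of "l t"] t by (simp add: singular_face_def flip: edge_def)
      qed
      also have "\<dots> = (pathfinish (g \<circ> l) - pathstart (g \<circ> l)) / (2 * of_real pi * \<i>)"
        by (rule winding_number_compose_exp, unfold path_def, rule continuous_on_compose[OF l(1)])
           (use l g(1) in \<open>auto intro: continuous_on_subset\<close>)
      finally show ?thesis by (simp add: pathfinish_def pathstart_def)
    qed
    have f0: "chain_winding \<phi> (frag_of (singular_face 2 0 \<sigma>)) = (g (0,1) - g (1,0)) / (2 * of_real pi * \<i>)"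
      by (subst face[of "\<lambda>t. (1 - t, t)"]) (auto simp: D_def v_def simplical_face_def edge_def fun_eq_iff intro!: continuous_intros)
    have f1: "chain_winding \<phi> (frag_of (singular_face 2 1 \<sigma>)) = (g (0,1) - g (0,0)) / (2 * of_real pi * \<i>)"
      by (subst face[of "\<lambda>t. (0, t)"]) (auto simp: D_def v_def simplical_face_def edge_def fun_eq_iff intro!: continuous_intros)
    have f2: "chain_winding \<phi> (frag_of (singular_face 2 2 \<sigma>)) = (g (1,0) - g (0,0)) / (2 * of_real pi * \<i>)"
      by (subst face[of "\<lambda>t. (t, 0)"]) (auto simp: D_def v_def simplical_face_def edge_def fun_eq_iff intro!: continuous_intros)
    have "chain_boundary 2 (frag_of \<sigma>) = frag_of (singular_face 2 0 \<sigma>) - frag_of (singular_face 2 1 \<sigma>) + frag_of (singular_face 2 2 \<sigma>)"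
      by (simp add: chain_boundary_of numeral_2_eq_2)
    then show ?thesis
      by (simp add: chain_winding_add chain_winding_diff f0 f1 f2 diff_divide_distrib del: One_nat_def)
  qed
  obtain d where d: "singular_chain 2 (top_of_set X) d" "chain_boundary 2 d = c"
    using c unfolding singular_boundary by (auto simp: numeral_2_eq_2)
  have "chain_winding \<phi> (chain_boundary 2 d) = 0"
  proof (rule frag_induction[of d "singular_simplex_set 2 (top_of_set X)" "\<lambda>d. chain_winding \<phi> (chain_boundary 2 d) = 0"])
    show "Poly_Mapping.keys d \<subseteq> singular_simplex_set 2 (top_of_set X)"
      using d by (simp add: singular_chain_def)
  qed (auto simp: tri chain_boundary_diff chain_winding_diff)
  then show ?thesis using d by simp
qed

section \<open>Loops in the punctured torus\<close>

lemma continuous_on_torus_cover [continuous_intros]: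
  "continuous_on S f \<Longrightarrow> continuous_on S (\<lambda>x. torus_cover (f x))"
  unfolding torus_cover_def by (intro continuous_intros)

lemma torus_cover_add_Ints:
  assumes "Re w \<in> \<int>" "Im w \<in> \<int>"
  shows "torus_cover (z + w) = torus_cover z" "torus_cover (w + z) = torus_cover z"
  using assms by (simp_all add: torus_cover_eq_iff)

lemma marked_eq: "marked = {(\<i>, 1), (- \<i>, 1)}"
  by (simp add: marked_def torus_cover_def complex_eq_iff)

text \<open>Modulo the integers, \<open>1/4\<close> and \<open>- 1/4\<close> are exactly the
  solutions of \<open>2 * x = 1/2\<close>; this merges the two marked points into one
  condition.\<close>

lemma torus_cover_in_punctured_torus:
  "torus_cover z \<in> punctured_torus \<longleftrightarrow> \<not> (Im z \<in> \<int> \<and> 2 * Re z - 1/2 \<in> \<int>)"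
proof -
  have "x - 1/4 \<in> \<int> \<or> x + 1/4 \<in> \<int> \<longleftrightarrow> 2 * x - 1/2 \<in> \<int>" for x :: real
  proof
    assume "x - 1/4 \<in> \<int> \<or> x + 1/4 \<in> \<int>"
    then obtain n :: int where "x - 1/4 = n \<or> x + 1/4 = n" by (auto elim!: Ints_cases)
    then have "2 * x - 1/2 = of_int (2 * n) \<or> 2 * x - 1/2 = of_int (2 * n - 1)" by auto
    then show "2 * x - 1/2 \<in> \<int>" by (metis Ints_of_int)
  next
    assume "2 * x - 1/2 \<in> \<int>"
    then obtain n :: int where n: "2 * x - 1/2 = n" by (auto elim!: Ints_cases)
    have "\<exists>m. n = 2 * m \<or> n = 2 * m - 1" by presburger
    then obtain m where "n = 2 * m \<or> n = 2 * m - 1" by blast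
    then have "x - 1/4 = of_int m \<or> x + 1/4 = of_int m" using n by auto
    then show "x - 1/4 \<in> \<int> \<or> x + 1/4 \<in> \<int>" by (metis Ints_of_int)
  qed
  then show ?thesis
    unfolding punctured_torus_def marked_def
    by (auto simp: torus_cover_in_torus torus_cover_eq_iff)
qed

text \<open>On a contractible set each coordinate has a continuous logarithm, which is purely
  imaginary because the coordinate has modulus 1.\<close>

lemma lift_to_plane:
  fixes K :: "'b::real_normed_vector set"
  assumes "contractible K" "continuous_on K f" "f ` K \<subseteq> torus"
  obtains l where "continuous_on K l" "\<And>x. x \<in> K \<Longrightarrow> torus_cover (l x) = f x"
proof -
  have "\<exists>g. continuous_on K g \<and> (\<forall>x\<in>K. h x = cis (2 * pi * g x))"
    if h: "continuous_on K h" "\<And>x. x \<in> K \<Longrightarrow> cmod (h x) = 1" for h :: "'b \<Rightarrow> complex"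
  proof -
    have "\<And>x. x \<in> K \<Longrightarrow> h x \<noteq> 0" using h(2) by fastforce
    then obtain g where g: "continuous_on K g" "\<And>x. x \<in> K \<Longrightarrow> h x = exp (g x)"
      using continuous_logarithm_on_contractible[OF h(1) assms(1)] by blast
    have "Re (g x) = 0" if "x \<in> K" for x
      using h(2)[OF that] g(2)[OF that] by simp
    then have "h x = cis (2 * pi * (Im (g x) / (2 * pi)))" if "x \<in> K" for x
      using g(2)[OF that] that exp_eq_polar[of "g x"] by simp
    then show ?thesis
      using g(1) by (intro exI[of _ "\<lambda>x. Im (g x) / (2 * pi)"]) (auto intro!: continuous_intros)
  qed
  note * = this
  have "continuous_on K (\<lambda>x. fst (f x))" "continuous_on K (\<lambda>x. snd (f x))"
    using assms(2) by (intro continuous_intros; assumption)+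
  moreover have "cmod (fst (f x)) = 1" "cmod (snd (f x)) = 1" if "x \<in> K" for x
    using assms(3) that by (auto simp: torus_def mem_Times_iff)
  ultimately obtain g h where
    g: "continuous_on K g" "\<forall>x\<in>K. fst (f x) = cis (2 * pi * g x)" and
    h: "continuous_on K h" "\<forall>x\<in>K. snd (f x) = cis (2 * pi * h x)"
    using *[of "\<lambda>x. fst (f x)"] *[of "\<lambda>x. snd (f x)"] by blast
  show thesis
  proof
    show "continuous_on K (\<lambda>x. Complex (g x) (h x))"
      unfolding Complex_eq using g h by (intro continuous_intros) auto
    show "torus_cover (Complex (g x) (h x)) = f x" if "x \<in> K" for x
      using g h that by (simp add: torus_cover_def prod_eq_iff)
  qed
qed

lemma lift_path_to_plane:
  assumes "path g" "path_image g \<subseteq> torus"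
  obtains l where "path l" "\<And>t. t \<in> {0..1} \<Longrightarrow> torus_cover (l t) = g t"
  using lift_to_plane[of "{0..1}" g] assms
  by (metis convex_imp_contractible convex_real_interval(5) path_def path_image_def)

section \<open>Chains homologous to integral combinations of a, b and c\<close>

definition loop_in :: "'a::topological_space set \<Rightarrow> (real \<Rightarrow> 'a) \<Rightarrow> bool" where
  "loop_in X g \<longleftrightarrow> path g \<and> path_image g \<subseteq> X \<and> pathfinish g = pathstart g"

abbreviation curve_comb :: "int \<Rightarrow> int \<Rightarrow> int \<Rightarrow> (complex \<times> complex) chain" where
  "curve_comb m n k \<equiv>
    frag_cmul m (path_chain curve_a) + frag_cmul n (path_chain curve_b) + frag_cmul k (path_chain curve_c)"

text \<open>A subgroup of all chains, not of homology classes: congruences modulo it also make sense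
  for segments and paths that are not closed.\<close>

definition curve_span :: "(complex \<times> complex) chain set" where
  "curve_span = {c. \<exists>m n k. null_homologous punctured_torus
     (c - curve_comb m n k)}"

lemma curve_span_null: "null_homologous punctured_torus c \<Longrightarrow> c \<in> curve_span"
  unfolding curve_span_def mem_Collect_eq by (intro exI[of _ 0]) simp

lemma curve_span_add:
  assumes "c \<in> curve_span" "d \<in> curve_span"
  shows "c + d \<in> curve_span"
proof -
  obtain m n k where 1: "null_homologous punctured_torus
     (c - curve_comb m n k)"
    using assms(1) by (auto simp: curve_span_def)
  obtain m' n' k' where 2: "null_homologous punctured_torus
     (d - curve_comb m' n' k')"
    using assms(2) by (auto simp: curve_span_def)
  have "c + d - (frag_cmul (m + m') (path_chain curve_a) + frag_cmul (n + n') (path_chain curve_b)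
            + frag_cmul (k + k') (path_chain curve_c))
      = (c - curve_comb m n k)
      + (d - curve_comb m' n' k')"
    by (simp add: frag_cmul_distrib)
  with singular_relboundary_add[OF 1 2] show ?thesis
    unfolding curve_span_def mem_Collect_eq by metis
qed

lemma curve_span_minus:
  assumes "c \<in> curve_span"
  shows "- c \<in> curve_span"
proof -
  obtain m n k where 1: "null_homologous punctured_torus
     (c - curve_comb m n k)"
    using assms(1) by (auto simp: curve_span_def)
  then have "null_homologous punctured_torus
     (- (c - curve_comb m n k))"
    using singular_relboundary_minus by blast
  then show ?thesis
    unfolding curve_span_def mem_Collect_eq
    by (rule_tac exI[of _ "- m"], rule_tac exI[of _ "- n"], rule_tac exI[of _ "- k"])
       (simp del: minus_frag_cmul add: minus_frag_cmul[symmetric] algebra_simps)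
qed

lemma curve_span_diff: "c \<in> curve_span \<Longrightarrow> d \<in> curve_span \<Longrightarrow> c - d \<in> curve_span"
  using curve_span_add[of c "- d"] curve_span_minus by simp

lemma curve_span_cancel: "c \<in> curve_span \<Longrightarrow> c - d \<in> curve_span \<Longrightarrow> d \<in> curve_span"
  using curve_span_diff[of c "c - d"] by simp

lemma curve_span_curves:
  "path_chain curve_a \<in> curve_span" "path_chain curve_b \<in> curve_span" "path_chain curve_c \<in> curve_span"
proof -
  show "path_chain curve_a \<in> curve_span" unfolding curve_span_def mem_Collect_eq
    by (intro exI[of _ 1] exI[of _ 0]) simp
  show "path_chain curve_b \<in> curve_span" unfolding curve_span_def mem_Collect_eq
    by (rule exI[of _ 0], rule exI[of _ 1], rule exI[of _ 0]) simp
  show "path_chain curve_c \<in> curve_span" unfolding curve_span_def mem_Collect_eq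
    by (rule exI[of _ 0], rule exI[of _ 0], rule exI[of _ 1]) simp
qed

section \<open>Segments in the strips that cover the plane without the lifts of the marked
  points\<close>

abbreviation segment_chain :: "complex \<Rightarrow> complex \<Rightarrow> (complex \<times> complex) chain" where
  "segment_chain z w \<equiv> path_chain (torus_cover \<circ> linepath z w)"

lemma segment_chain_shift:
  assumes "Re v \<in> \<int>" "Im v \<in> \<int>"
  shows "segment_chain (z + v) (w + v) = segment_chain z w"
proof (rule path_chain_cong)
  fix t
  have "linepath (z + v) (w + v) t = linepath z w t + v"
    by (simp add: linepath_def algebra_simps flip: scaleR_add_left)
  then show "(torus_cover \<circ> linepath (z + v) (w + v)) t = (torus_cover \<circ> linepath z w) t"
    using torus_cover_add_Ints[OF assms] by simp
qed

text \<open>Components of the preimages of the open annuli around the three curves. The horizontal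
  strips lie around lifts of \<open>b\<close>; vertical strip \<open>m\<close> has the core line
  \<open>Re z = m / 2\<close>, which lies over \<open>a\<close> for even \<open>m\<close> and over
  \<open>c\<close> for odd \<open>m\<close>. Every bounding line passes through lifts of marked
  points.\<close>

definition horizontal_strip :: "int \<Rightarrow> complex set" where
  "horizontal_strip n = {z. of_int n < Im z \<and> Im z < of_int n + 1}"

definition vertical_strip :: "int \<Rightarrow> complex set" where
  "vertical_strip m = {z. of_int m / 2 - 1/4 < Re z \<and> Re z < of_int m / 2 + 1/4}"

definition strips :: "complex set set" where
  "strips = range horizontal_strip \<union> range vertical_strip"

lemma strips_open_convex: "K \<in> strips \<Longrightarrow> open K \<and> convex K"
proof -
  have "horizontal_strip n = {z. Im z > of_int n} \<inter> {z. Im z < of_int n + 1}"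
    "vertical_strip n = {z. Re z > of_int n / 2 - 1/4} \<inter> {z. Re z < of_int n / 2 + 1/4}" for n
    by (auto simp: horizontal_strip_def vertical_strip_def)
  then show "K \<in> strips \<Longrightarrow> open K \<and> convex K"
    unfolding strips_def
    by (auto simp: open_halfspace_Im_gt open_halfspace_Im_lt open_halfspace_Re_gt open_halfspace_Re_lt
      convex_halfspace_Im_gt convex_halfspace_Im_lt convex_halfspace_Re_gt convex_halfspace_Re_lt
      intro!: open_Int convex_Int)
qed

lemma not_Ints_between: "of_int n < x \<Longrightarrow> x < of_int n + 1 \<Longrightarrow> x \<notin> \<int>" for x :: real
  by (auto elim!: Ints_cases)

lemma Union_strips: "\<Union>strips = {z. torus_cover z \<in> punctured_torus}"
proof (intro equalityI subsetI)
  fix z assume "z \<in> \<Union>strips"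
  then consider n where "z \<in> horizontal_strip n" | m where "z \<in> vertical_strip m"
    by (auto simp: strips_def)
  then show "z \<in> {z. torus_cover z \<in> punctured_torus}"
  proof cases
    case 1 then show ?thesis
      using not_Ints_between by (auto simp: torus_cover_in_punctured_torus horizontal_strip_def)
  next
    case 2
    then have "2 * Re z - 1/2 \<notin> \<int>"
      by (intro not_Ints_between[of "m - 1"]) (auto simp: vertical_strip_def)
    then show ?thesis by (auto simp: torus_cover_in_punctured_torus)
  qed
next
  fix z assume "z \<in> {z. torus_cover z \<in> punctured_torus}"
  then consider "Im z \<notin> \<int>" | "2 * Re z - 1/2 \<notin> \<int>" by (auto simp: torus_cover_in_punctured_torus)
  then show "z \<in> \<Union>strips"
  proof cases
    case 1
    then have "Im z \<noteq> of_int \<lfloor>Im z\<rfloor>" by (metis Ints_of_int)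
    then have "z \<in> horizontal_strip \<lfloor>Im z\<rfloor>" by (auto simp: horizontal_strip_def) linarith+
    then show ?thesis by (auto simp: strips_def)
  next
    case 2
    then have "2 * Re z - 1/2 \<noteq> of_int \<lfloor>2 * Re z - 1/2\<rfloor>" by (metis Ints_of_int)
    moreover have "of_int \<lfloor>2 * Re z - 1/2\<rfloor> \<le> 2 * Re z - 1/2" "2 * Re z - 1/2 < of_int \<lfloor>2 * Re z - 1/2\<rfloor> + 1"
      by linarith+
    \<comment> \<open>On vertical strip \<open>m\<close> the quantity \<open>2 * Re z - 1/2\<close>
      lies strictly between \<open>m - 1\<close> and \<open>m\<close>, hence the index is the floor
      plus 1.\<close>
    ultimately have "z \<in> vertical_strip (\<lfloor>2 * Re z - 1/2\<rfloor> + 1)"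
      by (simp add: vertical_strip_def field_simps)
    then show ?thesis by (auto simp: strips_def)
  qed
qed

lemma segment_chain_triangle:
  assumes "K \<in> strips" "x \<in> K" "y \<in> K" "z \<in> K"
  shows "null_homologous punctured_torus (segment_chain x y + segment_chain y z - segment_chain x z)"
proof (rule null_homologous_triangle)
  have "convex hull {x, y, z} \<subseteq> K" using assms strips_open_convex by (intro hull_minimal) auto
  then show "torus_cover ` (convex hull {x, y, z}) \<subseteq> punctured_torus"
    using assms(1) Union_strips by blast
qed (intro continuous_intros)

lemma segment_chain_refl:
  assumes "K \<in> strips" "x \<in> K"
  shows "null_homologous punctured_torus (segment_chain x x)"
  using segment_chain_triangle[OF assms assms(2,2)] by simp

lemma segment_chain_four:
  assumes "K \<in> strips" "x \<in> K" "y \<in> K" "z \<in> K" "w \<in> K"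
  shows "null_homologous punctured_torus (segment_chain x y + segment_chain y z + segment_chain z w - segment_chain x w)"
  using singular_relboundary_add[OF segment_chain_triangle[of K x y z] segment_chain_triangle[of K x z w]] assms
  by (simp add: algebra_simps)

text \<open>At the point \<open>w\<close> the segment is a chain of translates of one period, all
  with the same projection. Passing from \<open>w\<close> to \<open>z\<close> costs nothing, since
  the two segments that join the ends are translates of each other and cancel in the torus.\<close>

lemma segment_chain_translate:
  assumes K: "K \<in> strips" "\<And>z t. z \<in> K \<Longrightarrow> z + of_real t * v \<in> K"
    and v: "Re v \<in> \<int>" "Im v \<in> \<int>" and w: "w \<in> K" "segment_chain w (w + v) \<in> curve_span" and z: "z \<in> K"
  shows "segment_chain z (z + of_int n * v) \<in> curve_span"
proof -
  have Kn: "z + of_int n * v \<in> K" if "z \<in> K" for z n using K(2)[OF that, of "of_int n"] by simp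
  have nv: "Re (of_int n * v) \<in> \<int>" "Im (of_int n * v) \<in> \<int>" for n
    using v by auto
  have base: "segment_chain w (w + of_int n * v) \<in> curve_span" for n
  proof (induction n rule: int_induct[of _ 0])
    case base
    show ?case using curve_span_null[OF segment_chain_refl[OF K(1) w(1)]]
      by (simp only: of_int_0 mult_zero_left add_0_right)
  next
    case (step1 i)
    have "null_homologous punctured_torus (segment_chain w (w + of_int i * v)
       + segment_chain (w + of_int i * v) (w + v + of_int i * v) - segment_chain w (w + v + of_int i * v))"
      using Kn[of w i] Kn[of w "i+1"] w K(1) by (intro segment_chain_triangle[of K]) (auto simp: algebra_simps)
    then have "segment_chain w (w + of_int i * v) + segment_chain w (w + v) - segment_chain w (w + v + of_int i * v) \<in> curve_span"
      using curve_span_null segment_chain_shift[OF nv[of i]] by metis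
    with curve_span_add[OF step1(2) w(2)] have "segment_chain w (w + v + of_int i * v) \<in> curve_span"
      by (rule curve_span_cancel)
    moreover have "w + v + of_int i * v = w + of_int (i + 1) * v" by (simp add: algebra_simps)
    ultimately show ?case by (simp add: o_def)
  next
    case (step2 i)
    have "null_homologous punctured_torus (segment_chain w (w + of_int (i - 1) * v)
       + segment_chain (w + of_int (i - 1) * v) (w + v + of_int (i - 1) * v) - segment_chain w (w + v + of_int (i - 1) * v))"
      using Kn[of w i] Kn[of w "i-1"] w K(1) by (intro segment_chain_triangle[of K]) (auto simp: algebra_simps)
    then have "segment_chain w (w + of_int (i - 1) * v) + segment_chain w (w + v) - segment_chain w (w + v + of_int (i - 1) * v) \<in> curve_span"
      using curve_span_null segment_chain_shift[OF nv[of "i-1"]] by metis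
    moreover have "w + v + of_int (i - 1) * v = w + of_int i * v" by (simp add: algebra_simps)
    ultimately have "segment_chain w (w + of_int (i - 1) * v) + segment_chain w (w + v) - segment_chain w (w + of_int i * v) \<in> curve_span"
      by (simp only:)
    from curve_span_add[OF this curve_span_diff[OF step2(2) w(2)]]
    show ?case by (simp add: o_def)
  qed
  have 1: "segment_chain z w + segment_chain w (w + of_int n * v) - segment_chain z (w + of_int n * v) \<in> curve_span"
    using segment_chain_triangle[OF K(1)] Kn z w by (intro curve_span_null) auto
  \<comment> \<open>Together with the preceding triangle this fills the parallelogram with corners
    \<open>z\<close>, \<open>w\<close> and their translates.\<close>
  have 2: "segment_chain z (z + of_int n * v) + segment_chain z w - segment_chain z (w + of_int n * v) \<in> curve_span"
    using segment_chain_triangle[OF K(1), of z "z + of_int n * v" "w + of_int n * v"] Kn z w segment_chain_shift[OF nv[of n], of z w]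
    by (intro curve_span_null) auto
  have "segment_chain z (z + of_int n * v) = segment_chain w (w + of_int n * v)
    + ((segment_chain z (z + of_int n * v) + segment_chain z w - segment_chain z (w + of_int n * v))
     - (segment_chain z w + segment_chain w (w + of_int n * v) - segment_chain z (w + of_int n * v)))"
    by simp
  then show ?thesis using curve_span_add[OF base curve_span_diff[OF 2 1]] by metis
qed

text \<open>The core line of the strip projects to \<open>a\<close> or to \<open>c\<close>,
  depending on the parity of \<open>m\<close>.\<close>

lemma vertical_strip_translate:
  assumes "z \<in> vertical_strip m"
  shows "segment_chain z (z + of_int n * \<i>) \<in> curve_span"
proof -
  obtain w where w: "w \<in> vertical_strip m" "segment_chain w (w + \<i>) \<in> curve_span"
  proof (cases "even m")
    case True
    then obtain j where j: "m = 2 * j" by blast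
    have "segment_chain (of_int j) (of_int j + \<i>) = segment_chain 0 \<i>"
      using segment_chain_shift[of "of_int j" 0 \<i>] by (simp add: add.commute)
    also have "\<dots> = path_chain curve_a"
      by (rule path_chain_cong) (simp add: curve_a_def linepath_def complex_eq_iff, simp add: torus_cover_def)
    finally show ?thesis
      using curve_span_curves that[of "of_int j"] by (simp add: vertical_strip_def j)
  next
    case False
    then obtain j where j: "m = 2 * j + 1" by (auto elim: oddE)
    have "segment_chain (1/2 + of_int j) (1/2 + \<i> + of_int j) = segment_chain (1/2) (1/2 + \<i>)"
      using segment_chain_shift[of "of_int j" "1/2" "1/2 + \<i>"] by simp
    also have "\<dots> = path_chain curve_c"
      by (rule path_chain_cong) (simp add: curve_c_def linepath_def torus_cover_def flip: add_divide_distrib)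
    finally show ?thesis
      using curve_span_curves that[of "1/2 + of_int j"] by (simp add: vertical_strip_def j field_simps)
  qed
  show ?thesis
    by (rule segment_chain_translate[OF _ _ _ _ w assms])
       (auto simp: strips_def, auto simp: vertical_strip_def)
qed

lemma horizontal_strip_translate:
  assumes "z \<in> horizontal_strip 0"
  shows "segment_chain z (z + of_int n) \<in> curve_span"
proof -
  have "segment_chain (\<i>/2) (\<i>/2 + (- 1)) \<in> curve_span"
  proof -
    have "segment_chain (\<i>/2) (\<i>/2 + (- 1)) = path_chain curve_b"
      by (rule path_chain_cong) (simp add: curve_b_def linepath_def torus_cover_def flip: add_divide_distrib)
    then show ?thesis using curve_span_curves by simp
  qed
  \<comment> \<open>The curve \<open>b\<close> runs in the direction of decreasing real part, so the
    period is \<open>- 1\<close> and it is repeated \<open>- n\<close> times.\<close>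
  then have "segment_chain z (z + of_int (- n) * (- 1)) \<in> curve_span"
    by (rule segment_chain_translate[rotated 5, OF _ assms])
       (auto simp: strips_def, auto simp: horizontal_strip_def)
  then show ?thesis by simp
qed

text \<open>A path to \<open>z\<close>, or to a translate of \<open>z\<close> by an integral multiple of \<open>\<i>\<close>, from the base
  point \<open>\<i>/2\<close> along the line \<open>Im z = 1/2\<close> and then vertically.\<close>

definition base_chain :: "complex \<Rightarrow> (complex \<times> complex) chain" where
  "base_chain z = segment_chain (\<i>/2) (Complex (Re z) (1/2)) +
     segment_chain (Complex (Re z) (1/2)) (Complex (Re z) (frac (Im z)))"

text \<open>In a horizontal strip everything can be translated into strip 0, where convexity makes
  the two routes homologous. In a vertical strip the routes agree once the vertical legs are
  prolonged by whole turns around the core, and these are multiples of \<open>a\<close> or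
  \<open>c\<close>.\<close>

lemma base_chain_strip:
  assumes K: "K \<in> strips" "z \<in> K" "w \<in> K"
  shows "segment_chain z w - base_chain w + base_chain z \<in> curve_span"
proof -
  let ?h = "horizontal_strip 0" and ?z = "Complex (Re z) (1/2)" and ?w = "Complex (Re w) (1/2)"
  have h: "?h \<in> strips" by (simp add: strips_def)
  have mid: "\<i>/2 \<in> ?h" "Complex x (1/2) \<in> ?h" for x by (simp_all add: horizontal_strip_def)
  have P: "null_homologous punctured_torus (segment_chain (\<i>/2) ?z
     + segment_chain ?z ?w - segment_chain (\<i>/2) ?w)"
    using segment_chain_triangle[OF h mid(1) mid(2) mid(2)] .
  from K(1) consider n where "K = horizontal_strip n" | m where "K = vertical_strip m"
    by (auto simp: strips_def)
  then show ?thesis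
  proof cases
    case 1
    define z' w' where "z' = Complex (Re z) (frac (Im z))" and "w' = Complex (Re w) (frac (Im w))"
    have fl: "\<lfloor>Im z\<rfloor> = n" "\<lfloor>Im w\<rfloor> = n"
      using K 1 by (auto simp: horizontal_strip_def floor_eq_iff)
    then have zw: "z = z' + of_int n * \<i>" "w = w' + of_int n * \<i>"
      by (auto simp: z'_def w'_def complex_eq_iff frac_def)
    have h': "z' \<in> ?h" "w' \<in> ?h"
      using K 1 fl by (auto simp: horizontal_strip_def z'_def w'_def frac_def)
    have "segment_chain z w = segment_chain z' w'"
      unfolding zw by (rule segment_chain_shift) auto
    moreover have A: "null_homologous punctured_torus
      (segment_chain (\<i>/2) ?z + segment_chain ?z z' + segment_chain z' w' - segment_chain (\<i>/2) w')"
      by (rule segment_chain_four[OF h]) (use mid h' in auto)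
    moreover have B: "null_homologous punctured_torus
      (segment_chain (\<i>/2) ?w + segment_chain ?w w' - segment_chain (\<i>/2) w')"
      by (rule segment_chain_triangle[OF h]) (use mid h' in auto)
    ultimately show ?thesis
      using curve_span_null[OF singular_relboundary_diff[OF A B]] unfolding base_chain_def z'_def[symmetric] w'_def[symmetric]
      by (simp add: algebra_simps)
  next
    case 2
    have v: "Complex (Re z) y \<in> K" "Complex (Re w) y \<in> K" for y
      using K 2 by (auto simp: vertical_strip_def)
    \<comment> \<open>Reducing the height to its fractional part changes the vertical leg by
      \<open>\<lfloor>y\<rfloor>\<close> turns around the core of the strip.\<close>
    have vert: "segment_chain (Complex x (1/2)) (Complex x y) - segment_chain (Complex x (1/2)) (Complex x (frac y)) \<in> curve_span"
      if x: "\<And>y. Complex x y \<in> K" for x y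
    proof -
      let ?s = "Complex x (1/2)" and ?n = "of_int \<lfloor>y\<rfloor> * \<i>"
      have y: "Complex x y = Complex x (frac y) + ?n" by (simp add: complex_eq_iff frac_def)
      have "null_homologous punctured_torus (segment_chain ?s (?s + ?n) + segment_chain (?s + ?n) (Complex x (frac y) + ?n)
         - segment_chain ?s (Complex x (frac y) + ?n))"
        using x[of "1/2 + of_int \<lfloor>y\<rfloor>"] x[of y] x[of "1/2"]
        by (intro segment_chain_triangle[OF K(1)]) (auto simp: complex_eq_iff Complex_eq frac_def algebra_simps)
      moreover have "segment_chain (?s + ?n) (Complex x (frac y) + ?n) = segment_chain ?s (Complex x (frac y))"
        by (rule segment_chain_shift) auto
      ultimately have "null_homologous punctured_torus (segment_chain ?s (?s + ?n) + segment_chain ?s (Complex x (frac y))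
         - segment_chain ?s (Complex x (frac y) + ?n))"
        by simp
      moreover have "segment_chain ?s (?s + ?n) \<in> curve_span"
        using x[of "1/2"] 2 vertical_strip_translate by blast
      ultimately have "segment_chain ?s (?s + ?n) - (segment_chain ?s (?s + ?n) + segment_chain ?s (Complex x (frac y))
         - segment_chain ?s (Complex x (frac y) + ?n)) \<in> curve_span"
        using curve_span_diff curve_span_null by blast
      then show ?thesis unfolding y[symmetric] by simp
    qed
    have 3: "null_homologous punctured_torus (segment_chain ?z z + segment_chain z w - segment_chain ?z w)"
      by (rule segment_chain_triangle[OF K(1)]) (use K v in auto)
    have 4: "null_homologous punctured_torus (segment_chain ?z ?w + segment_chain ?w w - segment_chain ?z w)"
      by (rule segment_chain_triangle[OF K(1)]) (use K v in auto)
    note 5 = vert[of "Re z" "Im z", OF v(1)] vert[of "Re w" "Im w", OF v(2)]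
    show ?thesis
      using curve_span_add[OF curve_span_add[OF curve_span_null[OF P] curve_span_null[OF singular_relboundary_diff[OF 3 4]]]
        curve_span_diff[OF 5(2,1)]]
      by (simp add: base_chain_def algebra_simps)
  qed
qed

text \<open>Vertical periods are absorbed by \<open>frac\<close>. A horizontal period shifts the
  whole vertical leg, which does not change its projection, and prolongs the horizontal leg by turns
  along \<open>b\<close>.\<close>

lemma base_chain_periodic:
  assumes "torus_cover z = torus_cover w"
  shows "base_chain w - base_chain z \<in> curve_span"
proof -
  obtain m n :: int where "Re w - Re z = m" "Im w - Im z = n"
    using assms[symmetric] unfolding torus_cover_eq_iff by (auto elim!: Ints_cases)
  then have "Re w = Re z + m" "Im w = Im z + n" by simp_all
  then have w: "Re w = Re z + m" "frac (Im w) = frac (Im z)" by (simp_all add: frac_def)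
  let ?h = "horizontal_strip 0" and ?z = "Complex (Re z) (1/2)"
  have h: "?h \<in> strips" by (simp add: strips_def)
  have mid: "\<i>/2 \<in> ?h" "Complex x (1/2) \<in> ?h" for x by (simp_all add: horizontal_strip_def)
  have "segment_chain (?z + of_int m) (Complex (Re z) (frac (Im z)) + of_int m) = segment_chain ?z (Complex (Re z) (frac (Im z)))"
    by (rule segment_chain_shift) auto
  moreover have c: "Complex (Re w) y = Complex (Re z) y + of_int m" for y
    by (simp add: complex_eq_iff w)
  ultimately have b: "base_chain w - base_chain z = segment_chain (\<i>/2) (?z + of_int m) - segment_chain (\<i>/2) ?z"
    by (simp add: base_chain_def w(2))
  have "null_homologous punctured_torus (segment_chain (\<i>/2) ?z + segment_chain ?z (?z + of_int m) - segment_chain (\<i>/2) (?z + of_int m))"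
    using mid c by (intro segment_chain_triangle[OF h]) (auto simp flip: c)
  from curve_span_diff[OF horizontal_strip_translate[OF mid(2), of "Re z" m] curve_span_null[OF this]]
  show ?thesis unfolding b by (simp add: algebra_simps)
qed

text \<open>A degenerate triangle again, this time in the parameter interval.\<close>

lemma path_chain_subpaths:
  assumes "path g" "path_image g \<subseteq> X" "{s, t, u} \<subseteq> {0..1}"
  shows "null_homologous X (path_chain (g \<circ> linepath s t) + path_chain (g \<circ> linepath t u) - path_chain (g \<circ> linepath s u))"
proof (rule null_homologous_triangle)
  have "convex hull {s, t, u} \<subseteq> {0..1}" using assms(3) by (intro hull_minimal) auto
  then show "continuous_on (convex hull {s, t, u}) g" "g ` (convex hull {s, t, u}) \<subseteq> X"
    using assms(1,2) by (auto simp: path_def path_image_def intro: continuous_on_subset)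
qed

text \<open>\<^const>\<open>base_chain\<close> is a potential, modulo the span of \<open>a\<close>, \<open>b\<close>, \<open>c\<close>, for the chains
  of paths: this holds inside each strip, hence everywhere.\<close>

lemma path_chain_base_chain:
  assumes l: "path l" "\<And>t. t \<in> {0..1} \<Longrightarrow> torus_cover (l t) \<in> punctured_torus"
  shows "path_chain (torus_cover \<circ> l) - base_chain (l 1) + base_chain (l 0) \<in> curve_span"
proof -
  let ?\<gamma> = "\<lambda>s t. path_chain (torus_cover \<circ> l \<circ> linepath s t)"
  define R where "R s t \<longleftrightarrow> ?\<gamma> s t - base_chain (l t) + base_chain (l s) \<in> curve_span" for s t
  have p: "path (torus_cover \<circ> l)" "path_image (torus_cover \<circ> l) \<subseteq> punctured_torus"
    using l by (auto simp: path_def path_image_def o_def intro!: continuous_intros)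
  note sub = path_chain_subpaths[OF p]
  have "R 0 1"
  \<comment> \<open>Agreement of the path with the potential is an equivalence relation between
    parameters. It suffices that it holds locally, because the interval is connected.\<close>
  proof (rule connected_equivalence_relation[of "{0..1::real}"])
    show trans: "R s u" if "R s t" "R t u" "s \<in> {0..1}" "t \<in> {0..1}" "u \<in> {0..1}" for s t u
    proof -
      have "?\<gamma> s t - base_chain (l t) + base_chain (l s)
        + (?\<gamma> t u - base_chain (l u) + base_chain (l t))
        - (?\<gamma> s t + ?\<gamma> t u - ?\<gamma> s u)
        \<in> curve_span"
        by (rule curve_span_diff[OF curve_span_add[OF that(1,2)[unfolded R_def]] curve_span_null[OF sub[of s t u]]])
           (use that in auto)
      then show ?thesis unfolding R_def by (simp add: algebra_simps)
    qed
    show "R t s" if "R s t" "s \<in> {0..1}" "t \<in> {0..1}" for s t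
    proof -
      have "?\<gamma> s t + ?\<gamma> t s - ?\<gamma> s s
        + ?\<gamma> s s
         - (?\<gamma> s t - base_chain (l t) + base_chain (l s)) \<in> curve_span"
      proof -
        have "?\<gamma> s s \<in> curve_span"
          using curve_span_null[OF sub[of s s s]] that by (simp del: linepath_refl)
        moreover have "?\<gamma> s t + ?\<gamma> t s
            - ?\<gamma> s s \<in> curve_span"
          using that by (intro curve_span_null[OF sub[of s t s]]) auto
        ultimately show ?thesis
          by (intro curve_span_diff[OF curve_span_add that(1)[unfolded R_def]])
      qed
      then show ?thesis unfolding R_def by (simp add: algebra_simps)
    qed
    show "\<exists>T. openin (top_of_set {0..1}) T \<and> t \<in> T \<and> (\<forall>x\<in>T. R t x)" if t: "t \<in> {0..1}" for t
    proof -
      obtain K where K: "K \<in> strips" "l t \<in> K" using l(2)[OF t] Union_strips by blast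
      then have op: "open K" "convex K" using strips_open_convex by auto
      obtain e where e: "e > 0" "\<And>s. s \<in> {0..1} \<Longrightarrow> dist s t < e \<Longrightarrow> l s \<in> K"
      proof -
        obtain r where r: "r > 0" "ball (l t) r \<subseteq> K"
          using op K(2) open_contains_ball by blast
        then obtain e where "e > 0" "\<And>s. s \<in> {0..1} \<Longrightarrow> dist s t < e \<Longrightarrow> dist (l s) (l t) < r"
          using l(1) t unfolding path_def continuous_on_iff by metis
        then show ?thesis using that r by (metis dist_commute mem_ball subsetD)
      qed
      \<comment> \<open>Close to \<open>t\<close> the path stays in one strip \<open>K\<close>,
        where it may be replaced by its chord.\<close>
      have "R t x" if x: "x \<in> {0..1}" "dist x t < e" for x
      proof -
        have seg: "linepath t x s \<in> {0..1}" "dist (linepath t x s) t < e" if "s \<in> {0..1}" for s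
        proof -
          have "linepath t x s \<in> closed_segment t x" using that by (auto simp: linepath_def closed_segment_def)
          then show "linepath t x s \<in> {0..1}" "dist (linepath t x s) t < e"
            using t x closed_segment_subset[of t "{0..1}" x] dist_in_closed_segment[of _ t x]
            by (auto simp: dist_commute) (smt (verit) dist_commute dist_in_closed_segment)
        qed
        have "null_homologous punctured_torus (path_chain (torus_cover \<circ> (l \<circ> linepath t x)) - segment_chain ((l \<circ> linepath t x) 0) ((l \<circ> linepath t x) 1))"
        proof (rule null_homologous_convex[OF op(2)])
          show "path (l \<circ> linepath t x)"
            unfolding path_def
          proof (rule continuous_on_compose)
            show "continuous_on (linepath t x ` {0..1}) l"
              using l(1) seg by (auto simp: path_def intro: continuous_on_subset)
          qed (intro continuous_intros)
          show "path_image (l \<circ> linepath t x) \<subseteq> K" using seg e by (auto simp: path_image_def)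
          show "torus_cover ` K \<subseteq> punctured_torus" using K Union_strips by blast
        qed (intro continuous_intros)
        then have "?\<gamma> t x - segment_chain (l t) (l x)
            + (segment_chain (l t) (l x) - base_chain (l x) + base_chain (l t)) \<in> curve_span"
          by (intro curve_span_add[OF curve_span_null base_chain_strip[OF K(1) K(2) e(2)[OF x]]])
             (simp add: o_assoc linepath_def)
        then show ?thesis by (simp add: R_def algebra_simps)
      qed
      then show ?thesis using e(1) t
        by (intro exI[of _ "{0..1} \<inter> ball t e"]) (auto simp: dist_commute)
    qed
  qed auto
  moreover have "?\<gamma> 0 1 = path_chain (torus_cover \<circ> l)"
    by (rule path_chain_cong) (simp add: linepath_def)
  ultimately show ?thesis by (simp add: R_def)
qed

text \<open>The two ends of the lift of a loop differ by a period, so the potential takes the same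
  value there modulo the span.\<close>

proposition path_chain_in_curve_span:
  assumes "loop_in punctured_torus g"
  shows "path_chain g \<in> curve_span"
proof -
  have "path g" "path_image g \<subseteq> torus" using assms by (auto simp: loop_in_def punctured_torus_def)
  then obtain l where l: "path l" "\<And>t. t \<in> {0..1} \<Longrightarrow> torus_cover (l t) = g t"
    using lift_path_to_plane by blast
  have "torus_cover (l t) \<in> punctured_torus" if "t \<in> {0..1}" for t
    using that l(2) assms by (auto simp: loop_in_def path_image_def)
  then have "path_chain (torus_cover \<circ> l) - base_chain (l 1) + base_chain (l 0) \<in> curve_span"
    using l(1) path_chain_base_chain by blast
  moreover have "base_chain (l 1) - base_chain (l 0) \<in> curve_span"
    using assms l(2)[of 0] l(2)[of 1] by (intro base_chain_periodic) (auto simp: loop_in_def pathfinish_def pathstart_def)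
  ultimately have "path_chain (torus_cover \<circ> l) - base_chain (l 1) + base_chain (l 0) + (base_chain (l 1) - base_chain (l 0)) \<in> curve_span"
    by (rule curve_span_add)
  moreover have "path_chain (torus_cover \<circ> l) = path_chain g"
    by (rule path_chain_cong) (simp add: l(2))
  ultimately show ?thesis by simp
qed

section \<open>Winding numbers and the basis of the first homology group\<close>

lemma winding_number_sphere_lift:
  assumes "path l"
  shows "winding_number (\<lambda>t. cis (2 * pi * l t)) 0 = l 1 - l 0"
proof -
  have "winding_number (exp \<circ> (\<lambda>t. \<i> * of_real (2 * pi * l t))) 0 =
    (pathfinish (\<lambda>t. \<i> * of_real (2 * pi * l t)) - pathstart (\<lambda>t. \<i> * of_real (2 * pi * l t))) / (2 * of_real pi * \<i>)"
    using assms unfolding path_def by (intro winding_number_compose_exp) (auto simp: path_def intro!: continuous_intros)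
  also have "\<dots> = l 1 - l 0"
    by (simp add: pathfinish_def pathstart_def field_simps)
  finally show ?thesis by (simp add: o_def cis_conv_exp)
qed

lemma winding_number_Re_pos:
  assumes "path g" "pathfinish g = pathstart g" "\<And>t. t \<in> {0..1} \<Longrightarrow> 0 < Re (g t)"
  shows "winding_number g 0 = 0"
  by (rule winding_number_zero_outside[of _ "{z. 0 < Re z}"])
     (use assms in \<open>auto simp: path_image_def convex_halfspace_Re_gt\<close>)

lemma winding_number_perturb:
  assumes "path g" "path h" "pathfinish g = pathstart g" "pathfinish h = pathstart h"
    "\<And>t. t \<in> {0..1} \<Longrightarrow> 0 \<notin> closed_segment (g t) (h t)"
  shows "winding_number h 0 = winding_number g 0"
  using winding_number_loops_linear_eq assms by blast

text \<open>Maps to the punctured plane whose winding numbers along loops form the basis of cohomology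
  dual to \<open>a\<close>, \<open>b\<close>, \<open>d\<close>.  The last one is a local homeomorphism at the marked points, where it
  vanishes; it preserves orientation at \<open>(1/4, 0)\<close> and reverses it at \<open>(-1/4, 0)\<close>.\<close>

definition dual :: "3 \<Rightarrow> complex \<times> complex \<Rightarrow> complex" where
  "dual i q = (if i = 1 then snd q else if i = 2 then cnj (fst q) else of_real (Re (fst q)) + 1 - snd q)"

lemma dual_simps:
  "dual 1 q = snd q" "dual 2 q = cnj (fst q)" "dual 3 q = of_real (Re (fst q)) + 1 - snd q"
  by (simp_all add: dual_def)

lemma continuous_on_dual: "continuous_on S (dual i)"
  using exhaust_3[of i] by (auto simp: dual_simps[abs_def] intro!: continuous_intros)

text \<open>A zero of the third map means that the second coordinate is the real number
  \<open>Re z + 1\<close> of modulus 1. Since \<open>Re z\<close> is at least \<open>-1\<close>,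
  this forces \<open>Re z = 0\<close> and second coordinate 1: a marked point.\<close>

lemma dual_nonzero:
  assumes "q \<in> punctured_torus"
  shows "dual i q \<noteq> 0"
proof -
  obtain z w where q: "q = (z, w)" by force
  have n: "cmod z = 1" "cmod w = 1" "(z, w) \<notin> {(\<i>, 1), (- \<i>, 1)}"
    using assms by (auto simp: q punctured_torus_def torus_def marked_eq)
  consider "i = 1" | "i = 2" | "i = 3" using exhaust_3 by blast
  then show ?thesis
  proof cases
    case 3
    show ?thesis
    proof
      assume "dual i q = 0"
      then have w: "w = of_real (Re z + 1)" by (simp add: 3 dual_simps q)
      then have "\<bar>Re z + 1\<bar> = 1" using n(2) by (metis norm_of_real)
      moreover have "\<bar>Re z\<bar> \<le> 1" using n(1) abs_Re_le_cmod[of z] by simp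
      ultimately have "Re z = 0" by linarith
      moreover have "(Re z)\<^sup>2 + (Im z)\<^sup>2 = 1" using n(1) by (metis cmod_power2 one_power2)
      ultimately have "Im z = 1 \<or> Im z = -1" by (simp add: power2_eq_1_iff)
      with \<open>Re z = 0\<close> w n(3) show False by (auto simp: complex_eq_iff)
    qed
  qed (use n in \<open>auto simp: dual_simps q\<close>)
qed

text \<open>For loops in the punctured torus the winding numbers are integers, so floor and real
  part only change the type; see \<open>winding_vector_nth\<close>.\<close>

definition winding_vector :: "(real \<Rightarrow> complex \<times> complex) \<Rightarrow> int ^ 3" where
  "winding_vector g = (\<chi> i. \<lfloor>Re (winding_number (dual i \<circ> g) 0)\<rfloor>)"

lemma dual_path:
  assumes "loop_in punctured_torus g"
  shows "path (dual i \<circ> g)" "pathfinish (dual i \<circ> g) = pathstart (dual i \<circ> g)" "0 \<notin> path_image (dual i \<circ> g)"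
proof -
  show "path (dual i \<circ> g)"
    using assms by (auto simp: loop_in_def intro!: path_continuous_image continuous_on_dual)
  show "pathfinish (dual i \<circ> g) = pathstart (dual i \<circ> g)"
    using assms by (simp add: loop_in_def pathfinish_compose pathstart_compose)
  show "0 \<notin> path_image (dual i \<circ> g)"
    using assms dual_nonzero unfolding loop_in_def path_image_compose by (metis image_iff subsetD)
qed

lemma winding_vector_nth:
  assumes "loop_in punctured_torus g"
  shows "of_int (winding_vector g $ i) = winding_number (dual i \<circ> g) 0"
proof -
  have "winding_number (dual i \<circ> g) 0 \<in> \<int>"
    by (rule integer_winding_number) (use dual_path[OF assms] in auto)
  then show ?thesis by (auto simp: winding_vector_def elim!: Ints_cases)
qed

lemma winding_vector_eqI:
  assumes "\<And>i. winding_number (dual i \<circ> g) 0 = of_int (n $ i)"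
  shows "winding_vector g = n"
  by (simp add: winding_vector_def assms vec_eq_iff)

lemma winding_number_dual_lift:
  assumes "path l"
  shows "winding_number (dual 1 \<circ> (torus_cover \<circ> l)) 0 = of_real (Im (l 1) - Im (l 0))"
    "winding_number (dual 2 \<circ> (torus_cover \<circ> l)) 0 = of_real (Re (l 0) - Re (l 1))"
proof -
  have "path (\<lambda>t. Im (l t))" "path (\<lambda>t. - Re (l t))"
    using assms by (auto simp: path_def intro!: continuous_intros)
  from this[THEN winding_number_sphere_lift]
  show "winding_number (dual 1 \<circ> (torus_cover \<circ> l)) 0 = of_real (Im (l 1) - Im (l 0))"
    "winding_number (dual 2 \<circ> (torus_cover \<circ> l)) 0 = of_real (Re (l 0) - Re (l 1))"
    by (simp_all add: dual_def o_def torus_cover_def cis_cnj)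
qed

definition basis_curve :: "3 \<Rightarrow> real \<Rightarrow> complex \<times> complex" where
  "basis_curve i = (if i = 1 then curve_a else if i = 2 then curve_b else curve_d)"

lemma basis_curve_simps:
  "basis_curve 1 = curve_a" "basis_curve 2 = curve_b" "basis_curve 3 = curve_d"
  by (simp_all add: basis_curve_def)

lemma H1_basis_eq: "H1_basis i = loop_class (basis_curve i)"
  by (simp add: H1_basis_def basis_curve_def)

lemma curve_lifts:
  "curve_a = torus_cover \<circ> (\<lambda>t. Complex 0 t)" "curve_b = torus_cover \<circ> (\<lambda>t. Complex (- t) (1/2))"
  "curve_c = torus_cover \<circ> (\<lambda>t. Complex (1/2) t)" "curve_d = torus_cover \<circ> (\<lambda>t. 1/4 + 1/8 * cis (2 * pi * t))"
  by (auto simp: curve_a_def curve_b_def curve_c_def curve_d_def)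

lemma path_Complex: "path (\<lambda>t. Complex (f t) (g t)) \<longleftrightarrow> path f \<and> path g"
proof -
  have "path f \<and> path g" if "path (\<lambda>t. Complex (f t) (g t))"
    using continuous_on_Re[OF that[unfolded path_def]] continuous_on_Im[OF that[unfolded path_def]] by (simp add: path_def)
  then show ?thesis by (auto simp: path_def Complex_eq intro!: continuous_intros)
qed

lemma loop_in_torus_cover:
  assumes "path l" "\<And>t. t \<in> {0..1} \<Longrightarrow> \<not> (Im (l t) \<in> \<int> \<and> 2 * Re (l t) - 1/2 \<in> \<int>)"
    "Re (l 1) - Re (l 0) \<in> \<int>" "Im (l 1) - Im (l 0) \<in> \<int>"
  shows "loop_in punctured_torus (torus_cover \<circ> l)"
  using assms
  by (auto simp: loop_in_def path_def path_image_def pathfinish_def pathstart_def torus_cover_eq_iff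
    torus_cover_in_punctured_torus simp del: atLeastAtMost_iff intro!: continuous_intros)

lemma small_Ints: "x \<in> \<int> \<Longrightarrow> \<bar>x\<bar> < 1 \<Longrightarrow> x = 0" for x :: real
  by (auto elim!: Ints_cases)

lemma cmod_Re_Im_le: "\<bar>Re z\<bar> \<le> r" "\<bar>Im z\<bar> \<le> r" if "cmod z \<le> r"
  using that abs_Re_le_cmod[of z] abs_Im_le_cmod[of z] by linarith+

lemma near_puncture_in_punctured_torus:
  assumes "h \<noteq> 0" "cmod h \<le> 1/4"
  shows "torus_cover (1/4 + h) \<in> punctured_torus"
proof -
  have "\<bar>Re h\<bar> \<le> 1/4" "\<bar>Im h\<bar> \<le> 1/4" using cmod_Re_Im_le[OF assms(2)] by auto
  then have "\<bar>Im h\<bar> < 1" "\<bar>2 * Re h\<bar> < 1" by linarith+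
  then have "\<not> (Im h \<in> \<int> \<and> 2 * Re h \<in> \<int>)"
    using small_Ints[of "Im h"] small_Ints[of "2 * Re h"] assms(1) by (auto simp: complex_eq_iff)
  then show ?thesis by (simp add: torus_cover_in_punctured_torus)
qed

lemma loop_in_curves:
  "loop_in punctured_torus curve_a" "loop_in punctured_torus curve_b"
  "loop_in punctured_torus curve_c" "loop_in punctured_torus curve_d"
proof -
  have n: "x \<notin> \<int>" if "0 < x \<and> x < 1 \<or> -1 < x \<and> x < 0" for x :: real
    using that by (auto elim!: Ints_cases)
  show "loop_in punctured_torus curve_a" "loop_in punctured_torus curve_b" "loop_in punctured_torus curve_c"
    unfolding curve_lifts using n[of "-(1/2)"] n[of "1/2"]
    by (intro loop_in_torus_cover; simp add: path_Complex; simp add: path_def continuous_intros)+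
  have "torus_cover (1/4 + 1/8 * cis (2 * pi * t)) \<in> punctured_torus" for t
    by (rule near_puncture_in_punctured_torus) (auto simp: norm_mult)
  then show "loop_in punctured_torus curve_d"
    unfolding curve_lifts
    by (auto simp: loop_in_def path_def path_image_def pathfinish_def pathstart_def intro!: continuous_intros)
qed

lemma loop_in_basis_curve: "loop_in punctured_torus (basis_curve i)"
  using exhaust_3[of i] loop_in_curves by (auto simp: basis_curve_def)

lemma dual_3_torus_cover:
  "dual 3 (torus_cover z) = Complex (cos (2 * pi * Re z) + 1 - cos (2 * pi * Im z)) (- sin (2 * pi * Im z))"
  by (simp add: dual_simps torus_cover_def complex_eq_iff)

text \<open>If \<open>Im h\<close> is nonzero, the imaginary parts of both ends of the segment are
  nonzero with the same sign, because \<open>sin (2 * pi * x)\<close> has the sign of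
  \<open>x\<close> for \<open>\<bar>x\<bar> \<le> 1/4\<close>. If \<open>Im h = 0\<close>, the same
  holds for the real parts.\<close>

lemma dual_3_near_puncture:
  assumes "h \<noteq> 0" "cmod h \<le> 1/4"
  shows "0 \<notin> closed_segment (- h) (dual 3 (torus_cover (1/4 + h)))"
proof
  have b: "\<bar>Re h\<bar> \<le> 1/4" "\<bar>Im h\<bar> \<le> 1/4" using cmod_Re_Im_le[OF assms(2)] by auto
  assume "0 \<in> closed_segment (- h) (dual 3 (torus_cover (1/4 + h)))"
  then obtain s where s: "0 \<le> s" "s \<le> 1" and eq: "0 = (1 - s) *\<^sub>R (- h) + s *\<^sub>R dual 3 (torus_cover (1/4 + h))"
    by (auto simp: in_segment)
  have "cos (2 * pi * (1/4 + x)) = - sin (2 * pi * x)" for x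
    using minus_sin_cos_eq[of "2 * pi * x"] by (simp add: algebra_simps)
  then have d: "dual 3 (torus_cover (1/4 + h)) = Complex (- sin (2 * pi * Re h) + 1 - cos (2 * pi * Im h)) (- sin (2 * pi * Im h))"
    by (simp add: dual_3_torus_cover)
  have re: "0 = - (1 - s) * Re h + s * (- sin (2 * pi * Re h) + 1 - cos (2 * pi * Im h))"
    using arg_cong[OF eq, of Re] unfolding d by (simp add: algebra_simps)
  have im: "0 = - (1 - s) * Im h - s * sin (2 * pi * Im h)"
    using arg_cong[OF eq, of Im] unfolding d by (simp add: algebra_simps)
  have sgn: "0 < (1 - s) * x + s * sin (2 * pi * x)" if "0 < x" "x \<le> 1/4" for x
  proof -
    have "0 < sin (2 * pi * x)" using that by (intro sin_gt_zero) auto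
    then show ?thesis using s that by (cases "s = 0") (auto intro!: add_nonneg_pos)
  qed
  have zero: "x = 0" if "(1 - s) * x + s * sin (2 * pi * x) = 0" "\<bar>x\<bar> \<le> 1/4" for x
    using sgn[of x] sgn[of "-x"] that by (cases "x = 0"; cases "x > 0") auto
  have "Im h = 0" using zero[of "Im h"] im b by simp
  moreover have "Re h = 0" using zero[of "Re h"] re b \<open>Im h = 0\<close> by (simp add: algebra_simps)
  ultimately show False using assms by (simp add: complex_eq_iff)
qed

lemma winding_vector_curves:
  "winding_vector curve_a = axis 1 1" "winding_vector curve_b = axis 2 1"
  "winding_vector curve_c = axis 1 1 + axis 3 1" "winding_vector curve_d = axis 3 1"
proof -
  have p: "path (\<lambda>t. Complex 0 t)" "path (\<lambda>t. Complex (- t) (1/2))" "path (\<lambda>t. Complex (1/2) t)"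
    "path (\<lambda>t. 1/4 + 1/8 * cis (2 * pi * t))"
    by (auto simp: path_def Complex_eq intro!: continuous_intros)
  \<comment> \<open>The third map has positive real part along \<open>a\<close> and
    \<open>b\<close>. Along \<open>c\<close> it equals \<open>- cis (2 * pi * t)\<close>, and on the
    small circle \<open>d\<close> it is a perturbation of \<open>- h\<close>, which turns
    once.\<close>
  have a3: "winding_number (dual 3 \<circ> curve_a) 0 = 0"
  proof (rule winding_number_Re_pos)
    have "cos (2 * pi * t) < 2" for t using cos_le_one[of "2 * pi * t"] by linarith
    then show "0 < Re ((dual 3 \<circ> curve_a) t)" for t
      by (simp add: curve_lifts dual_3_torus_cover)
  qed (use dual_path[OF loop_in_curves(1)] in auto)
  have b3: "winding_number (dual 3 \<circ> curve_b) 0 = 0"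
  proof (rule winding_number_Re_pos)
    have "- 2 < cos (2 * pi * t)" for t using cos_ge_minus_one[of "2 * pi * t"] by linarith
    then show "0 < Re ((dual 3 \<circ> curve_b) t)" for t
      by (simp add: curve_lifts dual_3_torus_cover) (smt (verit))
  qed (use dual_path[OF loop_in_curves(2)] in auto)
  have c3: "winding_number (dual 3 \<circ> curve_c) 0 = 1"
  proof -
    have "dual 3 \<circ> curve_c = (\<lambda>t. cis (2 * pi * (t + 1/2)))"
      by (auto simp: curve_lifts dual_3_torus_cover complex_eq_iff fun_eq_iff distrib_left)
    then show ?thesis using winding_number_sphere_lift[of "\<lambda>t. t + 1/2"] by (simp add: path_def continuous_intros)
  qed
  have d3: "winding_number (dual 3 \<circ> curve_d) 0 = 1"
  proof -
    let ?g = "\<lambda>t. - (1/8) * cis (2 * pi * t)"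
    have "winding_number (dual 3 \<circ> curve_d) 0 = winding_number ?g 0"
    proof (rule winding_number_perturb)
      have "0 \<notin> closed_segment (- (1/8 * cis (2 * pi * t))) (dual 3 (torus_cover (1/4 + (1/8 * cis (2 * pi * t)))))" for t
        by (rule dual_3_near_puncture) (auto simp: norm_mult)
      then show "0 \<notin> closed_segment (?g t) ((dual 3 \<circ> curve_d) t)" for t
        by (simp add: curve_d_def)
      show "path ?g" by (auto simp: path_def intro!: continuous_intros)
    qed (use dual_path[OF loop_in_curves(4)] in \<open>auto simp: pathfinish_def pathstart_def\<close>)
    also have "?g = (\<lambda>t. - (1/8) * (circlepath 0 1 t - 0))"
      by (auto simp: circlepath cis_conv_exp mult_ac)
    also have "winding_number \<dots> 0 = 1"
      by (rule winding_number_scaled_circle) auto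
    finally show ?thesis .
  qed
  note d12 = p[THEN winding_number_dual_lift(1), folded curve_lifts]
    p[THEN winding_number_dual_lift(2), folded curve_lifts]
  show "winding_vector curve_a = axis 1 1" "winding_vector curve_b = axis 2 1"
    "winding_vector curve_c = axis 1 1 + axis 3 1" "winding_vector curve_d = axis 3 1"
    by (rule winding_vector_eqI; rename_tac i; case_tac i rule: exhaust_3[THEN disjE];
        use d12 a3 b3 c3 d3 in \<open>auto simp: axis_def\<close>)+
qed

section \<open>The first homology group as a quotient of the cycles\<close>

abbreviation homology_class :: "(complex \<times> complex) chain \<Rightarrow> (complex \<times> complex) chain set" where
  "homology_class c \<equiv> homologous_rel_set 1 (top_of_set punctured_torus) {} c"

abbreviation cycle :: "(complex \<times> complex) chain \<Rightarrow> bool" where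
  "cycle \<equiv> singular_relcycle 1 (top_of_set punctured_torus) {}"

lemma homology_class_eq_iff: "homology_class c = homology_class d \<longleftrightarrow> null_homologous punctured_torus (c - d)"
  by (metis homologous_rel_def homologous_rel_set_eq)

lemma group_H1: "group H1"
  by simp

lemma homology_class_closed: "cycle c \<Longrightarrow> homology_class c \<in> carrier H1"
  using carrier_relative_homology_group[of 1 "top_of_set punctured_torus" "{}"] by auto

lemma homology_class_mult: "homology_class c \<otimes>\<^bsub>H1\<^esub> homology_class d = homology_class (c + d)"
proof -
  have "(\<Union>r\<in>homology_class c. \<Union>s\<in>homology_class d. {r + s}) = homology_class (c + d)"
  proof (intro equalityI subsetI)
    fix x assume "x \<in> (\<Union>r\<in>homology_class c. \<Union>s\<in>homology_class d. {r + s})"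
    then show "x \<in> homology_class (c + d)" by (auto intro: homologous_rel_add)
  next
    fix x assume "x \<in> homology_class (c + d)"
    then have "homologous_rel 1 (top_of_set punctured_torus) {} (c + d - c) (x - c)"
      by (intro homologous_rel_diff) auto
    then show "x \<in> (\<Union>r\<in>homology_class c. \<Union>s\<in>homology_class d. {r + s})"
      by (intro UN_I[of c] UN_I[of "x - c"]) auto
  qed
  then show ?thesis
    using mult_relative_homology_group[of 1 "top_of_set punctured_torus" "{}"] by simp
qed

lemma homology_class_0: "homology_class 0 = \<one>\<^bsub>H1\<^esub>"
  using one_relative_homology_group[of 1 "top_of_set punctured_torus" "{}"]
    homologous_rel_set_eq_relboundary[of 1 "top_of_set punctured_torus" "{}" 0] by simp

lemma homology_class_pow:
  assumes "cycle c"
  shows "homology_class c [^]\<^bsub>H1\<^esub> (n::int) = homology_class (frag_cmul n c)"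
proof -
  interpret group H1 by (rule group_H1)
  note cl = homology_class_closed[OF assms]
  show ?thesis
  proof (induction n rule: int_induct[of _ 0])
    case base
    show ?case by (simp only: homology_class_0 frag_cmul_zero int_pow_0)
  next
    case (step1 i)
    then show ?case
      by (simp only: int_pow_mult[OF cl] int_pow_1[OF cl] homology_class_mult frag_cmul_distrib frag_cmul_one)
  next
    case (step2 i)
    have "inv\<^bsub>H1\<^esub> homology_class c = homology_class (- c)"
    proof (rule inv_equality)
      show "homology_class (- c) \<otimes>\<^bsub>H1\<^esub> homology_class c = \<one>\<^bsub>H1\<^esub>"
        by (simp only: homology_class_mult homology_class_0[symmetric] add.left_inverse)
      show "homology_class (- c) \<in> carrier H1"
        using assms singular_relcycle_minus by (intro homology_class_closed) blast
    qed (rule cl)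
    then have "homology_class c [^]\<^bsub>H1\<^esub> (i - 1) = homology_class (frag_cmul i c + - c)"
      using step2 by (simp only: int_pow_diff[OF cl] int_pow_1[OF cl] homology_class_mult)
    then show ?case by (simp add: frag_cmul_diff_distrib)
  qed
qed

lemma cycle_loop: "loop_in punctured_torus g \<Longrightarrow> cycle (path_chain g)"
  unfolding loop_in_def by (intro singular_relcycle_loop) auto

definition comb_chain :: "int ^ 3 \<Rightarrow> (complex \<times> complex) chain" where
  "comb_chain n = frag_cmul (n $ 1) (path_chain curve_a) + frag_cmul (n $ 2) (path_chain curve_b)
     + frag_cmul (n $ 3) (path_chain curve_d)"

lemma H1_comb_eq: "H1_comb n = homology_class (comb_chain n)"
proof -
  interpret comm_group H1 by simp
  have c: "cycle (path_chain (basis_curve i))" for i using loop_in_basis_curve cycle_loop by blast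
  have b: "H1_basis i [^]\<^bsub>H1\<^esub> (n $ i) = homology_class (frag_cmul (n $ i) (path_chain (basis_curve i)))" for i
    unfolding H1_basis_eq loop_class_eq by (rule homology_class_pow[OF c])
  have cl: "homology_class (frag_cmul (n $ i) (path_chain (basis_curve i))) \<in> carrier H1" for i
    using c singular_relcycle_cmul by (intro homology_class_closed) blast
  have "H1_comb n = (\<Otimes>\<^bsub>H1\<^esub>i\<in>{1, 2, 3::3}. homology_class (frag_cmul (n $ i) (path_chain (basis_curve i))))"
    unfolding H1_comb_def b UNIV_3 ..
  also have "\<dots> = homology_class (frag_cmul (n $ 1) (path_chain (basis_curve 1))) \<otimes>\<^bsub>H1\<^esub>
     (homology_class (frag_cmul (n $ 2) (path_chain (basis_curve 2))) \<otimes>\<^bsub>H1\<^esub>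
      (homology_class (frag_cmul (n $ 3) (path_chain (basis_curve 3))) \<otimes>\<^bsub>H1\<^esub> \<one>\<^bsub>H1\<^esub>))"
    using cl by simp
  also have "\<dots> = homology_class (comb_chain n)"
    unfolding homology_class_mult homology_class_0[symmetric]
    by (simp add: comb_chain_def basis_curve_simps add.assoc)
  finally show ?thesis .
qed

lemma chain_winding_dual_null:
  "null_homologous punctured_torus c \<Longrightarrow> chain_winding (dual i) c = 0"
  using chain_winding_null_homologous[OF continuous_on_dual dual_nonzero] by blast

lemma chain_winding_loop:
  "loop_in punctured_torus g \<Longrightarrow> chain_winding (dual i) (path_chain g) = of_int (winding_vector g $ i)"
  by (simp add: chain_winding_path_chain winding_vector_nth)

lemma chain_winding_comb_chain: "chain_winding (dual i) (comb_chain n) = of_int (n $ i)"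
  unfolding comb_chain_def chain_winding_add chain_winding_cmul
  using exhaust_3[of i] by (auto simp: chain_winding_loop loop_in_curves winding_vector_curves axis_def)

text \<open>The relation between \<open>a\<close>, \<open>c\<close> and \<open>d\<close> is not
  drawn geometrically: \<open>d\<close> is some combination of \<open>a\<close>, \<open>b\<close>,
  \<open>c\<close>, and the winding numbers determine its coefficients. Eliminating \<open>c\<close>
  then expresses any loop by \<open>a\<close>, \<open>b\<close>, \<open>d\<close>, and the winding
  numbers determine the coefficients once more.\<close>

lemma loop_homologous:
  assumes "loop_in punctured_torus g"
  shows "null_homologous punctured_torus (path_chain g - comb_chain (winding_vector g))"
proof -
  have span: "\<exists>m n k. null_homologous punctured_torus
     (path_chain h - curve_comb m n k)"
    if "loop_in punctured_torus h" for h
    using path_chain_in_curve_span[OF that] by (simp add: curve_span_def)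
  obtain m n k where d: "null_homologous punctured_torus
     (path_chain curve_d - curve_comb m n k)"
    using span[OF loop_in_curves(4)] by blast
  have "axis 3 1 $ i = m * axis 1 1 $ i + n * axis 2 1 $ i + k * (axis 1 1 + axis 3 1) $ i" for i :: 3
  proof -
    have "(of_int (axis 3 1 $ i - (m * axis 1 1 $ i + n * axis 2 1 $ i + k * (axis 1 1 + axis 3 1) $ i)) :: complex) = 0"
      using chain_winding_dual_null[OF d, of i]
      unfolding chain_winding_diff chain_winding_add chain_winding_cmul chain_winding_loop[OF loop_in_curves(1)]
        chain_winding_loop[OF loop_in_curves(2)] chain_winding_loop[OF loop_in_curves(3)]
        chain_winding_loop[OF loop_in_curves(4)] winding_vector_curves
        of_int_diff of_int_add of_int_mult .
    then show ?thesis unfolding of_int_eq_0_iff by simp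
  qed
  from this[of 1] this[of 2] this[of 3] have "k = 1" "m = -1" "n = 0"
    by (simp_all add: axis_def)
  then have d: "null_homologous punctured_torus (path_chain curve_d + path_chain curve_a - path_chain curve_c)"
    using d by (simp add: algebra_simps)
  obtain m n k where g: "null_homologous punctured_torus
     (path_chain g - curve_comb m n k)"
    using span[OF assms] by blast
  \<comment> \<open>Each of the \<open>k\<close> copies of \<open>c\<close> is replaced by
    \<open>a + d\<close>.\<close>
  define N :: "int ^ 3" where "N = vector [m + k, n, k]"
  have eqN: "path_chain g - comb_chain N = (path_chain g - curve_comb m n k)
     - frag_cmul k (path_chain curve_d + path_chain curve_a - path_chain curve_c)"
  proof -
    have "frag_cmul k (path_chain curve_d + path_chain curve_a - path_chain curve_c)
      = frag_cmul k (path_chain curve_d) + frag_cmul k (path_chain curve_a) - frag_cmul k (path_chain curve_c)"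
      by (rule poly_mapping_eqI) (simp add: lookup_add lookup_minus algebra_simps)
    then show ?thesis
      by (simp add: comb_chain_def N_def frag_cmul_distrib algebra_simps)
  qed
  have null: "null_homologous punctured_torus (path_chain g - comb_chain N)"
    unfolding eqN by (rule singular_relboundary_diff[OF g singular_relboundary_cmul[OF d]])
  have "winding_vector g $ i = N $ i" for i
    using chain_winding_dual_null[OF null, of i] assms
    by (simp add: chain_winding_diff chain_winding_loop chain_winding_comb_chain)
  then have "winding_vector g = N" by (simp add: vec_eq_iff)
  with null show ?thesis by simp
qed

proposition loop_class_eq_H1_comb:
  assumes "loop_in punctured_torus g"
  shows "loop_class g = H1_comb (winding_vector g)"
  unfolding H1_comb_eq loop_class_eq homology_class_eq_iff by (rule loop_homologous[OF assms])

proposition H1_comb_inject: "H1_comb m = H1_comb n \<longleftrightarrow> m = n"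
proof
  assume "H1_comb m = H1_comb n"
  then have "null_homologous punctured_torus (comb_chain m - comb_chain n)"
    unfolding H1_comb_eq homology_class_eq_iff .
  from chain_winding_dual_null[OF this] show "m = n"
    by (simp add: chain_winding_diff chain_winding_comb_chain vec_eq_iff)
qed simp

text \<open>Injectivity of \<open>H1_comb\<close> resolves the definite description in
  \<open>eta\<close>.\<close>

lemma eta_loop_class:
  assumes "loop_in punctured_torus g"
  shows "eta k (loop_class g) = winding_vector g $ 3 mod int k"
  by (simp add: eta_def loop_class_eq_H1_comb[OF assms] H1_comb_inject)

section \<open>The homology matrix of a homeomorphism\<close>

definition self_map :: "(complex \<times> complex \<Rightarrow> complex \<times> complex) \<Rightarrow> bool" where
  "self_map f \<longleftrightarrow> continuous_on punctured_torus f \<and> f ` punctured_torus \<subseteq> punctured_torus"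

text \<open>The counterpart of \<open>Psi\<close> for a single map, formed without quotients or
  definite descriptions; \<open>Psi_eq\<close> connects the two.\<close>

definition homology_matrix :: "(complex \<times> complex \<Rightarrow> complex \<times> complex) \<Rightarrow> int ^ 3 ^ 3" where
  "homology_matrix f = (\<chi> i j. winding_vector (f \<circ> basis_curve j) $ i)"

lemma column_homology_matrix: "column j (homology_matrix f) = winding_vector (f \<circ> basis_curve j)"
  by (simp add: column_def homology_matrix_def vec_eq_iff)

lemma loop_in_point: "loop_in X g \<Longrightarrow> t \<in> {0..1} \<Longrightarrow> g t \<in> X"
  unfolding loop_in_def path_image_def by blast

lemma loop_in_self_map:
  assumes "self_map f" "loop_in punctured_torus g"
  shows "loop_in punctured_torus (f \<circ> g)"
proof -
  have "path (f \<circ> g)"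
    using assms by (auto simp: loop_in_def self_map_def intro!: path_continuous_image intro: continuous_on_subset)
  moreover have "path_image (f \<circ> g) \<subseteq> punctured_torus"
    using assms unfolding loop_in_def self_map_def path_image_compose by blast
  ultimately show ?thesis
    using assms by (simp add: loop_in_def pathfinish_compose pathstart_compose)
qed

lemma chain_map_path_chain: "chain_map 1 f (path_chain g) = path_chain (f \<circ> g)"
  by (simp add: path_chain_def chain_map_of simplex_map_def path_simplex_def restrict_def fun_eq_iff o_def cong: if_cong)

lemma self_map_continuous_map:
  "self_map f \<Longrightarrow> continuous_map (top_of_set punctured_torus) (top_of_set punctured_torus) f"
  by (auto simp: self_map_def)

lemma hom_induced_loop_class:
  assumes "self_map f" "loop_in punctured_torus g"
  shows "hom_induced 1 (top_of_set punctured_torus) {} (top_of_set punctured_torus) {} f (loop_class g) = loop_class (f \<circ> g)"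
proof -
  have "hom_induced (int 1) (top_of_set punctured_torus) {} (top_of_set punctured_torus) {} f (homology_class (path_chain g))
    = homology_class (chain_map 1 f (path_chain g))"
    by (rule hom_induced_chain_map) (use assms self_map_continuous_map cycle_loop in auto)
  then show ?thesis by (simp add: loop_class_eq chain_map_path_chain[simplified])
qed

text \<open>The homology between \<open>g\<close> and a combination of the basis curves is pushed
  forward by \<open>f\<close>; linearity of the winding numbers on chains then gives the matrix
  product.\<close>

lemma winding_vector_self_map:
  assumes f: "self_map f" and g: "loop_in punctured_torus g"
  shows "winding_vector (f \<circ> g) = homology_matrix f *v winding_vector g"
proof -
  let ?n = "winding_vector g"
  have "null_homologous punctured_torus (chain_map 1 f (path_chain g - comb_chain ?n))"
    using singular_relboundary_chain_map[OF loop_homologous[OF g] self_map_continuous_map[OF f], of "{}"] by simp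
  moreover have "chain_map 1 f (path_chain g - comb_chain ?n) = path_chain (f \<circ> g)
     - (frag_cmul (?n $ 1) (path_chain (f \<circ> curve_a)) + frag_cmul (?n $ 2) (path_chain (f \<circ> curve_b))
        + frag_cmul (?n $ 3) (path_chain (f \<circ> curve_d)))"
    unfolding comb_chain_def chain_map_diff chain_map_add chain_map_cmul chain_map_path_chain ..
  ultimately have null: "null_homologous punctured_torus (path_chain (f \<circ> g)
     - (frag_cmul (?n $ 1) (path_chain (f \<circ> curve_a)) + frag_cmul (?n $ 2) (path_chain (f \<circ> curve_b))
        + frag_cmul (?n $ 3) (path_chain (f \<circ> curve_d))))" by simp
  have "winding_vector (f \<circ> g) $ i = (homology_matrix f *v ?n) $ i" for i
  proof -
    have "(of_int (winding_vector (f \<circ> g) $ i - (?n $ 1 * winding_vector (f \<circ> curve_a) $ i + ?n $ 2 * winding_vector (f \<circ> curve_b) $ i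
        + ?n $ 3 * winding_vector (f \<circ> curve_d) $ i)) :: complex) = 0"
      using chain_winding_dual_null[OF null, of i]
      unfolding chain_winding_diff chain_winding_add chain_winding_cmul chain_winding_loop[OF loop_in_self_map[OF f g]]
        chain_winding_loop[OF loop_in_self_map[OF f loop_in_curves(1)]] chain_winding_loop[OF loop_in_self_map[OF f loop_in_curves(2)]]
        chain_winding_loop[OF loop_in_self_map[OF f loop_in_curves(4)]]
        of_int_diff of_int_add of_int_mult .
    then show ?thesis
      unfolding of_int_eq_0_iff by (simp add: matrix_vector_mult_def sum_3 homology_matrix_def basis_curve_simps algebra_simps)
  qed
  then show ?thesis by (simp add: vec_eq_iff)
qed

lemma homology_matrix_comp:
  assumes "self_map f" "self_map g"
  shows "homology_matrix (f \<circ> g) = homology_matrix f ** homology_matrix g"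
proof -
  have "winding_vector (f \<circ> g \<circ> basis_curve j) = homology_matrix f *v winding_vector (g \<circ> basis_curve j)" for j
    using winding_vector_self_map[OF assms(1) loop_in_self_map[OF assms(2) loop_in_basis_curve]] by (simp add: o_assoc)
  then show ?thesis
    by (simp add: vec_eq_iff homology_matrix_def matrix_matrix_mult_def matrix_vector_mult_def)
qed

lemma winding_vector_cong: "(\<And>t. t \<in> {0..1} \<Longrightarrow> g t = h t) \<Longrightarrow> winding_vector g = winding_vector h"
  by (auto simp: winding_vector_def vec_eq_iff intro!: arg_cong[of _ _ "\<lambda>x. \<lfloor>Re x\<rfloor>"] winding_number_cong)

lemma homology_matrix_cong:
  assumes "\<And>q. q \<in> punctured_torus \<Longrightarrow> f q = g q"
  shows "homology_matrix f = homology_matrix g"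
proof -
  have "winding_vector (f \<circ> basis_curve j) = winding_vector (g \<circ> basis_curve j)" for j
    by (rule winding_vector_cong) (use assms loop_in_point[OF loop_in_basis_curve[of j]] in simp)
  then show ?thesis by (simp add: homology_matrix_def)
qed

lemma homology_matrix_id: "homology_matrix (\<lambda>q. q) = mat 1"
proof -
  have "winding_vector (basis_curve j) = axis j 1" for j
    using exhaust_3[of j] by (auto simp: basis_curve_def winding_vector_curves)
  then show ?thesis by (simp add: homology_matrix_def mat_def vec_eq_iff axis_def o_def)
qed

section \<open>Homeomorphisms of the torus that preserve the marked points\<close>

lemma marked_subset_torus: "marked \<subseteq> torus"
  by (auto simp: marked_def torus_cover_in_torus)

lemma torus_cover_image: "torus_cover ` UNIV = torus"
proof (intro equalityI subsetI)
  fix q assume q: "q \<in> torus"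
  obtain z w where q': "q = (z, w)" by force
  have "cis (Arg x) = x" if "cmod x = 1" for x
  proof -
    have "x \<noteq> 0" using that by auto
    then show ?thesis using that by (simp add: cis_Arg sgn_div_norm)
  qed
  then have "cis (Arg z) = z" "cis (Arg w) = w"
    using q q' by (auto simp: torus_def)
  then have "q = torus_cover (Complex (Arg z / (2 * pi)) (Arg w / (2 * pi)))"
    by (simp add: q' torus_cover_def)
  then show "q \<in> torus_cover ` UNIV" by blast
qed (auto simp: torus_cover_in_torus)

lemma marked_homeosD:
  assumes "f \<in> marked_homeos"
  shows "continuous_on torus f" "f ` torus = torus" "inj_on f torus" "f ` marked = marked"
    "f ` punctured_torus = punctured_torus" "self_map f" "f \<in> extensional torus"
proof -
  obtain g where g: "homeomorphism torus torus f g" using assms by (auto simp: marked_homeos_def)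
  then show c: "continuous_on torus f" and im: "f ` torus = torus"
    by (auto simp: homeomorphism_def)
  show inj: "inj_on f torus"
    by (rule inj_on_inverseI[of _ g]) (use g in \<open>simp add: homeomorphism_def\<close>)
  show m: "f ` marked = marked" "f \<in> extensional torus" using assms by (auto simp: marked_homeos_def)
  show "f ` punctured_torus = punctured_torus"
    unfolding punctured_torus_def using inj_on_image_set_diff[OF inj, of torus marked] marked_subset_torus im m by auto
  then show "self_map f"
    using c by (auto simp: self_map_def punctured_torus_def intro: continuous_on_subset)
qed

lemma marked_homeosI:
  assumes "continuous_on torus f" "continuous_on torus g" "f ` torus \<subseteq> torus" "g ` torus \<subseteq> torus"
    "\<And>q. q \<in> torus \<Longrightarrow> f (g q) = q" "\<And>q. q \<in> torus \<Longrightarrow> g (f q) = q"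
    "f ` marked = marked" "f \<in> extensional torus"
  shows "f \<in> marked_homeos"
  unfolding marked_homeos_def using assms by (auto intro!: exI[of _ g] homeomorphismI)

lemma marked_homeos_compose:
  assumes "f \<in> marked_homeos" "g \<in> marked_homeos"
  shows "compose torus f g \<in> marked_homeos"
proof -
  obtain f' g' where f': "homeomorphism torus torus f f'" and g': "homeomorphism torus torus g g'"
    using assms by (auto simp: marked_homeos_def)
  have "homeomorphism torus torus (f \<circ> g) (g' \<circ> f')"
    by (rule homeomorphism_compose[OF g' f'])
  then have "homeomorphism torus torus (compose torus f g) (g' \<circ> f')"
    by (rule homeomorphism_cong) (auto simp: compose_def)
  moreover have "compose torus f g ` marked = marked"
  proof -
    have "compose torus f g ` marked = f ` g ` marked"
      unfolding image_image by (rule image_cong) (use marked_subset_torus in \<open>auto simp: compose_def\<close>)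
    then show ?thesis using marked_homeosD(4) assms by simp
  qed
  ultimately show ?thesis
    by (auto simp: marked_homeos_def)
qed

definition torus_inv :: "(complex \<times> complex \<Rightarrow> complex \<times> complex) \<Rightarrow> complex \<times> complex \<Rightarrow> complex \<times> complex" where
  "torus_inv f = (\<lambda>q\<in>torus. inv_into torus f q)"

lemma torus_inv:
  assumes "f \<in> marked_homeos"
  shows "torus_inv f \<in> marked_homeos" "\<And>q. q \<in> torus \<Longrightarrow> f (torus_inv f q) = q"
    "\<And>q. q \<in> torus \<Longrightarrow> torus_inv f (f q) = q"
proof -
  note f = marked_homeosD[OF assms]
  show r: "f (torus_inv f q) = q" if "q \<in> torus" for q
    using that f(2) by (simp add: torus_inv_def f_inv_into_f)
  show l: "torus_inv f (f q) = q" if "q \<in> torus" for q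
    using that f(2,3) by (auto simp: torus_inv_def)
  obtain g where g: "homeomorphism torus torus f g" using assms by (auto simp: marked_homeos_def)
  have eq: "g q = torus_inv f q" if "q \<in> torus" for q
  proof -
    have "g q \<in> torus" "f (g q) = q" using that g by (auto simp: homeomorphism_def)
    then show ?thesis using l[of "g q"] by simp
  qed
  have "homeomorphism torus torus (torus_inv f) f"
    using homeomorphism_cong[OF homeomorphism_symD[OF g]] eq by metis
  moreover have "torus_inv f ` marked = marked"
  proof -
    have "torus_inv f ` f ` marked = marked"
    proof -
      have "(\<lambda>q. torus_inv f (f q)) ` marked = (\<lambda>q. q) ` marked"
        by (rule image_cong) (use l marked_subset_torus in auto)
      then show ?thesis by (simp add: image_image)
    qed
    then show ?thesis using f(4) by simp
  qed
  ultimately show "torus_inv f \<in> marked_homeos"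
    by (auto simp: marked_homeos_def torus_inv_def)
qed

lemma punctured_subset_torus: "punctured_torus \<subseteq> torus"
  by (auto simp: punctured_torus_def)

lemma homology_matrix_compose:
  assumes "f \<in> marked_homeos" "g \<in> marked_homeos"
  shows "homology_matrix (compose torus f g) = homology_matrix f ** homology_matrix g"
proof -
  have "homology_matrix (compose torus f g) = homology_matrix (f \<circ> g)"
    using punctured_subset_torus by (intro homology_matrix_cong) (auto simp: compose_def)
  then show ?thesis using homology_matrix_comp marked_homeosD(6) assms by simp
qed

lemma homology_matrix_torus_inv:
  assumes "f \<in> marked_homeos"
  shows "homology_matrix f ** homology_matrix (torus_inv f) = mat 1"
    "homology_matrix (torus_inv f) ** homology_matrix f = mat 1"
proof -
  note i = torus_inv[OF assms]
  have "homology_matrix (f \<circ> torus_inv f) = homology_matrix (\<lambda>q. q)" "homology_matrix (torus_inv f \<circ> f) = homology_matrix (\<lambda>q. q)"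
    using i punctured_subset_torus by (auto intro!: homology_matrix_cong)
  then show "homology_matrix f ** homology_matrix (torus_inv f) = mat 1"
    "homology_matrix (torus_inv f) ** homology_matrix f = mat 1"
    using homology_matrix_comp marked_homeosD(6) i(1) assms homology_matrix_id by simp_all
qed

text \<open>Every stage of the isotopy maps the punctured torus to itself, so the images of a loop
  form a free homotopy that avoids the zeros of the dual maps.\<close>

lemma isotopic_homology_matrix:
  assumes "(f, g) \<in> isotopy_rel"
  shows "homology_matrix f = homology_matrix g"
proof -
  obtain h where h: "continuous_on ({0..1::real} \<times> torus) h"
    "\<And>t. t \<in> {0..1} \<Longrightarrow> (\<lambda>q\<in>torus. h (t, q)) \<in> marked_homeos"
    "\<And>q. q \<in> torus \<Longrightarrow> h (0, q) = f q" "\<And>q. q \<in> torus \<Longrightarrow> h (1, q) = g q"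
    using assms by (auto simp: isotopy_rel_def)
  have "winding_number (dual i \<circ> (f \<circ> c)) 0 = winding_number (dual i \<circ> (g \<circ> c)) 0"
    if c: "loop_in punctured_torus c" for c i
  proof (rule winding_number_homotopic_loops)
    have cX: "c t \<in> punctured_torus" "c t \<in> torus" if "t \<in> {0..1}" for t
      using loop_in_point[OF c] that punctured_subset_torus by blast+
    have hX: "h (s, q) \<in> punctured_torus" if "s \<in> {0..1}" "q \<in> punctured_torus" for s q
    proof -
      have "(\<lambda>q\<in>torus. h (s, q)) ` punctured_torus = punctured_torus"
        using marked_homeosD(5)[OF h(2)] that by blast
      then show ?thesis using that punctured_subset_torus by auto
    qed
    show "homotopic_loops (- {0}) (dual i \<circ> (f \<circ> c)) (dual i \<circ> (g \<circ> c))"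
      unfolding homotopic_loops
    proof (intro exI conjI ballI)
      let ?H = "\<lambda>y::real\<times>real. dual i (h (fst y, c (snd y)))"
      have "path c" using c by (simp add: loop_in_def)
      then have "continuous_on ({0..1} \<times> {0..1}) (\<lambda>y::real\<times>real. c (snd y))"
        unfolding path_def by (rule continuous_on_compose2) (auto intro!: continuous_intros)
      then have "continuous_on ({0..1} \<times> {0..1}) (\<lambda>y::real\<times>real. h (fst y, c (snd y)))"
        by (intro continuous_on_compose2[OF h(1)] continuous_intros) (auto simp: cX)
      then show "continuous_on ({0..1} \<times> {0..1}) ?H"
        by (intro continuous_on_compose2[OF continuous_on_dual[of UNIV i]]) auto
      show "?H \<in> {0..1} \<times> {0..1} \<rightarrow> - {0}"
      proof (rule funcsetI)
        fix y :: "real \<times> real" assume "y \<in> {0..1} \<times> {0..1}"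
        then have "h (fst y, c (snd y)) \<in> punctured_torus" by (intro hX cX(1)) auto
        then show "?H y \<in> - {0}" using dual_nonzero by simp
      qed
      have "c 1 = c 0" using c by (simp add: loop_in_def pathfinish_def pathstart_def)
      then show "pathfinish (?H \<circ> Pair t) = pathstart (?H \<circ> Pair t)" for t
        by (simp add: pathfinish_def pathstart_def)
    qed (use h(3,4) cX in auto)
  qed
  then show ?thesis
    using loop_in_basis_curve by (simp add: homology_matrix_def winding_vector_def)
qed

text \<open>The hypothesis is a nonempty subset of a class because products in
  \<open>Mod_group\<close> are elementwise products of classes; for these
  \<open>Mod_group_mult_subset\<close> gives an inclusion in the class of the composite.\<close>

lemma Psi_eq:
  assumes "\<phi> \<noteq> {}" "\<phi> \<subseteq> mapping_class f"
  shows "Psi \<phi> = homology_matrix f"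
proof -
  have m: "homology_matrix g = homology_matrix f \<and> g \<in> marked_homeos" if "g \<in> \<phi>" for g
  proof -
    have "(f, g) \<in> isotopy_rel" using that assms by (auto simp: mapping_class_def)
    then show ?thesis
      using isotopic_homology_matrix[of f g] by (auto simp: isotopy_rel_def homeo_group_def)
  qed
  have ind: "hom_induced 1 (top_of_set punctured_torus) {} (top_of_set punctured_torus) {} g (H1_basis j)
       = H1_comb (column j (homology_matrix f))" if "g \<in> \<phi>" for g j
  proof -
    have "self_map g" using m[OF that] marked_homeosD(6) by blast
    then show ?thesis
      using loop_in_basis_curve[of j] m[OF that]
      by (metis H1_basis_eq hom_induced_loop_class loop_class_eq_H1_comb loop_in_self_map column_homology_matrix)
  qed
  show ?thesis
    unfolding Psi_def
  proof (rule the_equality)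
    fix A assume A: "\<forall>f\<in>\<phi>. \<forall>j. hom_induced 1 (top_of_set punctured_torus) {} (top_of_set punctured_torus) {} f (H1_basis j)
       = H1_comb (column j A)"
    obtain g where "g \<in> \<phi>" using assms by blast
    then have "column j A = column j (homology_matrix f)" for j
      using ind A H1_comb_inject by metis
    then show "A = homology_matrix f" by (simp add: column_def vec_eq_iff)
  qed (use ind in blast)
qed

section \<open>Lifts to the plane and orientation\<close>

text \<open>Distinct Gaussian integers are at distance at least 1.\<close>

lemma continuous_Ints_constant:
  fixes c :: "'b::topological_space \<Rightarrow> complex"
  assumes "connected S" "continuous_on S c" "\<And>x. x \<in> S \<Longrightarrow> Re (c x) \<in> \<int> \<and> Im (c x) \<in> \<int>" "x \<in> S" "y \<in> S"
  shows "c x = c y"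
proof -
  have "c constant_on S"
  proof (rule continuous_discrete_range_constant[OF assms(1,2)])
    fix x assume x: "x \<in> S"
    have "1 \<le> cmod (c y - c x)" if "y \<in> S" "c y \<noteq> c x" for y
    proof (rule ccontr)
      assume "\<not> ?thesis"
      then have "\<bar>Re (c y) - Re (c x)\<bar> < 1" "\<bar>Im (c y) - Im (c x)\<bar> < 1"
        using abs_Re_le_cmod[of "c y - c x"] abs_Im_le_cmod[of "c y - c x"] by auto
      then show False
        using small_Ints[of "Re (c y) - Re (c x)"] small_Ints[of "Im (c y) - Im (c x)"] assms(3) x that
        by (auto simp: complex_eq_iff)
    qed
    then show "\<exists>e>0. \<forall>y. y \<in> S \<and> c y \<noteq> c x \<longrightarrow> e \<le> cmod (c y - c x)"
      by (intro exI[of _ 1]) auto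
  qed
  then show ?thesis using assms(4,5) by (auto simp: constant_on_def)
qed

lemma torus_map_lift:
  assumes "continuous_on torus f" "f ` torus \<subseteq> torus"
  obtains F where "continuous_on UNIV F" "\<And>z. torus_cover (F z) = f (torus_cover z)"
proof -
  have "continuous_on UNIV (\<lambda>z. f (torus_cover z))"
    by (rule continuous_on_compose2[OF assms(1)]) (auto simp: torus_cover_in_torus intro!: continuous_intros)
  moreover have "contractible (UNIV :: complex set)" by (simp add: convex_imp_contractible)
  ultimately obtain F where "continuous_on UNIV F" "\<And>z. z \<in> UNIV \<Longrightarrow> torus_cover (F z) = f (torus_cover z)"
    using lift_to_plane[of "UNIV :: complex set" "\<lambda>z. f (torus_cover z)"] assms(2) torus_cover_in_torus
    by (metis (no_types, lifting) image_subset_iff)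
  then show ?thesis using that by blast
qed

text \<open>The linear part of the lift to the plane, the upper left block acting on the classes of
  \<open>a\<close> (the translation by \<open>\<i>\<close>) and \<open>b\<close> (the translation by \<open>- 1\<close>).\<close>

definition block_map :: "int ^ 3 ^ 3 \<Rightarrow> complex \<Rightarrow> complex" where
  "block_map A z = Complex (of_int (A $ 2 $ 2) * Re z - of_int (A $ 2 $ 1) * Im z)
     (of_int (A $ 1 $ 1) * Im z - of_int (A $ 1 $ 2) * Re z)"

definition block_det :: "int ^ 3 ^ 3 \<Rightarrow> int" where
  "block_det A = A $ 1 $ 1 * A $ 2 $ 2 - A $ 1 $ 2 * A $ 2 $ 1"

lemma linear_block_map: "linear (block_map A)"
  by (rule linearI) (auto simp: block_map_def complex_eq_iff algebra_simps)

lemma inj_block_map: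
  assumes "block_det A \<noteq> 0"
  shows "inj (block_map A)"
  unfolding linear_injective_0[OF linear_block_map]
proof (intro allI impI)
  fix z assume z: "block_map A z = 0"
  then have 1: "of_int (A $ 2 $ 2) * Re z - of_int (A $ 2 $ 1) * Im z = 0"
    and 2: "of_int (A $ 1 $ 1) * Im z - of_int (A $ 1 $ 2) * Re z = 0"
    by (simp_all add: block_map_def complex_eq_iff)
  \<comment> \<open>Cramer's rule.\<close>
  have "of_int (block_det A) * Re z = of_int (A $ 1 $ 1) * (of_int (A $ 2 $ 2) * Re z - of_int (A $ 2 $ 1) * Im z)
      + of_int (A $ 2 $ 1) * (of_int (A $ 1 $ 1) * Im z - of_int (A $ 1 $ 2) * Re z)"
    "of_int (block_det A) * Im z = of_int (A $ 1 $ 2) * (of_int (A $ 2 $ 2) * Re z - of_int (A $ 2 $ 1) * Im z)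
      + of_int (A $ 2 $ 2) * (of_int (A $ 1 $ 1) * Im z - of_int (A $ 1 $ 2) * Re z)"
    by (simp_all add: block_det_def algebra_simps)
  then show "z = 0" unfolding 1 2 using assms by (simp add: complex_eq_iff)
qed

text \<open>For a period \<open>v\<close> the difference \<open>F (z + v) - F z\<close> is a
  continuous function with values in the Gaussian integers, hence independent of \<open>z\<close>.
  For \<open>\<i>\<close> and \<open>1\<close> it is read off from the lifts of the images of
  \<open>a\<close> and \<open>b\<close>; induction gives all other periods.\<close>

lemma lift_translate:
  assumes f: "f \<in> marked_homeos"
    and F: "continuous_on UNIV F" "\<And>z. torus_cover (F z) = f (torus_cover z)"
  shows "F (z + Complex (of_int m) (of_int n)) = F z + block_map (homology_matrix f) (Complex (of_int m) (of_int n))"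
proof -
  let ?A = "homology_matrix f"
  have trans: "F (z + v) - F z = F (w + v) - F w" if "Re v \<in> \<int>" "Im v \<in> \<int>" for v z w
  proof (rule continuous_Ints_constant[of UNIV "\<lambda>z. F (z + v) - F z"])
    show "continuous_on UNIV (\<lambda>z. F (z + v) - F z)"
      by (intro continuous_intros continuous_on_compose2[OF F(1)]) auto
    show "Re (F (z + v) - F z) \<in> \<int> \<and> Im (F (z + v) - F z) \<in> \<int>" for z
      using F(2) torus_cover_add_Ints[OF that] by (simp flip: torus_cover_eq_iff)
  qed auto
  have e: "block_map ?A z = Re z *\<^sub>R block_map ?A 1 + Im z *\<^sub>R block_map ?A \<i>" for z
    by (simp add: block_map_def complex_eq_iff)
  have wv: "of_int (winding_vector (f \<circ> (torus_cover \<circ> l)) $ 1) = Im (F (l 1)) - Im (F (l 0))"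
      "of_int (winding_vector (f \<circ> (torus_cover \<circ> l)) $ 2) = Re (F (l 0)) - Re (F (l 1))"
      if l: "path l" "loop_in punctured_torus (torus_cover \<circ> l)" for l
  proof -
    have lp: "loop_in punctured_torus (f \<circ> (torus_cover \<circ> l))"
      using loop_in_self_map marked_homeosD(6) f l by blast
    have eq: "f \<circ> (torus_cover \<circ> l) = torus_cover \<circ> (F \<circ> l)" using F(2) by auto
    have "path (F \<circ> l)" using l F(1) by (auto intro: path_continuous_image continuous_on_subset)
    from winding_number_dual_lift[OF this] winding_vector_nth[OF lp]
    have "complex_of_real (of_int (winding_vector (f \<circ> (torus_cover \<circ> l)) $ 1)) = of_real (Im (F (l 1)) - Im (F (l 0)))"
      "complex_of_real (of_int (winding_vector (f \<circ> (torus_cover \<circ> l)) $ 2)) = of_real (Re (F (l 0)) - Re (F (l 1)))"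
      unfolding eq by simp_all
    then show "of_int (winding_vector (f \<circ> (torus_cover \<circ> l)) $ 1) = Im (F (l 1)) - Im (F (l 0))"
      "of_int (winding_vector (f \<circ> (torus_cover \<circ> l)) $ 2) = Re (F (l 0)) - Re (F (l 1))"
      unfolding of_real_eq_iff by simp_all
  qed
  have p: "path (\<lambda>t. Complex 0 t)" "path (\<lambda>t. Complex (- t) (1/2))"
    by (auto simp: path_def Complex_eq intro!: continuous_intros)
  have i: "F (z + \<i>) - F z = block_map ?A \<i>" for z
  proof -
    have "F (0 + \<i>) - F 0 = block_map ?A \<i>"
    proof -
      have c01: "Complex 0 0 = 0" "Complex 0 1 = \<i>" by (simp_all add: complex_eq_iff)
      have "F (Complex 0 1) - F (Complex 0 0) = block_map ?A \<i>"
        using wv[OF p(1)] loop_in_curves(1)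
        by (simp add: block_map_def homology_matrix_def basis_curve_simps complex_eq_iff flip: curve_lifts)
      then show ?thesis unfolding c01 by simp
    qed
    then show ?thesis using trans[of \<i> z 0] by simp
  qed
  have o: "F (z + 1) - F z = block_map ?A 1" for z
  proof -
    \<comment> \<open>The curve \<open>b\<close> runs from \<open>\<i>/2\<close> to
      \<open>\<i>/2 - 1\<close>; traversed backwards it is the translation by
      \<open>1\<close>.\<close>
    have "F (Complex 0 (1/2)) - F (Complex (-1) (1/2)) = block_map ?A 1"
      using wv[OF p(2)] loop_in_curves(2)
      by (simp add: block_map_def homology_matrix_def basis_curve_simps complex_eq_iff flip: curve_lifts)
    moreover have "Complex 0 (1/2) = Complex (-1) (1/2) + 1" by (simp add: complex_eq_iff)
    ultimately have "F (Complex (-1) (1/2) + 1) - F (Complex (-1) (1/2)) = block_map ?A 1" by metis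
    then show ?thesis using trans[of 1 z "Complex (-1) (1/2)"] by simp
  qed
  have int: "F (z + of_int m * v) = F z + m *\<^sub>R block_map ?A v"
    if v: "\<And>z. F (z + v) - F z = block_map ?A v" for v z and m :: int
  proof (induction m rule: int_induct[of _ 0])
    case (step1 i)
    then show ?case using v[of "z + of_int i * v"] by (simp add: algebra_simps)
  next
    case (step2 i)
    then show ?case using v[of "z + of_int (i - 1) * v"] by (simp add: algebra_simps)
  qed simp
  have zc: "z + Complex (of_int m) (of_int n) = z + of_int m * 1 + of_int n * \<i>" by (simp add: complex_eq_iff)
  have "F (z + Complex (of_int m) (of_int n)) = F z + m *\<^sub>R block_map ?A 1 + n *\<^sub>R block_map ?A \<i>"
    unfolding zc by (simp only: int[OF o] int[OF i])
  then show ?thesis by (subst e) simp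
qed

lemma homology_matrix_third_column:
  assumes f: "f \<in> marked_homeos"
  shows "homology_matrix f $ 1 $ 3 = 0" "homology_matrix f $ 2 $ 3 = 0"
proof -
  obtain F where F: "continuous_on UNIV F" "\<And>z. torus_cover (F z) = f (torus_cover z)"
    using torus_map_lift[of f] marked_homeosD[OF f] by (metis order_refl)
  define l where "l = F \<circ> (\<lambda>t. 1/4 + 1/8 * cis (2 * pi * t))"
  have eq: "f \<circ> curve_d = torus_cover \<circ> l" using F(2) by (auto simp: curve_lifts l_def)
  have "path l" unfolding l_def
    by (intro path_continuous_image continuous_on_subset[OF F(1)]) (auto simp: path_def intro!: continuous_intros)
  moreover have "l 1 = l 0" by (simp add: l_def)
  ultimately have "winding_number (dual i \<circ> (f \<circ> curve_d)) 0 = 0" if "i = 1 \<or> i = 2" for i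
    using that winding_number_dual_lift[of l] by (auto simp: eq)
  then show "homology_matrix f $ 1 $ 3 = 0" "homology_matrix f $ 2 $ 3 = 0"
    by (simp_all add: homology_matrix_def winding_vector_def basis_curve_simps)
qed

lemma homology_matrix_units:
  assumes f: "f \<in> marked_homeos"
  shows "block_det (homology_matrix f) = 1 \<or> block_det (homology_matrix f) = -1"
    "homology_matrix f $ 3 $ 3 = 1 \<or> homology_matrix f $ 3 $ 3 = -1"
proof -
  let ?A = "homology_matrix f" and ?B = "homology_matrix (torus_inv f)"
  have AB: "?A ** ?B = mat 1" by (rule homology_matrix_torus_inv[OF f])
  note c = homology_matrix_third_column[OF f] homology_matrix_third_column[OF torus_inv(1)[OF f]]
  have "(?A ** ?B) $ i $ j = (if i = j then 1 else 0)" for i j unfolding AB by (simp add: mat_def)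
  note e = this[of 1 1] this[of 1 2] this[of 2 1] this[of 2 2] this[of 3 3]
  have "block_det ?A * block_det ?B = (?A ** ?B) $ 1 $ 1 * (?A ** ?B) $ 2 $ 2 - (?A ** ?B) $ 1 $ 2 * (?A ** ?B) $ 2 $ 1"
    by (simp add: block_det_def matrix_matrix_mult_def sum_3 c algebra_simps)
  then have "block_det ?A * block_det ?B = 1" unfolding e by simp
  then show "block_det ?A = 1 \<or> block_det ?A = -1" by (simp add: zmult_eq_1_iff) blast
  have "?A $ 3 $ 3 * ?B $ 3 $ 3 = 1"
    using e(5) by (simp add: matrix_matrix_mult_def sum_3 c)
  then show "?A $ 3 $ 3 = 1 \<or> ?A $ 3 $ 3 = -1" by (simp add: zmult_eq_1_iff) blast
qed

text \<open>A real linear map has the form \<open>\<alpha> * z + \<beta> * cnj z\<close>, and its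
  determinant is the difference of the squared moduli of \<open>\<alpha>\<close> and
  \<open>\<beta>\<close>. The larger of the two terms determines the winding number: once forwards
  for the first, once backwards for the second.\<close>

lemma winding_number_block_map:
  assumes d: "block_det A = 1 \<or> block_det A = -1" and r: "r > 0"
  shows "winding_number (\<lambda>t. block_map A (circlepath 0 r t)) 0 = of_int (block_det A)"
proof -
  define \<alpha> \<beta> where "\<alpha> = (block_map A 1 - \<i> * block_map A \<i>) / 2" and "\<beta> = (block_map A 1 + \<i> * block_map A \<i>) / 2"
  have eq: "block_map A z = \<alpha> * z + \<beta> * cnj z" for z
    by (simp add: \<alpha>_def \<beta>_def block_map_def complex_eq_iff field_simps)
  have det: "(cmod \<alpha>)\<^sup>2 - (cmod \<beta>)\<^sup>2 = of_int (block_det A)"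
    unfolding cmod_power2 by (simp add: \<alpha>_def \<beta>_def block_map_def block_det_def field_simps power2_eq_square)
  have p: "path (\<lambda>t. c * circlepath 0 r t)" "path (\<lambda>t. c * cnj (circlepath 0 r t))"
    "path (\<lambda>t. block_map A (circlepath 0 r t))" for c
    unfolding eq[abs_def] by (auto simp: path_def circlepath intro!: continuous_intros)
  have e: "circlepath 0 r 1 = circlepath 0 r 0" by (simp add: circlepath)
  have n: "cmod (circlepath 0 r t) = r" for t using r by (simp add: circlepath norm_mult norm_exp_eq_Re)
  have seg: "0 \<notin> closed_segment x (x + y)" if "cmod y < cmod x" for x y :: complex
    using segment_bound(1)[of 0 x "x + y"] that by (auto simp: )
  from d show ?thesis
  proof
    assume D: "block_det A = 1"
    then have "(cmod \<beta>)\<^sup>2 < (cmod \<alpha>)\<^sup>2" using det by simp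
    then have lt: "cmod \<beta> < cmod \<alpha>" by (rule power_less_imp_less_base) simp
    have "winding_number (\<lambda>t. block_map A (circlepath 0 r t)) 0 = winding_number (\<lambda>t. \<alpha> * circlepath 0 r t) 0"
      by (rule winding_number_perturb[OF p(1) p(3)])
         (use lt r n seg in \<open>auto simp: pathfinish_def pathstart_def e eq norm_mult\<close>)
    also have "\<dots> = 1"
      using winding_number_scaled_circle[of \<alpha> r 0] lt r by fastforce
    finally show ?thesis using D by simp
  next
    assume D: "block_det A = -1"
    then have "(cmod \<alpha>)\<^sup>2 < (cmod \<beta>)\<^sup>2" using det by simp
    then have lt: "cmod \<alpha> < cmod \<beta>" by (rule power_less_imp_less_base) simp
    have "winding_number (\<lambda>t. block_map A (circlepath 0 r t)) 0 = winding_number (\<lambda>t. \<beta> * cnj (circlepath 0 r t)) 0"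
      by (rule winding_number_perturb[OF p(2) p(3)])
         (use lt r n seg[of "\<alpha> * _" "\<beta> * _"] in \<open>auto simp: pathfinish_def pathstart_def e eq norm_mult add.commute\<close>)
    also have "(\<lambda>t. \<beta> * cnj (circlepath 0 r t)) = cnj \<circ> (\<lambda>t. cnj \<beta> * (circlepath 0 r t - 0))"
      by auto
    also have "winding_number \<dots> 0 = - cnj (winding_number (\<lambda>t. cnj \<beta> * (circlepath 0 r t - 0)) 0)"
      using winding_number_cnj[of "\<lambda>t. cnj \<beta> * (circlepath 0 r t - 0)" 0] p(1)[of "cnj \<beta>"] lt n r
      by (simp add: path_image_def) (metis (no_types, lifting) imageE complex_cnj_zero_iff mult_eq_0_iff norm_zero less_irrefl norm_ge_zero not_less)
    also have "winding_number (\<lambda>t. cnj \<beta> * (circlepath 0 r t - 0)) 0 = 1"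
      using lt r by (intro winding_number_scaled_circle) auto
    finally show ?thesis using D by simp
  qed
qed

text \<open>Two points with the same image differ by a period, because \<open>f\<close> is
  injective; the period is mapped by the injective linear part, so it is zero.\<close>

lemma lift_injective:
  assumes f: "f \<in> marked_homeos"
    and F: "continuous_on UNIV F" "\<And>z. torus_cover (F z) = f (torus_cover z)"
  shows "inj F"
proof (rule injI)
  fix z w assume eq: "F z = F w"
  then have "f (torus_cover z) = f (torus_cover w)" using F(2) by metis
  then have "torus_cover z = torus_cover w"
    using marked_homeosD(3)[OF f] torus_cover_in_torus by (metis inj_onD)
  then obtain m n :: int where "Re z - Re w = m" "Im z - Im w = n"
    unfolding torus_cover_eq_iff by (auto elim!: Ints_cases)
  then have z: "z = w + Complex (of_int m) (of_int n)" by (simp add: complex_eq_iff)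
  then have "block_map (homology_matrix f) (Complex (of_int m) (of_int n)) = 0"
    using lift_translate[OF f F, of w m n] eq by simp
  moreover have "block_det (homology_matrix f) \<noteq> 0" using homology_matrix_units(1)[OF f] by auto
  ultimately have "Complex (of_int m) (of_int n) = 0"
    using inj_block_map linear_injective_0[OF linear_block_map] by blast
  then show "z = w" using z by simp
qed

text \<open>As \<open>F\<close> is injective, the radius of the circle is irrelevant; on large circles \<open>F\<close> is
  homotopic to its linear part, from which it differs by a bounded function.\<close>

lemma winding_number_lift:
  assumes f: "f \<in> marked_homeos"
    and F: "continuous_on UNIV F" "\<And>z. torus_cover (F z) = f (torus_cover z)" and r: "r > 0"
  shows "winding_number (F \<circ> circlepath z r) (F z) = of_int (block_det (homology_matrix f))"
proof -
  let ?A = "homology_matrix f"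
  note d = homology_matrix_units(1)[OF f]
  have lin: "linear (block_map ?A)" by (rule linear_block_map)
  have contL: "continuous_on S (block_map ?A)" for S
    using lin by (simp add: linear_continuous_on linear_conv_bounded_linear)
  obtain c where c: "c > 0" "\<And>h. c * cmod h \<le> cmod (block_map ?A h)"
    using linear_inj_bounded_below_pos[OF lin inj_block_map] d by (metis zero_neq_one zero_neq_neg_one)
  \<comment> \<open>The deviation from the linear part is doubly periodic, hence bounded by its
    values on the unit square.\<close>
  define G where "G z = F z - block_map ?A z" for z
  obtain C where C: "\<And>z. cmod (G z) \<le> C"
  proof -
    let ?Q = "cbox 0 (Complex 1 1)"
    have "compact (G ` ?Q)"
      unfolding G_def by (intro compact_continuous_image continuous_intros contL continuous_on_subset[OF F(1)]) auto
    then obtain C where C: "\<And>z. z \<in> ?Q \<Longrightarrow> cmod (G z) \<le> C"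
      using compact_imp_bounded bounded_iff by (metis imageI)
    have "cmod (G z) \<le> C" for z
    proof -
      let ?w = "Complex (frac (Re z)) (frac (Im z))" and ?v = "Complex (of_int \<lfloor>Re z\<rfloor>) (of_int \<lfloor>Im z\<rfloor>)"
      have z: "z = ?w + ?v" by (simp add: complex_eq_iff frac_def)
      have "G (?w + ?v) = G ?w"
        unfolding G_def lift_translate[OF f F] linear_add[OF lin] by simp
      then have "G z = G ?w" using z by simp
      moreover have "?w \<in> ?Q" by (auto simp: in_cbox_complex_iff frac_ge_0 less_imp_le[OF frac_lt_1])
      ultimately show ?thesis using C by simp
    qed
    then show ?thesis using that by blast
  qed
  have "C \<ge> 0" using C[of 0] norm_ge_zero order_trans by blast
  \<comment> \<open>On the circle of radius \<open>R\<close> the linear part has modulus at least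
    \<open>c * R\<close>, which exceeds \<open>2 * C\<close>, the bound for the difference of two
    values of \<open>G\<close>.\<close>
  define R where "R = (2 * C + 1) / c"
  have R: "R > 0" "c * R > 2 * C" using c \<open>C \<ge> 0\<close> by (auto simp: R_def)
  have cp: "circlepath z s t = z + circlepath 0 s t" for s t by (simp add: circlepath)
  have e: "circlepath z s 1 = circlepath z s 0" for z s by (simp add: circlepath)
  have n: "s > 0 \<Longrightarrow> cmod (circlepath 0 s t) = s" for s t by (simp add: circlepath norm_mult norm_exp_eq_Re)
  have contF: "continuous_on S g \<Longrightarrow> continuous_on S (\<lambda>x. F (g x))" for S and g :: "'s::topological_space \<Rightarrow> complex"
    by (rule continuous_on_compose2[OF F(1)]) auto
  have "winding_number (F \<circ> circlepath z r) (F z) = winding_number (F \<circ> circlepath z R) (F z)"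
  proof (rule winding_number_homotopic_loops)
    show "homotopic_loops (- {F z}) (F \<circ> circlepath z r) (F \<circ> circlepath z R)"
      unfolding homotopic_loops
    proof (intro exI conjI ballI)
      let ?H = "\<lambda>y::real\<times>real. F (z + circlepath 0 ((1 - fst y) * r + fst y * R) (snd y))"
      show "continuous_on ({0..1} \<times> {0..1}) ?H"
        unfolding circlepath by (intro contF continuous_intros)
      show "?H \<in> {0..1} \<times> {0..1} \<rightarrow> - {F z}"
      proof (rule funcsetI)
        fix y :: "real \<times> real" assume "y \<in> {0..1} \<times> {0..1}"
        then have "0 < (1 - fst y) * r + fst y * R"
          using r R by (cases "fst y = 1") (auto intro!: add_pos_nonneg)
        then have "circlepath 0 ((1 - fst y) * r + fst y * R) (snd y) \<noteq> 0"
          using n[of "(1 - fst y) * r + fst y * R" "snd y"] by auto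
        then show "?H y \<in> - {F z}" using injD[OF lift_injective[OF f F]] by fastforce
      qed
    qed (auto simp: cp[symmetric] pathfinish_def pathstart_def e)
  qed
  also have "\<dots> = winding_number (\<lambda>t. F (z + circlepath 0 R t) - F z) 0"
    by (subst winding_number_offset) (simp add: o_def cp[symmetric])
  also have "\<dots> = winding_number (\<lambda>t. block_map ?A (circlepath 0 R t)) 0"
  proof (rule winding_number_perturb)
    show "path (\<lambda>t. block_map ?A (circlepath 0 R t))"
      unfolding path_def circlepath by (intro continuous_on_compose2[OF contL[of UNIV]] continuous_intros) auto
    show "path (\<lambda>t. F (z + circlepath 0 R t) - F z)"
      unfolding path_def circlepath by (intro continuous_intros contF)
    fix t
    let ?h = "circlepath 0 R t"
    have "F (z + ?h) - F z - block_map ?A ?h = G (z + ?h) - G z"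
      by (simp add: G_def linear_add[OF lin])
    then have "cmod (F (z + ?h) - F z - block_map ?A ?h) \<le> 2 * C"
      using C[of "z + ?h"] C[of z] norm_triangle_ineq4[of "G (z + ?h)" "G z"] by simp
    also have "2 * C < cmod (block_map ?A ?h)" using c(2)[of ?h] n[of R t] R by simp
    finally show "0 \<notin> closed_segment (block_map ?A ?h) (F (z + ?h) - F z)"
      using segment_bound(1)[of 0 "block_map ?A ?h" "F (z + ?h) - F z"] by auto
  qed (auto simp: pathfinish_def pathstart_def e)
  also have "\<dots> = of_int (block_det ?A)" by (rule winding_number_block_map[OF d R(1)])
  finally show ?thesis .
qed

proposition orientation_preserving_iff:
  assumes f: "f \<in> marked_homeos"
  shows "orientation_preserving_on UNIV (f \<circ> torus_cover) \<longleftrightarrow> block_det (homology_matrix f) = 1"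
proof -
  obtain F where F: "continuous_on UNIV F" "\<And>z. torus_cover (F z) = f (torus_cover z)"
    using torus_map_lift[of f] marked_homeosD[OF f] by (metis order_refl)
  note w = winding_number_lift[OF f F]
  show ?thesis
  proof
    assume "block_det (homology_matrix f) = 1"
    then have "winding_number (F \<circ> circlepath z 1) (F z) = 1" for z using w[of 1 z] by simp
    moreover have "F z \<notin> path_image (F \<circ> circlepath z 1)" for z
    proof
      assume "F z \<in> path_image (F \<circ> circlepath z 1)"
      then obtain t where "F z = F (circlepath z 1 t)" by (auto simp: path_image_def)
      then have "z = circlepath z 1 t" using injD[OF lift_injective[OF f F]] by blast
      then show False by (simp add: circlepath)
    qed
    ultimately show "orientation_preserving_on UNIV (f \<circ> torus_cover)"
      unfolding orientation_preserving_on_def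
      using F continuous_on_subset[OF F(1)] by (intro ballI exI[of _ 1] conjI exI[of _ F]) auto
  next
    assume "orientation_preserving_on UNIV (f \<circ> torus_cover)"
    then obtain r l where r: "r > 0" and l: "continuous_on (cball 0 r) l" "\<And>w. w \<in> cball 0 r \<Longrightarrow> torus_cover (l w) = f (torus_cover w)"
      "winding_number (l \<circ> circlepath 0 r) (l 0) = 1"
      unfolding orientation_preserving_on_def by (metis UNIV_I comp_apply)
    \<comment> \<open>Any local lift differs from the global lift by a constant period, so both have
      the same local degree.\<close>
    have "l w - F w = l 0 - F 0" if "w \<in> cball 0 r" for w
    proof (rule continuous_Ints_constant[of "cball 0 r" "\<lambda>w. l w - F w"])
      show "Re (l x - F x) \<in> \<int> \<and> Im (l x - F x) \<in> \<int>" if "x \<in> cball 0 r" for x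
        using l(2)[OF that] F(2)[of x] by (simp flip: torus_cover_eq_iff)
      show "continuous_on (cball 0 r) (\<lambda>w. l w - F w)"
        by (intro continuous_intros l continuous_on_subset[OF F(1)]) auto
    qed (use that r in auto)
    moreover have "circlepath 0 r t \<in> cball 0 r" for t
      using r by (simp add: circlepath norm_mult norm_exp_eq_Re)
    ultimately have "l (circlepath 0 r t) - l 0 = F (circlepath 0 r t) - F 0" for t
      by (metis (no_types, lifting) add_diff_cancel_left' diff_add_eq diff_diff_eq2 add.commute)
    then have "winding_number (l \<circ> circlepath 0 r) (l 0) = winding_number (F \<circ> circlepath 0 r) (F 0)"
      by (subst (1 2) winding_number_offset) (simp add: o_def)
    then have "of_int (block_det (homology_matrix f)) = (1::complex)" using l(3) w[OF r] by simp
    then show "block_det (homology_matrix f) = 1" using of_int_eq_1_iff by blast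
  qed
qed

section \<open>Liftable homeomorphisms\<close>

text \<open>\<open>W\<close> is a small disc in a chart around \<open>s\<close>. Dimension two
  enters here: removing the centre leaves the disc connected.\<close>

lemma closed_surface_nhd:
  assumes S: "closed_surface S" and s: "s \<in> S" and d: "0 < d"
  obtains W where "openin (top_of_set S) W" "s \<in> W" "W \<subseteq> ball s d" "connected (W - {s})" "W - {s} \<noteq> {}"
proof -
  obtain U \<phi> \<psi> where U: "s \<in> U" "openin (top_of_set S) U" and hom: "homeomorphism U (UNIV :: complex set) \<phi> \<psi>"
    using S s unfolding closed_surface_def homeomorphic_def by blast
  have cont: "continuous_on UNIV \<psi>" and im: "\<psi> ` UNIV = U" "\<phi> ` U = UNIV" and inv: "\<And>x. x \<in> U \<Longrightarrow> \<psi> (\<phi> x) = x" "\<And>z. \<phi> (\<psi> z) = z"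
    using hom by (auto simp: homeomorphism_def)
  have "open (\<psi> -` ball s d)" using cont by (simp add: open_vimage)
  moreover have "\<phi> s \<in> \<psi> -` ball s d" using inv(1)[OF U(1)] d by simp
  ultimately obtain r where r: "r > 0" "ball (\<phi> s) r \<subseteq> \<psi> -` ball s d" using open_contains_ball by blast
  let ?W = "\<psi> ` ball (\<phi> s) r"
  have W: "?W - {s} = \<psi> ` (ball (\<phi> s) r - {\<phi> s})"
    using inv(1)[OF U(1)] inv(2) by (auto simp: image_iff)
  have conn: "connected (?W - {s})"
    unfolding W by (intro connected_continuous_image connected_punctured_ball continuous_on_subset[OF cont]) auto
  have ne: "?W - {s} \<noteq> {}"
  proof -
    have "\<phi> s + of_real (r/2) \<in> ball (\<phi> s) r - {\<phi> s}" using r by (simp add: dist_norm)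
    then show ?thesis unfolding W by blast
  qed
  have op: "openin (top_of_set S) ?W"
  proof (rule openin_trans[OF _ U(2)])
    have "openin (top_of_set UNIV) (ball (\<phi> s) r)" by simp
    then show "openin (top_of_set U) ?W"
      using homeomorphism_imp_open_map[OF homeomorphism_symD[OF hom]] by blast
  qed
  have "s \<in> ?W" using inv(1)[OF U(1)] r by (intro image_eqI[of _ _ "\<phi> s"]) auto
  moreover have "?W \<subseteq> ball s d" using r by blast
  ultimately show thesis using that op conn ne by blast
qed

lemma closed_surface_dense:
  assumes S: "closed_surface S" and P: "finite P"
  shows "S \<subseteq> closure (S - P)"
proof
  fix s assume s: "s \<in> S"
  show "s \<in> closure (S - P)"
    unfolding closure_approachable
  proof (intro allI impI)
    fix e :: real assume "e > 0"
    obtain d where d: "d > 0" "\<And>x. x \<in> P \<Longrightarrow> x \<noteq> s \<Longrightarrow> d \<le> dist s x" using finite_set_avoid[OF P] by blast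
    obtain W where W: "openin (top_of_set S) W" "W \<subseteq> ball s (min d e)" "W - {s} \<noteq> {}"
      using closed_surface_nhd[OF S s, of "min d e"] d \<open>e > 0\<close> by (metis min_less_iff_conj)
    then obtain y where y: "y \<in> W" "y \<noteq> s" by blast
    then have "dist s y < d" "dist s y < e" "y \<in> S" using W by (auto dest: openin_imp_subset)
    then show "\<exists>y\<in>S - P. dist y s < e" using d(2) y by (metis DiffI dist_commute not_less)
  qed
qed

lemma closed_surface_agree:
  fixes u v :: "'a::real_normed_vector \<Rightarrow> 'b::real_normed_vector"
  assumes S: "closed_surface S" and P: "finite P" and cont: "continuous_on S u" "continuous_on S v"
    and eq: "\<And>x. x \<in> S - P \<Longrightarrow> u x = v x" and x: "x \<in> S"
  shows "u x = v x"
proof -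
  have "closedin (top_of_set S) {x \<in> S. u x - v x = 0}"
    by (intro continuous_closedin_preimage_constant continuous_intros cont)
  moreover have "closed S" using S by (auto simp: closed_surface_def compact_imp_closed)
  ultimately have "closed {x \<in> S. u x - v x = 0}" using closedin_closed_trans by blast
  then have "closure (S - P) \<subseteq> {x \<in> S. u x - v x = 0}"
    by (rule closure_minimal[rotated]) (use eq in auto)
  then show ?thesis using closed_surface_dense[OF S P] x by auto
qed

text \<open>A small punctured disc around \<open>s\<close> is mapped by \<open>h\<close> into the
  union of disjoint balls around the points of \<open>P\<close>, and connectedness selects one of
  them. Since this works for every smaller radius and always selects the same centre, that centre is
  the limit.\<close>

lemma puncture_limit:
  fixes S :: "'a::real_normed_vector set" and p :: "'a \<Rightarrow> complex \<times> complex"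
  assumes S: "closed_surface S" and p: "continuous_on S p" "p ` S \<subseteq> torus"
    and P: "P = S \<inter> p -` marked" "finite P"
    and f: "f \<in> marked_homeos"
    and h: "continuous_on (S - P) h" "h ` (S - P) \<subseteq> S - P" "\<And>x. x \<in> S - P \<Longrightarrow> p (h x) = f (p x)"
    and s: "s \<in> P"
  obtains q where "q \<in> S" "(h \<longlongrightarrow> q) (at s within (S - P))"
proof -
  have sS: "s \<in> S" using s P by auto
  have fp: "continuous_on S (\<lambda>x. f (p x))"
    using continuous_on_compose2[OF marked_homeosD(1)[OF f] p(1)] p(2) by blast
  have m: "f (p s) \<in> marked" using s P marked_homeosD(4)[OF f] by auto
  obtain d where d: "d > 0" "\<And>x y. x \<in> P \<Longrightarrow> y \<in> P \<Longrightarrow> x \<noteq> y \<Longrightarrow> 2 * d \<le> dist x y"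
  proof -
    have "\<exists>d>0. \<forall>y\<in>P. y \<noteq> x \<longrightarrow> d \<le> dist x y" for x using finite_set_avoid[OF P(2)] by blast
    then obtain D where D: "\<And>x. D x > 0" "\<And>x y. y \<in> P \<Longrightarrow> y \<noteq> x \<Longrightarrow> D x \<le> dist x y" by metis
    have "P \<noteq> {}" using s by auto
    then have "Min (D ` P) > 0" "\<And>x. x \<in> P \<Longrightarrow> Min (D ` P) \<le> D x" using D P(2) by (simp_all add: Min_gr_iff)
    then show ?thesis using that[of "Min (D ` P) / 2"] D(2) by (metis field_sum_of_halves half_gt_zero mult_2 order_trans)
  qed
  have disj: "x = y" if "x \<in> P" "y \<in> P" "z \<in> ball x d" "z \<in> ball y d" for x y z
  proof (rule ccontr)
    assume "x \<noteq> y"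
    with d(2) that have "2 * d \<le> dist x y" by blast
    then show False using that dist_triangle[of x y z] by (auto simp: dist_commute)
  qed
  have near: "\<exists>W q. openin (top_of_set S) W \<and> s \<in> W \<and> W \<inter> P = {s} \<and> W - {s} \<noteq> {} \<and> q \<in> P \<and> h ` (W - {s}) \<subseteq> ball q e"
    if e: "0 < e" "e \<le> d" for e
  proof -
    \<comment> \<open>Off the balls \<open>p\<close> misses the marked point \<open>f (p s)\<close>;
      as \<open>?K\<close> is compact, it even keeps a distance \<open>r\<close> from it.\<close>
    let ?K = "S - (\<Union>q\<in>P. ball q e)"
    have "compact S" using S by (simp add: closed_surface_def)
    then have "compact ?K" by (intro compact_diff) auto
    then have "compact (p ` ?K)" by (intro compact_continuous_image continuous_on_subset[OF p(1)]) auto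
    then have cl: "closed (p ` ?K)" by (rule compact_imp_closed)
    have nin: "f (p s) \<notin> p ` ?K"
    proof
      assume "f (p s) \<in> p ` ?K"
      then obtain x where x: "x \<in> ?K" "f (p s) = p x" by blast
      then have "x \<in> P" using m P by auto
      then show False using x e by auto
    qed
    obtain r where r0: "r > 0" "\<forall>y\<in>p ` ?K. r \<le> dist (f (p s)) y"
      using separate_point_closed[OF cl nin] by metis
    note r = r0(1) bspec[OF r0(2)]
    obtain \<delta> where \<delta>: "\<delta> > 0" "\<And>x. x \<in> S \<Longrightarrow> dist x s < \<delta> \<Longrightarrow> dist (f (p x)) (f (p s)) < r"
      using fp sS r(1) unfolding continuous_on_iff by metis
    obtain c where c: "c > 0" "\<And>x. x \<in> P \<Longrightarrow> x \<noteq> s \<Longrightarrow> c \<le> dist s x" using finite_set_avoid[OF P(2)] by blast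
    obtain W where W: "openin (top_of_set S) W" "s \<in> W" "W \<subseteq> ball s (min c \<delta>)" "connected (W - {s})" "W - {s} \<noteq> {}"
      using closed_surface_nhd[OF S sS, of "min c \<delta>"] c \<delta> by (metis min_less_iff_conj)
    have WS: "W \<subseteq> S" using W(1) by (rule openin_imp_subset)
    have WP: "W \<inter> P = {s}" using W(2,3) s c(2) by force
    then have sub: "W - {s} \<subseteq> S - P" using WS by blast
    have "h x \<in> (\<Union>q\<in>P. ball q e)" if x: "x \<in> W - {s}" for x
    proof (rule ccontr)
      assume "h x \<notin> (\<Union>q\<in>P. ball q e)"
      then have "h x \<in> ?K" using h(2) x sub by blast
      then have "r \<le> dist (f (p s)) (p (h x))" using r(2) by blast
      moreover have "p (h x) = f (p x)" using h(3) x sub by blast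
      moreover have "dist x s < \<delta>" using W(3) x by (auto simp: dist_commute)
      ultimately show False using \<delta>(2)[of x] x WS by (auto simp: dist_commute)
    qed
    then have cover: "h ` (W - {s}) \<subseteq> (\<Union>q\<in>P. ball q e)" by blast
    have conn: "connected (h ` (W - {s}))"
      by (intro connected_continuous_image continuous_on_subset[OF h(1)] sub W(4))
    obtain x0 where x0: "x0 \<in> W - {s}" using W(5) by blast
    then obtain q where q: "q \<in> P" "h x0 \<in> ball q e" using cover by blast
    have "h ` (W - {s}) \<subseteq> ball q e"
    proof (rule ccontr)
      assume "\<not> ?thesis"
      then have n1: "(\<Union>q'\<in>P - {q}. ball q' e) \<inter> h ` (W - {s}) \<noteq> {}" using cover by blast
      have n2: "ball q e \<inter> h ` (W - {s}) \<noteq> {}" using q x0 by blast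
      have dj: "ball q e \<inter> (\<Union>q'\<in>P - {q}. ball q' e) \<inter> h ` (W - {s}) = {}"
      proof -
        have "x \<notin> ball q' e" if "x \<in> ball q e" "q' \<in> P - {q}" for x q'
          using disj[of q q' x] that q(1) e by auto
        then show ?thesis by blast
      qed
      have cv: "h ` (W - {s}) \<subseteq> ball q e \<union> (\<Union>q'\<in>P - {q}. ball q' e)" using cover by blast
      have op: "open (\<Union>q'\<in>P - {q}. ball q' e)" by auto
      show False using connectedD[OF conn open_ball op dj cv] n1 n2 by simp
    qed
    then show ?thesis using W(1,2,5) WP q(1) by blast
  qed
  obtain W q where W: "openin (top_of_set S) W" "s \<in> W" "W \<inter> P = {s}" "q \<in> P" "h ` (W - {s}) \<subseteq> ball q d"
    using near[of d] d(1) by auto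
  have "(h \<longlongrightarrow> q) (at s within (S - P))"
  proof (rule Lim_withinI)
    fix e :: real assume "e > 0"
    define e' where "e' = min d e"
    have e': "0 < e'" "e' \<le> d" "e' \<le> e" using \<open>e > 0\<close> d(1) by (auto simp: e'_def)
    obtain V q' where V: "openin (top_of_set S) V" "s \<in> V" "V \<inter> P = {s}" "q' \<in> P" "h ` (V - {s}) \<subseteq> ball q' e'"
      using near[OF e'(1,2)] by blast
    have "openin (top_of_set S) (V \<inter> W)" using V W by auto
    then obtain r where r: "r > 0" "ball s r \<inter> S \<subseteq> V \<inter> W"
      using V(2) W(2) unfolding openin_contains_ball by (metis IntI)
    \<comment> \<open>A point \<open>y\<close> near \<open>s\<close> lies in both neighbourhoods, so
      its image lies in both selected balls and their centres agree.\<close>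
    have "s \<in> closure (S - P)" using closed_surface_dense[OF S P(2)] sS by blast
    then obtain y where y: "y \<in> S - P" "dist y s < r" using r(1) unfolding closure_approachable by blast
    then have yVW: "y \<in> V - {s}" "y \<in> W - {s}" using r(2) s by (auto simp: dist_commute)
    then have "h y \<in> ball q' e'" "h y \<in> ball q d" using V(5) W(5) by blast+
    then have "q' = q" using disj[of q' q "h y"] V(4) W(4) e' by auto
    have "dist (h x) q \<le> e" if "x \<in> S - P" "0 < dist x s" "dist x s < r" for x
    proof -
      have "x \<in> V - {s}" using that r(2) by (auto simp: dist_commute)
      then have "h x \<in> ball q e'" using V(5) \<open>q' = q\<close> by blast
      then show ?thesis using e' by (simp add: dist_commute)
    qed
    then show "\<exists>d>0. \<forall>x\<in>S - P. 0 < dist x s \<and> dist x s < d \<longrightarrow> dist (h x) q \<le> e"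
      using r(1) by blast
  qed
  then show thesis using that W(4) P(1) by blast
qed

lemma puncture_extension:
  fixes S :: "'a::real_normed_vector set" and p :: "'a \<Rightarrow> complex \<times> complex"
  assumes S: "closed_surface S" and p: "continuous_on S p" "p ` S \<subseteq> torus"
    and P: "P = S \<inter> p -` marked" "finite P"
    and f: "f \<in> marked_homeos"
    and h: "continuous_on (S - P) h" "h ` (S - P) \<subseteq> S - P" "\<And>x. x \<in> S - P \<Longrightarrow> p (h x) = f (p x)"
  obtains H where "continuous_on S H" "H ` S \<subseteq> S" "\<And>x. x \<in> S - P \<Longrightarrow> H x = h x"
proof -
  have "\<exists>q. q \<in> S \<and> (h \<longlongrightarrow> q) (at s within (S - P))" if "s \<in> P" for s
    using puncture_limit[OF assms that] by blast
  then obtain q where q: "\<And>s. s \<in> P \<Longrightarrow> q s \<in> S" "\<And>s. s \<in> P \<Longrightarrow> (h \<longlongrightarrow> q s) (at s within (S - P))"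
    by metis
  define H where "H x = (if x \<in> P then q x else h x)" for x
  have fc: "closed P" using P(2) by (simp add: finite_imp_closed)
  have "continuous (at s within S) H" if s: "s \<in> S" for s
  proof -
    obtain c where c: "c > 0" "\<And>x. x \<in> P \<Longrightarrow> x \<noteq> s \<Longrightarrow> c \<le> dist s x" using finite_set_avoid[OF P(2)] by blast
    have lim: "(h \<longlongrightarrow> H s) (at s within (S - P))"
      using q(2) h(1) s by (cases "s \<in> P") (auto simp: H_def continuous_on_def)
    have "(H \<longlongrightarrow> H s) (at s within S)"
      unfolding Lim_within
    proof (intro allI impI)
      fix e :: real assume "e > 0"
      then obtain d where d: "d > 0" "\<And>x. x \<in> S - P \<Longrightarrow> 0 < dist x s \<Longrightarrow> dist x s < d \<Longrightarrow> dist (h x) (H s) < e"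
        using lim unfolding Lim_within by blast
      have "dist (H x) (H s) < e" if "x \<in> S" "0 < dist x s" "dist x s < min c d" for x
      proof -
        have "x \<notin> P" using c(2)[of x] that by (auto simp: dist_commute)
        then show ?thesis using d(2)[of x] that by (simp add: H_def)
      qed
      then show "\<exists>d>0. \<forall>x\<in>S. 0 < dist x s \<and> dist x s < d \<longrightarrow> dist (H x) (H s) < e"
        using c(1) d(1) by (intro exI[of _ "min c d"]) auto
    qed
    then show ?thesis by (simp add: continuous_within)
  qed
  then have "continuous_on S H" by (simp add: continuous_on_eq_continuous_within)
  moreover have "H ` S \<subseteq> S" using q(1) h(2) by (auto simp: H_def)
  ultimately show thesis using that by (simp add: H_def)
qed

text \<open>The covering inherits this property, which the general lifting criterion requires of the
  domain of the map to be lifted.\<close>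

lemma locally_path_connected_punctured_torus: "locally path_connected punctured_torus"
proof (rule locally_open_subset)
  show "locally path_connected torus"
    unfolding torus_def
    by (rule locally_Times[of path_connected _ path_connected]) (auto intro: path_connected_Times locally_path_connected_sphere)
  have "finite marked" by (simp add: marked_eq)
  then show "openin (top_of_set torus) punctured_torus"
    unfolding punctured_torus_def by (intro openin_diff) (auto simp: closed_subset finite_imp_closed marked_subset_torus)
qed

text \<open>For matrices with third column \<open>(0, 0, e)\<close> this says that the kernel of
  \<open>eta k\<close> is mapped into itself.\<close>

definition preserves_eta :: "nat \<Rightarrow> int ^ 3 ^ 3 \<Rightarrow> bool" where
  "preserves_eta k A \<longleftrightarrow> int k dvd A $ 3 $ 1 \<and> int k dvd A $ 3 $ 2"

text \<open>The third row of \<open>A ** B = mat 1\<close> expresses \<open>e\<close> times the row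
  of the inverse through the row of \<open>A\<close>, and \<open>e\<close> is a unit.\<close>

lemma preserves_eta_torus_inv:
  assumes f: "f \<in> marked_homeos" and A: "preserves_eta k (homology_matrix f)"
  shows "preserves_eta k (homology_matrix (torus_inv f))"
proof -
  let ?A = "homology_matrix f" and ?B = "homology_matrix (torus_inv f)"
  have "(?A ** ?B) $ 3 $ j = mat 1 $ 3 $ j" for j using homology_matrix_torus_inv(1)[OF f] by simp
  from this[of 1] this[of 2]
  have e: "?A $ 3 $ 3 * ?B $ 3 $ 1 = - (?A $ 3 $ 1 * ?B $ 1 $ 1 + ?A $ 3 $ 2 * ?B $ 2 $ 1)"
    "?A $ 3 $ 3 * ?B $ 3 $ 2 = - (?A $ 3 $ 1 * ?B $ 1 $ 2 + ?A $ 3 $ 2 * ?B $ 2 $ 2)"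
    by (auto simp: matrix_matrix_mult_def sum_3 mat_def)
  have "int k dvd ?A $ 3 $ 3 * ?B $ 3 $ 1" "int k dvd ?A $ 3 $ 3 * ?B $ 3 $ 2"
    unfolding e using A by (auto simp: preserves_eta_def)
  then show ?thesis
    using homology_matrix_units(2)[OF f] by (auto simp: preserves_eta_def)
qed

section \<open>Lifting homeomorphisms to a fixed cyclic branched cover\<close>

context
  fixes k :: nat and S :: "'a::real_normed_vector set" and p :: "'a \<Rightarrow> complex \<times> complex"
  assumes cover: "cyclic_branched_cover k S p"
begin

abbreviation "regular_part \<equiv> S \<inter> p -` punctured_torus"

lemma cover_facts:
  "closed_surface S" "continuous_on S p" "p ` S = torus" "finite (S \<inter> p -` marked)" "path_connected regular_part"
  "covering_space regular_part p punctured_torus" "regular_part = S - S \<inter> p -` marked"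
  using cover by (auto simp: cyclic_branched_cover_def punctured_torus_def)

lemma loop_in_cover:
  assumes "path g" "path_image g \<subseteq> regular_part" "p (g 1) = p (g 0)"
  shows "loop_in punctured_torus (p \<circ> g)"
proof -
  have "path (p \<circ> g)"
    using assms(1) continuous_on_subset[OF covering_space_imp_continuous[OF cover_facts(6)] assms(2)]
    by (rule path_continuous_image)
  moreover have "path_image (p \<circ> g) \<subseteq> punctured_torus" using assms(2) by (auto simp: path_image_compose)
  ultimately show ?thesis using assms(3) by (simp add: loop_in_def pathfinish_def pathstart_def)
qed

lemma closed_lift_iff:
  assumes "path g" "path_image g \<subseteq> regular_part" "p (g 1) = p (g 0)"
  shows "g 1 = g 0 \<longleftrightarrow> int k dvd winding_vector (p \<circ> g) $ 3"
proof -
  have "loop_in punctured_torus (p \<circ> g)" by (rule loop_in_cover[OF assms])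
  then show ?thesis
    using cover assms by (auto simp: cyclic_branched_cover_def eta_loop_class pathfinish_def pathstart_def dvd_eq_mod_eq_0)
qed

text \<open>The lifting criterion asks that \<open>f o p\<close> send loops at \<open>z\<close> to
  loops whose lifts at \<open>a\<close> close up. A loop upstairs projects to one with third
  coordinate divisible by \<open>k\<close>, and the matrix of \<open>f\<close> preserves this
  divisibility.\<close>

lemma lift_exists:
  assumes f: "f \<in> marked_homeos" "preserves_eta k (homology_matrix f)" and az: "a \<in> regular_part" "z \<in> regular_part" "f (p z) = p a"
  obtains g where "continuous_on regular_part g" "g ` regular_part \<subseteq> regular_part" "g z = a" "\<And>y. y \<in> regular_part \<Longrightarrow> p (g y) = f (p y)"
proof -
  note cov = cover_facts(6)
  have sm: "self_map f" using marked_homeosD(6) f by blast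
  have cf: "continuous_on regular_part (\<lambda>y. f (p y))"
    by (rule continuous_on_compose2[of punctured_torus f])
       (use sm covering_space_imp_continuous[OF cov] in \<open>auto simp: self_map_def\<close>)
  have imf: "(\<lambda>y. f (p y)) \<in> regular_part \<rightarrow> punctured_torus" using sm by (auto simp: self_map_def)
  have loc: "locally path_connected regular_part"
    using covering_space_locally_path_connected_eq[OF cov] locally_path_connected_punctured_torus by blast
  have lift: "\<exists>q. path q \<and> path_image q \<subseteq> regular_part \<and> pathstart q = a \<and> pathfinish q = a \<and>
       homotopic_paths punctured_torus ((\<lambda>y. f (p y)) \<circ> r) (p \<circ> q)"
    if r: "path r" "path_image r \<subseteq> regular_part" "pathstart r = z" "pathfinish r = z" for r
  proof -
    have lp: "loop_in punctured_torus (p \<circ> r)"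
      using r by (intro loop_in_cover) (simp_all add: pathfinish_def pathstart_def)
    have "int k dvd winding_vector (p \<circ> r) $ 3"
      using closed_lift_iff[OF r(1,2)] r(3,4) by (simp add: pathfinish_def pathstart_def)
    then have kf: "int k dvd winding_vector (f \<circ> (p \<circ> r)) $ 3"
      using f(2) unfolding winding_vector_self_map[OF sm lp]
      by (auto simp: matrix_vector_mult_def sum_3 preserves_eta_def)
    have lpf: "loop_in punctured_torus (f \<circ> (p \<circ> r))" by (rule loop_in_self_map[OF sm lp])
    obtain q where q: "path q" "path_image q \<subseteq> regular_part" "pathstart q = a" "\<And>t. t \<in> {0..1} \<Longrightarrow> p (q t) = (f \<circ> (p \<circ> r)) t"
    proof (rule covering_space_lift_path_strong[OF cov az(1)])
      show "path (f \<circ> (p \<circ> r))" "path_image (f \<circ> (p \<circ> r)) \<subseteq> punctured_torus"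
        using lpf by (simp_all add: loop_in_def)
      show "pathstart (f \<circ> (p \<circ> r)) = p a" using r(3) az by (simp add: pathstart_def)
    qed blast
    have "winding_vector (p \<circ> q) = winding_vector (f \<circ> (p \<circ> r))"
      by (rule winding_vector_cong) (use q(4) in simp)
    moreover have "p (q 1) = p (q 0)"
      using q(4)[of 0] q(4)[of 1] r(3,4) by (simp add: pathfinish_def pathstart_def)
    ultimately have "q 1 = q 0" using closed_lift_iff[OF q(1,2)] kf by simp
    then have "pathfinish q = a" using q(3) by (simp add: pathfinish_def pathstart_def)
    moreover have "homotopic_paths punctured_torus ((\<lambda>y. f (p y)) \<circ> r) (p \<circ> q)"
      by (rule homotopic_paths_eq) (use lpf q(4) in \<open>auto simp: loop_in_def o_def\<close>)
    ultimately show ?thesis using q by blast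
  qed
  show thesis
  proof (rule covering_space_lift_general[OF cov az(1,2) cover_facts(5) loc cf imf az(3)], goal_cases)
    case (1 r)
    then show ?case by (rule lift)
  next
    case (2 g)
    then show ?case using that by blast
  qed
qed

text \<open>Uniqueness of lifts: \<open>g\<close> and the identity lift the same map and agree at
  \<open>z\<close>. It will show that the lifts of \<open>f\<close> and of its inverse are inverse
  to each other.\<close>

lemma deck_identity:
  assumes g: "continuous_on regular_part g" "g ` regular_part \<subseteq> regular_part" "g z = z" "\<And>y. y \<in> regular_part \<Longrightarrow> p (g y) = p y" and z: "z \<in> regular_part" "y \<in> regular_part"
  shows "g y = y"
proof (rule covering_space_lift_unique[OF cover_facts(6), of g z "\<lambda>y. y" regular_part p y])
  show "continuous_on regular_part p" "p \<in> regular_part \<rightarrow> punctured_torus"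
    using covering_space_imp_continuous[OF cover_facts(6)] by auto
  show "connected regular_part" using cover_facts(5) by (rule path_connected_imp_connected)
qed (use g z in auto)

proposition lifts_iff:
  assumes f: "f \<in> marked_homeos"
  shows "lifts S p f \<longleftrightarrow> preserves_eta k (homology_matrix f)"
proof
  assume "lifts S p f"
  then obtain h h' where h: "homeomorphism S S h h'" "\<And>s. s \<in> S \<Longrightarrow> p (h s) = f (p s)" by (auto simp: lifts_def)
  have hC: "h s \<in> regular_part" if "s \<in> regular_part" for s
    using that h marked_homeosD(5)[OF f] by (auto simp: homeomorphism_def)
  \<comment> \<open>The lift of such a loop is closed, and \<open>h\<close> maps it to a closed lift
    of the image loop. The curves \<open>a\<close> and \<open>b\<close> are of this kind, and they
    yield the two entries of the row.\<close>
  have "int k dvd winding_vector (f \<circ> c) $ 3"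
    if c: "loop_in punctured_torus c" "winding_vector c $ 3 = 0" for c
  proof -
    obtain g where g: "path g" "path_image g \<subseteq> regular_part" "\<And>t. t \<in> {0..1} \<Longrightarrow> p (g t) = c t"
      using covering_space_lift_path[OF cover_facts(6), of c] c by (auto simp: loop_in_def)
    have "winding_vector (p \<circ> g) = winding_vector c" by (rule winding_vector_cong) (use g in auto)
    moreover have pg: "p (g 1) = p (g 0)" using c g(3) by (simp add: loop_in_def pathfinish_def pathstart_def)
    ultimately have "g 1 = g 0" using closed_lift_iff[OF g(1,2)] c by simp
    have "path (h \<circ> g)"
      using g(1,2) h(1) by (intro path_continuous_image) (auto simp: homeomorphism_def intro: continuous_on_subset)
    moreover have "path_image (h \<circ> g) \<subseteq> regular_part" using hC g(2) by (force simp: path_image_def)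
    ultimately have "int k dvd winding_vector (p \<circ> (h \<circ> g)) $ 3"
      using closed_lift_iff[of "h \<circ> g"] \<open>g 1 = g 0\<close> by simp
    moreover have "winding_vector (p \<circ> (h \<circ> g)) = winding_vector (f \<circ> c)"
    proof (rule winding_vector_cong)
      fix t :: real assume t: "t \<in> {0..1}"
      then have "g t \<in> S" using g(2) unfolding path_image_def by blast
      then show "(p \<circ> (h \<circ> g)) t = (f \<circ> c) t" using h(2) g(3)[OF t] by simp
    qed
    ultimately show ?thesis by simp
  qed
  from this[OF loop_in_curves(1)] this[OF loop_in_curves(2)]
  show "preserves_eta k (homology_matrix f)"
    by (simp add: preserves_eta_def homology_matrix_def basis_curve_simps winding_vector_curves axis_def)
next
  assume A: "preserves_eta k (homology_matrix f)"
  note fi = torus_inv[OF f] and cf = cover_facts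
  let ?P = "S \<inter> p -` marked"
  have "curve_a 0 \<in> punctured_torus" using loop_in_point[OF loop_in_curves(1), of 0] by simp
  then obtain z where z: "z \<in> regular_part" using cf(3) punctured_subset_torus by (metis IntI image_iff subsetD vimageI)
  have "f (p z) \<in> punctured_torus" using z marked_homeosD(5)[OF f] by blast
  then obtain a where a: "a \<in> regular_part" "f (p z) = p a" using cf(3) punctured_subset_torus by (metis IntI image_iff subsetD vimageI)
  have az: "torus_inv f (p a) = p z" using fi(3)[of "p z"] a z punctured_subset_torus by auto
  obtain h where h: "continuous_on regular_part h" "h ` regular_part \<subseteq> regular_part" "h z = a" "\<And>y. y \<in> regular_part \<Longrightarrow> p (h y) = f (p y)"
    using lift_exists[OF f A a(1) z a(2)] by blast
  \<comment> \<open>The base points are exchanged, so that both composites of \<open>h\<close> and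
    \<open>h'\<close> have a fixed point.\<close>
  obtain h' where h': "continuous_on regular_part h'" "h' ` regular_part \<subseteq> regular_part" "h' a = z" "\<And>y. y \<in> regular_part \<Longrightarrow> p (h' y) = torus_inv f (p y)"
    using lift_exists[OF fi(1) preserves_eta_torus_inv[OF f A] z a(1) az] by blast
  have pt: "p y \<in> torus" if "y \<in> regular_part" for y using that punctured_subset_torus by auto
  have inv1: "h' (h y) = y" if "y \<in> regular_part" for y
  proof (rule deck_identity[OF _ _ _ _ z that])
    show "(\<lambda>y. h' (h y)) ` regular_part \<subseteq> regular_part" using h(2) h'(2) unfolding image_subset_iff by blast
    show "continuous_on regular_part (\<lambda>y. h' (h y))" using continuous_on_compose2[OF h'(1) h(1,2)] .
    show "p (h' (h y)) = p y" if "y \<in> regular_part" for y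
    proof -
      have "h y \<in> regular_part" using h(2) that by blast
      then show ?thesis using h(4)[OF that] h'(4) fi(3) pt[OF that] by simp
    qed
  qed (use h h' in auto)
  have inv2: "h (h' y) = y" if "y \<in> regular_part" for y
  proof (rule deck_identity[OF _ _ _ _ a(1) that])
    show "(\<lambda>y. h (h' y)) ` regular_part \<subseteq> regular_part" using h(2) h'(2) unfolding image_subset_iff by blast
    show "continuous_on regular_part (\<lambda>y. h (h' y))" using continuous_on_compose2[OF h(1) h'(1,2)] .
    show "p (h (h' y)) = p y" if "y \<in> regular_part" for y
    proof -
      have "h' y \<in> regular_part" using h'(2) that by blast
      then show ?thesis using h'(4)[OF that] h(4) fi(2) pt[OF that] by simp
    qed
  qed (use h h' in auto)
  \<comment> \<open>Both lifts extend over the branch points; the identities between them carry over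
    from the dense regular part.\<close>
  note ext = puncture_extension[OF cf(1,2) equalityD1[OF cf(3)] refl cf(4)]
  obtain H where H: "continuous_on S H" "H ` S \<subseteq> S" "\<And>x. x \<in> regular_part \<Longrightarrow> H x = h x"
    using ext[OF f, of h] h unfolding cf(7)[symmetric] by metis
  obtain H' where H': "continuous_on S H'" "H' ` S \<subseteq> S" "\<And>x. x \<in> regular_part \<Longrightarrow> H' x = h' x"
    using ext[OF fi(1), of h'] h' unfolding cf(7)[symmetric] by metis
  have reg: "x \<in> regular_part" if "x \<in> S - ?P" for x using that cf(7) by blast
  have 1: "H' (H s) = s" if "s \<in> S" for s
  proof (rule closed_surface_agree[of S ?P "\<lambda>s. H' (H s)" "\<lambda>s. s", OF cf(1,4) _ continuous_on_id _ that])
    show "continuous_on S (\<lambda>s. H' (H s))" using continuous_on_compose2[OF H'(1) H(1,2)] .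
    fix x assume "x \<in> S - ?P"
    then have x: "x \<in> regular_part" by (rule reg)
    then have "h x \<in> regular_part" using h(2) by blast
    then show "H' (H x) = x" using H(3)[OF x] H'(3) inv1[OF x] by simp
  qed
  have 2: "H (H' s) = s" if "s \<in> S" for s
  proof (rule closed_surface_agree[of S ?P "\<lambda>s. H (H' s)" "\<lambda>s. s", OF cf(1,4) _ continuous_on_id _ that])
    show "continuous_on S (\<lambda>s. H (H' s))" using continuous_on_compose2[OF H(1) H'(1,2)] .
    fix x assume "x \<in> S - ?P"
    then have x: "x \<in> regular_part" by (rule reg)
    then have "h' x \<in> regular_part" using h'(2) by blast
    then show "H (H' x) = x" using H'(3)[OF x] H(3) inv2[OF x] by simp
  qed
  have "p (H s) = f (p s)" if "s \<in> S" for s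
  proof (rule closed_surface_agree[of S ?P "\<lambda>s. p (H s)" "\<lambda>s. f (p s)", OF cf(1,4) _ _ _ that])
    show "continuous_on S (\<lambda>s. p (H s))" using continuous_on_compose2[OF cf(2) H(1,2)] .
    show "continuous_on S (\<lambda>s. f (p s))"
      using continuous_on_compose2[OF marked_homeosD(1)[OF f] cf(2)] cf(3) by simp
    fix x assume "x \<in> S - ?P"
    then have x: "x \<in> regular_part" by (rule reg)
    then show "p (H x) = f (p x)" using H(3)[OF x] h(4)[OF x] by simp
  qed
  moreover have "homeomorphism S S H H'"
    using H(1,2) H'(1,2) 1 2 by (intro homeomorphismI) auto
  ultimately show "lifts S p f" by (auto simp: lifts_def)
qed

end

section \<open>The Dehn twists and the hyperelliptic involution\<close>

text \<open>The amount of twisting, in full turns, as a function of the position across the strip: 0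
  on one side and 1 on the other.\<close>

definition clamp01 :: "real \<Rightarrow> real" where
  "clamp01 u = max 0 (min 1 u)"

lemma continuous_on_clamp01 [continuous_intros]:
  "continuous_on S f \<Longrightarrow> continuous_on S (\<lambda>x. clamp01 (f x))"
  unfolding clamp01_def by (intro continuous_intros)

lemma torus_cover_strip_eq_iff:
  assumes "\<beta> = 1 \<or> \<beta> = \<i>"
  shows "torus_cover (p + \<beta> * Complex s t) = torus_cover (p + \<beta> * Complex s' t') \<longleftrightarrow> s - s' \<in> \<int> \<and> t - t' \<in> \<int>"
proof -
  have "t' - t \<in> \<int> \<longleftrightarrow> t - t' \<in> \<int>" by (metis Ints_minus minus_diff_eq)
  then show ?thesis using assms by (auto simp: torus_cover_eq_iff)
qed

text \<open>Here \<open>s\<close> is the coordinate across the strip and \<open>t\<close> the one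
  along it. The strip is \<open>\<bar>s\<bar> \<le> 1/8\<close>, with radius
  \<open>3/2 + 4 * s\<close> in the model annulus, so the twist makes \<open>4 * s + 1/2\<close>
  turns. Elsewhere the clamp is an integer, and whole turns are invisible in the torus; thus one
  formula serves for the whole torus.\<close>

lemma left_twist_strip:
  assumes \<beta>: "\<beta> = 1 \<or> \<beta> = \<i>" and s: "\<bar>s\<bar> \<le> 1/2"
  shows "left_twist (strip_chart p \<beta>) (torus_cover (p + \<beta> * Complex s t))
    = torus_cover (p + \<beta> * Complex s (t + clamp01 (4 * s + 1/2)))"
proof (cases "\<bar>s\<bar> \<le> 1/8")
  case True
  have polar: "strip_chart p \<beta> (rcis (3/2 + 4 * s) (2 * pi * u)) = torus_cover (p + \<beta> * Complex s u)" for u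
  proof -
    let ?z = "rcis (3/2 + 4 * s) (2 * pi * u)"
    have r: "cmod ?z = 3/2 + 4 * s" "3/2 + 4 * s > 0" using True by (auto simp: abs_le_iff)
    then have "?z \<noteq> 0" by (metis less_irrefl norm_zero)
    then have "cis (2 * pi * (Arg ?z / (2 * pi))) = cis (2 * pi * u)"
    proof -
      have "cis (Arg ?z) = ?z / of_real (3/2 + 4 * s)"
        using \<open>?z \<noteq> 0\<close> cis_Arg[of ?z] sgn_eq[of ?z] unfolding r(1) by simp
      also have "\<dots> = cis (2 * pi * u)"
        using r(2) unfolding rcis_def by (metis nonzero_mult_div_cancel_left of_real_eq_0_iff less_irrefl)
      finally show ?thesis by simp
    qed
    then have "torus_cover (Complex 0 (Arg ?z / (2 * pi))) = torus_cover (Complex 0 u)"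
      by (simp add: torus_cover_def)
    then have "Arg ?z / (2 * pi) - u \<in> \<int>" by (simp add: torus_cover_eq_iff)
    then show ?thesis
      using r by (simp add: strip_chart_def torus_cover_strip_eq_iff[OF \<beta>])
  qed
  let ?z = "rcis (3/2 + 4 * s) (2 * pi * t)"
  have z: "?z \<in> annulus" "cmod ?z = 3/2 + 4 * s" using True by (auto simp: annulus_def abs_le_iff)
  have q: "torus_cover (p + \<beta> * Complex s t) = strip_chart p \<beta> ?z" using polar[of t] by simp
  have "inv_into annulus (strip_chart p \<beta>) (strip_chart p \<beta> ?z) = ?z"
    by (rule inv_into_f_f[OF inj_on_strip_chart[OF \<beta>] z(1)])
  then have "left_twist (strip_chart p \<beta>) (torus_cover (p + \<beta> * Complex s t)) = strip_chart p \<beta> (annulus_twist ?z)"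
    unfolding left_twist_def using torus_cover_in_torus[of "p + \<beta> * Complex s t"] z(1) by (auto simp: q)
  also have "annulus_twist ?z = rcis (3/2 + 4 * s) (2 * pi * (t + (4 * s + 1/2)))"
    unfolding annulus_twist_def z(2) by (simp add: rcis_def cis_mult algebra_simps)
  also have "strip_chart p \<beta> \<dots> = torus_cover (p + \<beta> * Complex s (t + (4 * s + 1/2)))" by (rule polar)
  also have "4 * s + 1/2 = clamp01 (4 * s + 1/2)" using True by (auto simp: clamp01_def abs_le_iff)
  finally show ?thesis .
next
  case False
  have "torus_cover (p + \<beta> * Complex s t) \<notin> strip_chart p \<beta> ` annulus"
  proof
    assume "torus_cover (p + \<beta> * Complex s t) \<in> strip_chart p \<beta> ` annulus"
    then obtain z where z: "z \<in> annulus" "torus_cover (p + \<beta> * Complex s t) = strip_chart p \<beta> z" by blast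
    then have "s - (cmod z - 3/2) / 4 \<in> \<int>" by (simp add: strip_chart_def torus_cover_strip_eq_iff[OF \<beta>])
    moreover have b: "\<bar>(cmod z - 3/2) / 4\<bar> \<le> 1/8"
      using z(1) unfolding annulus_def mem_Collect_eq abs_le_iff by (simp add: field_simps)
    then have "\<bar>s - (cmod z - 3/2) / 4\<bar> < 1" using s unfolding abs_le_iff abs_less_iff by linarith
    ultimately have "s = (cmod z - 3/2) / 4" using small_Ints by fastforce
    then show False using b False by metis
  qed
  then have "left_twist (strip_chart p \<beta>) (torus_cover (p + \<beta> * Complex s t)) = torus_cover (p + \<beta> * Complex s t)"
    by (simp add: left_twist_def torus_cover_in_torus)
  moreover have "clamp01 (4 * s + 1/2) = 0 \<or> clamp01 (4 * s + 1/2) = 1"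
    using False by (auto simp: clamp01_def)
  then have "torus_cover (p + \<beta> * Complex s (t + clamp01 (4 * s + 1/2))) = torus_cover (p + \<beta> * Complex s t)"
    unfolding torus_cover_strip_eq_iff[OF \<beta>] by auto
  ultimately show ?thesis by simp
qed

lemma torus_strip_rep:
  assumes \<beta>: "\<beta> = 1 \<or> \<beta> = \<i>" and q: "q \<in> torus"
  obtains s t where "- 1/2 \<le> s" "s < 1/2" "0 \<le> t" "t \<le> 1" "q = torus_cover (p + \<beta> * Complex s t)"
proof -
  obtain z where z: "q = torus_cover z" using q torus_cover_image by blast
  define w where "w = (z - p) / \<beta>"
  have b0: "\<beta> \<noteq> 0" using \<beta> by auto
  let ?s = "frac (Re w + 1/2) - 1/2" and ?t = "frac (Im w)"
  have "q = torus_cover (p + \<beta> * Complex (Re w) (Im w))" using z b0 by (simp add: w_def)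
  also have "\<dots> = torus_cover (p + \<beta> * Complex ?s ?t)"
    unfolding torus_cover_strip_eq_iff[OF \<beta>] by (simp add: frac_def)
  finally show thesis
    using that[of ?s ?t] frac_ge_0[of "Re w + 1/2"] frac_lt_1[of "Re w + 1/2"] frac_ge_0[of "Im w"] frac_lt_1[of "Im w"]
    by force
qed

text \<open>A continuous map from a compact space onto a Hausdorff space is a quotient map. This
  reduces continuity of a twist to its formula in strip coordinates.\<close>

lemma continuous_on_compact_quotient:
  fixes \<kappa> :: "'b::t2_space \<Rightarrow> 'c::t2_space" and f :: "'c \<Rightarrow> 'd::topological_space"
  assumes K: "compact K" "continuous_on K \<kappa>" "\<kappa> ` K = Y" and f: "continuous_on K (\<lambda>x. f (\<kappa> x))"
  shows "continuous_on Y f"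
  unfolding continuous_openin_preimage_eq
proof (intro allI impI)
  fix V :: "'d set" assume "open V"
  then have "openin (top_of_set K) (K \<inter> (\<lambda>x. f (\<kappa> x)) -` V)"
    using f by (simp add: continuous_openin_preimage_gen)
  moreover have "K \<inter> (\<lambda>x. f (\<kappa> x)) -` V = K \<inter> \<kappa> -` (Y \<inter> f -` V)" using K(3) by auto
  ultimately show "openin (top_of_set Y) (Y \<inter> f -` V)"
    using Abstract_Topology_2.continuous_imp_quotient_map[OF K(2,3,1), of "Y \<inter> f -` V"] by simp
qed

lemma compact_torus: "compact torus"
  unfolding torus_def by (intro compact_Times compact_sphere)

text \<open>The twist preserves \<open>s\<close> and shifts \<open>t\<close> by an amount that
  depends on \<open>s\<close> alone, so it is a bijection; a continuous bijection of a compact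
  Hausdorff space is a homeomorphism.\<close>

lemma left_twist_marked_homeo:
  assumes \<beta>: "\<beta> = 1 \<or> \<beta> = \<i>" and m: "\<And>q. q \<in> marked \<Longrightarrow> left_twist (strip_chart p \<beta>) q = q"
  shows "left_twist (strip_chart p \<beta>) \<in> marked_homeos"
proof -
  let ?f = "left_twist (strip_chart p \<beta>)"
  let ?K = "{-1/2..1/2} \<times> {0..1} :: (real \<times> real) set"
  let ?\<kappa> = "\<lambda>x. torus_cover (p + \<beta> * Complex (fst x) (snd x))"
  have eq: "?f (?\<kappa> x) = torus_cover (p + \<beta> * Complex (fst x) (snd x + clamp01 (4 * fst x + 1/2)))" if "x \<in> ?K" for x
    using that by (intro left_twist_strip[OF \<beta>]) auto
  have cont: "continuous_on torus ?f"
  proof (rule continuous_on_compact_quotient[of ?K ?\<kappa>])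
    show "compact ?K" by (intro compact_Times) auto
    show "continuous_on ?K ?\<kappa>" unfolding Complex_eq by (intro continuous_intros)
    show "?\<kappa> ` ?K = torus"
    proof (intro equalityI subsetI)
      fix q assume "q \<in> torus"
      then obtain s t where "- 1/2 \<le> s" "s < 1/2" "0 \<le> t" "t \<le> 1" "q = torus_cover (p + \<beta> * Complex s t)"
        using torus_strip_rep[OF \<beta>] by blast
      then show "q \<in> ?\<kappa> ` ?K" by (intro image_eqI[of _ _ "(s, t)"]) auto
    qed (auto simp: torus_cover_in_torus)
    have "continuous_on ?K (\<lambda>x. torus_cover (p + \<beta> * Complex (fst x) (snd x + clamp01 (4 * fst x + 1/2))))"
      unfolding Complex_eq by (intro continuous_intros)
    then show "continuous_on ?K (\<lambda>x. ?f (?\<kappa> x))"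
      by (rule continuous_on_eq) (use eq in simp)
  qed
  have inj: "inj_on ?f torus"
  proof (rule inj_onI)
    fix q q' assume q: "q \<in> torus" "q' \<in> torus" and fq: "?f q = ?f q'"
    obtain s t where s: "- 1/2 \<le> s" "s < 1/2" "q = torus_cover (p + \<beta> * Complex s t)"
      using torus_strip_rep[OF \<beta> q(1)] by blast
    obtain s' t' where s': "- 1/2 \<le> s'" "s' < 1/2" "q' = torus_cover (p + \<beta> * Complex s' t')"
      using torus_strip_rep[OF \<beta> q(2)] by blast
    have e: "?f q = torus_cover (p + \<beta> * Complex s (t + clamp01 (4 * s + 1/2)))"
      "?f q' = torus_cover (p + \<beta> * Complex s' (t' + clamp01 (4 * s' + 1/2)))"
      unfolding s(3) s'(3) by (rule left_twist_strip[OF \<beta>]; use s s' in linarith)+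
    then have "s - s' \<in> \<int>" and t: "t + clamp01 (4 * s + 1/2) - (t' + clamp01 (4 * s' + 1/2)) \<in> \<int>"
      using fq unfolding e torus_cover_strip_eq_iff[OF \<beta>] by blast+
    moreover have "\<bar>s - s'\<bar> < 1" using s s' by linarith
    ultimately have "s = s'" using small_Ints by fastforce
    then show "q = q'" using t s s' by (simp add: torus_cover_strip_eq_iff[OF \<beta>])
  qed
  have im: "?f ` torus = torus"
  proof (intro equalityI subsetI)
    fix q assume "q \<in> torus"
    then obtain s t where s: "- 1/2 \<le> s" "s < 1/2" "q = torus_cover (p + \<beta> * Complex s t)"
      using torus_strip_rep[OF \<beta>] by blast
    have "?f (torus_cover (p + \<beta> * Complex s (t - clamp01 (4 * s + 1/2)))) = q"
      unfolding s(3) using s by (subst left_twist_strip[OF \<beta>]) auto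
    then show "q \<in> ?f ` torus" using torus_cover_in_torus by blast
  next
    fix q assume "q \<in> ?f ` torus"
    then obtain q' where q': "q' \<in> torus" "q = ?f q'" by blast
    obtain s t where s: "- 1/2 \<le> s" "s < 1/2" "q' = torus_cover (p + \<beta> * Complex s t)"
      using torus_strip_rep[OF \<beta> q'(1)] by blast
    show "q \<in> torus" unfolding q'(2) s(3)
      by (subst left_twist_strip[OF \<beta>]) (use s torus_cover_in_torus in auto)
  qed
  obtain g where "homeomorphism torus torus ?f g"
    using homeomorphism_compact[OF compact_torus cont im inj] by blast
  moreover have "?f ` marked = marked" using m by force
  moreover have "?f \<in> extensional torus" by (simp add: left_twist_def)
  ultimately show ?thesis by (auto simp: marked_homeos_def)
qed

section \<open>The twists about a, b, c and the involution in coordinates\<close>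

abbreviation "twist_a \<equiv> left_twist (strip_chart 0 1)"
abbreviation "twist_b \<equiv> left_twist (strip_chart (\<i>/2) \<i>)"
abbreviation "twist_c \<equiv> left_twist (strip_chart (1/2) 1)"
abbreviation "involution \<equiv> (\<lambda>q\<in>torus. (cnj (fst q), cnj (snd q)))"

lemma twist_a: "\<bar>x\<bar> \<le> 1/2 \<Longrightarrow> twist_a (torus_cover (Complex x y)) = torus_cover (Complex x (y + clamp01 (4 * x + 1/2)))"
  using left_twist_strip[of 1 x 0 y] by simp

lemma twist_c: "\<bar>x - 1/2\<bar> \<le> 1/2 \<Longrightarrow>
  twist_c (torus_cover (Complex x y)) = torus_cover (Complex x (y + clamp01 (4 * x - 3/2)))"
  using left_twist_strip[of 1 "x - 1/2" "1/2" y] by (simp add: Complex_eq algebra_simps)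

text \<open>As for \<open>c\<close>, the strip is centred at \<open>1/2\<close>, so the amount of
  twisting is \<open>4 * (y - 1/2) + 1/2\<close>. With \<open>\<beta> = \<i>\<close> the direction
  along the strip is \<open>\<i> * \<beta> = - 1\<close>, hence the minus sign.\<close>

lemma twist_b: "\<bar>y - 1/2\<bar> \<le> 1/2 \<Longrightarrow>
  twist_b (torus_cover (Complex x y)) = torus_cover (Complex (x - clamp01 (4 * y - 3/2)) y)"
  using left_twist_strip[of \<i> "y - 1/2" "\<i>/2" "- x"] by (simp add: Complex_eq algebra_simps)

lemma torus_cover_shift:
  "torus_cover (Complex (x + 1) y) = torus_cover (Complex x y)"
  "torus_cover (Complex (x - 1) y) = torus_cover (Complex x y)"
  "torus_cover (Complex x (y + 1)) = torus_cover (Complex x y)"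
  by (simp_all add: torus_cover_eq_iff)

lemma clamp01_simps: "u \<le> 0 \<Longrightarrow> clamp01 u = 0" "1 \<le> u \<Longrightarrow> clamp01 u = 1" "0 \<le> u \<Longrightarrow> u \<le> 1 \<Longrightarrow> clamp01 u = u"
  by (auto simp: clamp01_def)

text \<open>The circle has \<open>x\<close> between \<open>1/8\<close> and \<open>3/8\<close>, so it
  meets the strips around \<open>a\<close> and \<open>c\<close> at most in their boundary lines,
  where the twist is the identity; it misses the strip around \<open>b\<close>.\<close>

lemma twists_fix_curve_d:
  "twist_a (curve_d t) = curve_d t" "twist_b (curve_d t) = curve_d t" "twist_c (curve_d t) = curve_d t"
proof -
  define x y where "x = 1/4 + 1/8 * cos (2 * pi * t)" and "y = 1/8 * sin (2 * pi * t)"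
  have d: "curve_d t = torus_cover (Complex x y)" by (simp add: curve_d_def x_def y_def torus_cover_eq_iff)
  have x: "1/8 \<le> x" "x \<le> 3/8" and y: "-1/8 \<le> y" "y \<le> 1/8"
    using cos_ge_minus_one[of "2*pi*t"] cos_le_one[of "2*pi*t"] sin_ge_minus_one[of "2*pi*t"] sin_le_one[of "2*pi*t"]
    unfolding x_def y_def by linarith+
  show "twist_a (curve_d t) = curve_d t"
    using x twist_a[of x y] by (simp add: d clamp01_simps torus_cover_shift)
  show "twist_c (curve_d t) = curve_d t"
    using x twist_c[of x y] by (simp add: d clamp01_simps abs_le_iff)
  show "twist_b (curve_d t) = curve_d t"
  proof (cases "y \<ge> 0")
    \<comment> \<open>The formula for \<open>twist_b\<close> covers heights in
      \<open>[0, 1]\<close>; a negative height is first raised by 1.\<close>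
    case True
    then show ?thesis using y twist_b[of y x] by (simp add: d clamp01_simps abs_le_iff)
  next
    case False
    then show ?thesis using y twist_b[of "y + 1" x]
      by (simp add: d clamp01_simps abs_le_iff torus_cover_shift)
  qed
qed

lemma twists_marked_homeos: "twist_a \<in> marked_homeos" "twist_b \<in> marked_homeos" "twist_c \<in> marked_homeos"
proof -
  have m: "marked = {torus_cover (Complex (1/4) 0), torus_cover (Complex (-1/4) 0)}"
    by (simp add: marked_def Complex_eq)
  have e: "torus_cover (Complex (-1/4) 0) = torus_cover (Complex (3/4) 0)" by (simp add: torus_cover_eq_iff)
  have "twist_c (torus_cover (Complex (-1/4) 0)) = torus_cover (Complex (-1/4) 0)"
    unfolding e using twist_c[of "3/4" 0] by (simp add: clamp01_simps torus_cover_eq_iff)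
  then have "twist_a q = q" "twist_b q = q" "twist_c q = q" if "q \<in> marked" for q
    using that twist_a[of "1/4" 0] twist_a[of "-1/4" 0] twist_b[of 0 "1/4"] twist_b[of 0 "-1/4"]
      twist_c[of "1/4" 0] twist_c[of "3/4" 0]
    by (auto simp: m clamp01_simps torus_cover_eq_iff)
  then show "twist_a \<in> marked_homeos" "twist_b \<in> marked_homeos" "twist_c \<in> marked_homeos"
    by (intro left_twist_marked_homeo; simp)+
qed

lemma involution_marked_homeo: "involution \<in> marked_homeos"
proof (rule marked_homeosI[of _ involution])
  have "continuous_on torus (\<lambda>q. (cnj (fst q), cnj (snd q)))" by (intro continuous_intros)
  then show "continuous_on torus involution" "continuous_on torus involution"
    by (auto elim!: continuous_on_eq)
  have "marked \<subseteq> torus" by (rule marked_subset_torus)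
  then show "involution ` marked = marked" by (auto simp: marked_eq image_iff)
qed (auto simp: torus_def)

lemma winding_vector_torus_cover:
  fixes n :: "int ^ 3"
  assumes l: "path l" and n1: "Im (l 1) - Im (l 0) = of_int (n $ 1)" and n2: "Re (l 0) - Re (l 1) = of_int (n $ 2)"
    and n3: "winding_number (dual 3 \<circ> (torus_cover \<circ> l)) 0 = of_int (n $ 3)"
  shows "winding_vector (torus_cover \<circ> l) = n"
proof (rule winding_vector_eqI)
  fix i
  have "complex_of_real (Im (l 1) - Im (l 0)) = of_int (n $ 1)" "complex_of_real (Re (l 0) - Re (l 1)) = of_int (n $ 2)"
    unfolding n1 n2 by simp_all
  then show "winding_number (dual i \<circ> (torus_cover \<circ> l)) 0 = of_int (n $ i)"
    using exhaust_3[of i] winding_number_dual_lift[OF l] n3 by auto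
qed

lemma path_dual_torus_cover:
  assumes "path l"
  shows "path (dual i \<circ> (torus_cover \<circ> l))"
proof -
  have "path (torus_cover \<circ> l)"
    by (rule path_continuous_image[OF assms]) (intro continuous_intros)
  then show ?thesis by (rule path_continuous_image[OF _ continuous_on_dual])
qed

text \<open>The inequality says that the third dual map stays in the right half-plane along the
  loop.\<close>

lemma winding_number_dual_3_zero:
  assumes l: "path l" "Re (l 1) - Re (l 0) \<in> \<int>" "Im (l 1) - Im (l 0) \<in> \<int>"
    and pos: "\<And>t. t \<in> {0..1} \<Longrightarrow> cos (2 * pi * Im (l t)) < cos (2 * pi * Re (l t)) + 1"
  shows "winding_number (dual 3 \<circ> (torus_cover \<circ> l)) 0 = 0"
proof (rule winding_number_Re_pos)
  show "path (dual 3 \<circ> (torus_cover \<circ> l))" by (rule path_dual_torus_cover[OF l(1)])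
  have "torus_cover (l 1) = torus_cover (l 0)" using l by (simp add: torus_cover_eq_iff)
  then show "pathfinish (dual 3 \<circ> (torus_cover \<circ> l)) = pathstart (dual 3 \<circ> (torus_cover \<circ> l))"
    by (simp add: pathfinish_def pathstart_def)
  show "0 < Re ((dual 3 \<circ> (torus_cover \<circ> l)) t)" if "t \<in> {0..1}" for t
    using pos[OF that] by (simp add: dual_3_torus_cover)
qed

text \<open>The shape that \<open>homology_matrix_third_column\<close> forces on the matrices of
  marked homeomorphisms.\<close>

definition block_matrix :: "int \<Rightarrow> int \<Rightarrow> int \<Rightarrow> int \<Rightarrow> int \<Rightarrow> int \<Rightarrow> int \<Rightarrow> int ^ 3 ^ 3" where
  "block_matrix a b c d x y e = vector [vector [a, b, 0], vector [c, d, 0], vector [x, y, e]]"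

lemma block_matrix_nth [simp]:
  "block_matrix a b c d x y e $ 1 $ 1 = a" "block_matrix a b c d x y e $ 1 $ 2 = b" "block_matrix a b c d x y e $ 1 $ 3 = 0"
  "block_matrix a b c d x y e $ 2 $ 1 = c" "block_matrix a b c d x y e $ 2 $ 2 = d" "block_matrix a b c d x y e $ 2 $ 3 = 0"
  "block_matrix a b c d x y e $ 3 $ 1 = x" "block_matrix a b c d x y e $ 3 $ 2 = y" "block_matrix a b c d x y e $ 3 $ 3 = e"
  by (simp_all add: block_matrix_def)

lemma matrix_3_eqI:
  fixes A B :: "int ^ 3 ^ 3"
  assumes "A $ 1 $ 1 = B $ 1 $ 1" "A $ 1 $ 2 = B $ 1 $ 2" "A $ 1 $ 3 = B $ 1 $ 3"
    "A $ 2 $ 1 = B $ 2 $ 1" "A $ 2 $ 2 = B $ 2 $ 2" "A $ 2 $ 3 = B $ 2 $ 3"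
    "A $ 3 $ 1 = B $ 3 $ 1" "A $ 3 $ 2 = B $ 3 $ 2" "A $ 3 $ 3 = B $ 3 $ 3"
  shows "A = B"
  using assms by (simp add: vec_eq_iff forall_3)

lemma homology_matrix_eqI:
  assumes "winding_vector (f \<circ> curve_a) = vector [a, c, x]" "winding_vector (f \<circ> curve_b) = vector [b, d, y]"
    "winding_vector (f \<circ> curve_d) = vector [0, 0, e]"
  shows "homology_matrix f = block_matrix a b c d x y e"
  by (rule matrix_3_eqI) (simp_all add: homology_matrix_def basis_curve_simps assms)

lemma cos_pos_near_0:
  assumes "\<bar>x\<bar> \<le> 1/8"
  shows "0 < cos (2 * pi * x)"
proof (rule cos_gt_zero_pi)
  have "2 * pi * \<bar>x\<bar> \<le> 2 * pi * (1/8)" using assms by (intro mult_left_mono) auto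
  then have "\<bar>2 * pi * x\<bar> < pi / 2" by (simp add: abs_mult)
  then show "- (pi / 2) < 2 * pi * x" "2 * pi * x < pi / 2" by linarith+
qed

lemma cos_plus_int: "cos (2 * pi * (x - 1)) = cos (2 * pi * x)" "cos (2 * pi * (x + 1)) = cos (2 * pi * x)"
  "cos (2 * pi * (x - 1/2)) = - cos (2 * pi * x)" "cos (2 * pi * (x + 1/2)) = - cos (2 * pi * x)"
  "cos (2 * pi * (1/2 + x)) = - cos (2 * pi * x)" "cos (2 * pi * - x) = cos (2 * pi * x)"
  by (simp_all add: distrib_left right_diff_distrib cos_diff cos_add)

lemma twist_d_vector:
  assumes "\<And>t. f (curve_d t) = curve_d t"
  shows "winding_vector (f \<circ> curve_d) = vector [0, 0, 1]"
proof -
  have "winding_vector (f \<circ> curve_d) = axis 3 1"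
    unfolding winding_vector_curves(4)[symmetric] by (rule winding_vector_cong) (simp add: assms)
  then show ?thesis by (simp add: vec_eq_iff forall_3 axis_def)
qed

lemma homology_matrix_twist_a: "homology_matrix twist_a = block_matrix 1 (-1) 0 1 0 0 1"
proof (rule homology_matrix_eqI)
  show "winding_vector (twist_a \<circ> curve_d) = vector [0, 0, 1]" by (rule twist_d_vector) (rule twists_fix_curve_d)
  have cos_le: "cos x < 2" "- 2 < cos x" for x :: real
    using cos_le_one[of x] cos_ge_minus_one[of x] by linarith+
  \<comment> \<open>The curve \<open>a\<close> is the core of its strip, where the twist is half a
    turn along the curve.\<close>
  let ?l = "\<lambda>t. Complex 0 (t + 1/2)"
  have "winding_vector (twist_a \<circ> curve_a) = winding_vector (torus_cover \<circ> ?l)"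
    by (rule winding_vector_cong) (simp add: curve_lifts twist_a clamp01_simps)
  also have "\<dots> = vector [1, 0, 0]"
  proof (rule winding_vector_torus_cover)
    show p: "path ?l" unfolding path_def Complex_eq by (intro continuous_intros)
    have "winding_number (dual 3 \<circ> (torus_cover \<circ> ?l)) 0 = 0"
    proof (rule winding_number_dual_3_zero[OF p])
      show "cos (2 * pi * Im (?l t)) < cos (2 * pi * Re (?l t)) + 1" for t
        unfolding complex.sel cos_plus_int using cos_le(2)[of "2 * pi * t"] by simp
    qed simp_all
    then show "winding_number (dual 3 \<circ> (torus_cover \<circ> ?l)) 0 = of_int (vector [1, 0, 0 :: int] $ (3::3))" by simp
  qed simp_all
  finally show "winding_vector (twist_a \<circ> curve_a) = vector [1, 0, 0]" .
  \<comment> \<open>The curve \<open>b\<close> starts and ends inside the strip around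
    \<open>a\<close>, so its twisted lift is glued from two halves, with \<open>x = - t\<close> and
    \<open>x = 1 - t\<close>. In the first half the last two terms cancel; in the second half the
    first clamp is 0 and \<open>- 1\<close> is an invisible full turn. Altogether the height drops
    from \<open>1/2\<close> to \<open>- 1/2\<close>.\<close>
  let ?\<psi> = "\<lambda>t. clamp01 (1/2 - 4 * t) + clamp01 (4 * (1 - t) + 1/2) - 1"
  let ?l = "\<lambda>t. Complex (- t) (1/2 + ?\<psi> t)"
  have "winding_vector (twist_a \<circ> curve_b) = winding_vector (torus_cover \<circ> ?l)"
  proof (rule winding_vector_cong)
    fix t :: real assume t: "t \<in> {0..1}"
    show "(twist_a \<circ> curve_b) t = (torus_cover \<circ> ?l) t"
    proof (cases "t \<le> 1/2")
      case True
      then show ?thesis using t twist_a[of "- t" "1/2"] by (simp add: curve_lifts clamp01_simps)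
    next
      case False
      have "curve_b t = torus_cover (Complex (1 - t) (1/2))"
        by (simp add: curve_lifts torus_cover_eq_iff)
      moreover have "clamp01 (4 * (1 - t) + 1/2) - 1 - clamp01 (4 * (1 - t) + 1/2) = -1" by simp
      ultimately show ?thesis using t False twist_a[of "1 - t" "1/2"]
        by (simp add: clamp01_simps(1) torus_cover_eq_iff)
    qed
  qed
  also have "\<dots> = vector [-1, 1, 0]"
  proof (rule winding_vector_torus_cover)
    show p: "path ?l" unfolding path_def Complex_eq by (intro continuous_intros)
    have "winding_number (dual 3 \<circ> (torus_cover \<circ> ?l)) 0 = 0"
    proof (rule winding_number_dual_3_zero[OF p])
      fix t :: real assume t: "t \<in> {0..1}"
      \<comment> \<open>Away from the strip \<open>?\<psi>\<close> is 0 and the left side is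
        \<open>- 1\<close>; inside the strip \<open>cos (2 * pi * t)\<close> is positive.\<close>
      have "- cos (2 * pi * ?\<psi> t) < cos (2 * pi * t) + 1"
      proof (cases "1/8 < t \<and> t < 7/8")
        case True
        then have "?\<psi> t = 0" by (simp add: clamp01_simps)
        then show ?thesis using cos_le(2)[of "2 * pi * t"] by simp
      next
        case False
        then have "0 < cos (2 * pi * t)"
          using t cos_pos_near_0[of t] cos_pos_near_0[of "t - 1"] by (cases "t \<le> 1/8") (auto simp: cos_plus_int)
        then show ?thesis using cos_ge_minus_one[of "2 * pi * ?\<psi> t"] by linarith
      qed
      then show "cos (2 * pi * Im (?l t)) < cos (2 * pi * Re (?l t)) + 1"
        unfolding complex.sel cos_plus_int .
    qed (simp_all add: clamp01_simps)
    then show "winding_number (dual 3 \<circ> (torus_cover \<circ> ?l)) 0 = of_int (vector [-1, 1, 0 :: int] $ (3::3))" by simp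
  qed (simp_all add: clamp01_simps)
  finally show "winding_vector (twist_a \<circ> curve_b) = vector [-1, 1, 0]" .
qed

lemma homology_matrix_twist_b: "homology_matrix twist_b = block_matrix 1 0 1 1 0 0 1"
proof (rule homology_matrix_eqI)
  show "winding_vector (twist_b \<circ> curve_d) = vector [0, 0, 1]" by (rule twist_d_vector) (rule twists_fix_curve_d)
  have cos_le: "cos x < 2" "- 2 < cos x" for x :: real
    using cos_le_one[of x] cos_ge_minus_one[of x] by linarith+
  let ?l = "\<lambda>t. Complex (- (t + 1/2)) (1/2)"
  have "winding_vector (twist_b \<circ> curve_b) = winding_vector (torus_cover \<circ> ?l)"
    by (rule winding_vector_cong) (simp add: curve_lifts twist_b clamp01_simps)
  also have "\<dots> = vector [0, 1, 0]"
  proof (rule winding_vector_torus_cover)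
    show p: "path ?l" unfolding path_def Complex_eq by (intro continuous_intros)
    have "winding_number (dual 3 \<circ> (torus_cover \<circ> ?l)) 0 = 0"
    proof (rule winding_number_dual_3_zero[OF p])
      show "cos (2 * pi * Im (?l t)) < cos (2 * pi * Re (?l t)) + 1" for t
        unfolding complex.sel cos_plus_int using cos_le(1)[of "2 * pi * t"] by simp
    qed simp_all
    then show "winding_number (dual 3 \<circ> (torus_cover \<circ> ?l)) 0 = of_int (vector [0, 1, 0 :: int] $ (3::3))" by simp
  qed simp_all
  finally show "winding_vector (twist_b \<circ> curve_b) = vector [0, 1, 0]" .
  let ?l = "\<lambda>t. Complex (- clamp01 (4 * t - 3/2)) t"
  have "winding_vector (twist_b \<circ> curve_a) = winding_vector (torus_cover \<circ> ?l)"
  proof (rule winding_vector_cong)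
    fix t :: real assume "t \<in> {0..1}"
    then have "\<bar>t - 1/2\<bar> \<le> 1/2" unfolding abs_le_iff atLeastAtMost_iff by linarith
    then show "(twist_b \<circ> curve_a) t = (torus_cover \<circ> ?l) t"
      using twist_b[of t 0] by (simp add: curve_lifts)
  qed
  also have "\<dots> = vector [1, 1, 0]"
  proof (rule winding_vector_torus_cover)
    show p: "path ?l" unfolding path_def Complex_eq by (intro continuous_intros)
    have "winding_number (dual 3 \<circ> (torus_cover \<circ> ?l)) 0 = 0"
    proof (rule winding_number_dual_3_zero[OF p])
      fix t :: real assume t: "t \<in> {0..1}"
      \<comment> \<open>Inside the strip \<open>cos (2 * pi * t)\<close> is negative; outside it the
        clamp is an integer and the right side equals 2.\<close>
      have "cos (2 * pi * t) < cos (2 * pi * clamp01 (4 * t - 3/2)) + 1"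
      proof (cases "3/8 < t \<and> t < 5/8")
        case True
        then have "\<bar>t - 1/2\<bar> \<le> 1/8" unfolding abs_le_iff by linarith
        then have "0 < - cos (2 * pi * t)"
          using cos_pos_near_0[of "t - 1/2"] unfolding cos_plus_int by blast
        then show ?thesis using cos_ge_minus_one[of "2 * pi * clamp01 (4 * t - 3/2)"] by linarith
      next
        case False
        then have "clamp01 (4 * t - 3/2) = 0 \<or> clamp01 (4 * t - 3/2) = 1" by (auto simp: clamp01_def)
        then show ?thesis using cos_le(1)[of "2 * pi * t"] by auto
      qed
      then show "cos (2 * pi * Im (?l t)) < cos (2 * pi * Re (?l t)) + 1"
        unfolding complex.sel cos_plus_int .
    qed (simp_all add: clamp01_simps)
    then show "winding_number (dual 3 \<circ> (torus_cover \<circ> ?l)) 0 = of_int (vector [1, 1, 0 :: int] $ (3::3))" by simp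
  qed (simp_all add: clamp01_simps)
  finally show "winding_vector (twist_b \<circ> curve_a) = vector [1, 1, 0]" .
qed

lemma homology_matrix_twist_c: "homology_matrix twist_c = block_matrix 1 (-1) 0 1 0 (-1) 1"
proof (rule homology_matrix_eqI)
  show "winding_vector (twist_c \<circ> curve_d) = vector [0, 0, 1]" by (rule twist_d_vector) (rule twists_fix_curve_d)
  have "winding_vector (twist_c \<circ> curve_a) = winding_vector curve_a"
    by (rule winding_vector_cong) (simp add: curve_lifts twist_c clamp01_simps)
  then show "winding_vector (twist_c \<circ> curve_a) = vector [1, 0, 0]"
    by (simp add: winding_vector_curves vec_eq_iff forall_3 axis_def)
  let ?\<psi> = "\<lambda>t. clamp01 (4 * (1 - t) - 3/2)"
  let ?l = "\<lambda>t. Complex (- t) (1/2 + ?\<psi> t)"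
  have "winding_vector (twist_c \<circ> curve_b) = winding_vector (torus_cover \<circ> ?l)"
  proof (rule winding_vector_cong)
    fix t :: real assume t: "t \<in> {0..1}"
    have "curve_b t = torus_cover (Complex (1 - t) (1/2))"
      by (simp add: curve_lifts torus_cover_eq_iff)
    moreover have "\<bar>1 - t - 1/2\<bar> \<le> 1/2" using t unfolding abs_le_iff atLeastAtMost_iff by linarith
    ultimately show "(twist_c \<circ> curve_b) t = (torus_cover \<circ> ?l) t"
      using twist_c[of "1 - t" "1/2"] by (simp add: torus_cover_eq_iff)
  qed
  also have "\<dots> = vector [-1, 1, -1]"
  proof (rule winding_vector_torus_cover)
    show p: "path ?l" unfolding path_def Complex_eq by (intro continuous_intros)
    have p\<psi>: "path ?\<psi>" unfolding path_def by (intro continuous_intros)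
    \<comment> \<open>The third dual map is here \<open>cis (2 * pi * ?\<psi> t)\<close> plus the
      nonnegative number \<open>cos (2 * pi * t) + 1\<close>. The segment between the two could meet
      0 only where the first equals \<open>-1\<close>; there \<open>t = 1/2\<close>, and the added
      number is 0. As \<open>?\<psi>\<close> falls from 1 to 0, the winding number is
      \<open>-1\<close>.\<close>
    have "winding_number (dual 3 \<circ> (torus_cover \<circ> ?l)) 0 = winding_number (\<lambda>t. cis (2 * pi * ?\<psi> t)) 0"
    proof (rule winding_number_perturb)
      show "path (\<lambda>t. cis (2 * pi * ?\<psi> t))" unfolding path_def by (intro continuous_intros)
      show "path (dual 3 \<circ> (torus_cover \<circ> ?l))"
        by (rule path_dual_torus_cover[OF p])
      fix t :: real assume t: "t \<in> {0..1}"
      have d: "(dual 3 \<circ> (torus_cover \<circ> ?l)) t = cis (2 * pi * ?\<psi> t) + of_real (cos (2 * pi * t) + 1)"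
        by (simp add: dual_3_torus_cover complex_eq_iff distrib_left sin_add cos_add)
      show "0 \<notin> closed_segment (cis (2 * pi * ?\<psi> t)) ((dual 3 \<circ> (torus_cover \<circ> ?l)) t)"
      proof
        assume "0 \<in> closed_segment (cis (2 * pi * ?\<psi> t)) ((dual 3 \<circ> (torus_cover \<circ> ?l)) t)"
        then obtain u where u: "0 \<le> u" "u \<le> 1"
          and eq: "0 = (1 - u) *\<^sub>R cis (2 * pi * ?\<psi> t) + u *\<^sub>R (cis (2 * pi * ?\<psi> t) + of_real (cos (2 * pi * t) + 1))"
          unfolding d by (auto simp: in_segment)
        have eq': "cis (2 * pi * ?\<psi> t) = - of_real (u * (cos (2 * pi * t) + 1))"
          using eq by (simp add: complex_eq_iff algebra_simps)
        have "0 \<le> u * (cos (2 * pi * t) + 1)"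
        proof (rule mult_nonneg_nonneg[OF u(1)])
          show "0 \<le> cos (2 * pi * t) + 1" using cos_ge_minus_one[of "2 * pi * t"] by linarith
        qed
        then have one: "u * (cos (2 * pi * t) + 1) = 1"
          using arg_cong[OF eq', of cmod] unfolding norm_minus_cancel norm_of_real norm_cis by simp
        have "cos (2 * pi * ?\<psi> t) = - 1"
          using arg_cong[OF eq', of Re] unfolding one by simp
        then have "cos (2 * pi * (?\<psi> t - 1/2)) = 1" by (simp only: cos_plus_int)
        then obtain n :: int where "2 * pi * (?\<psi> t - 1/2) = of_int n * 2 * pi"
          unfolding cos_one_2pi_int by blast
        then have "?\<psi> t - 1/2 = of_int n" by simp
        then have "?\<psi> t - 1/2 \<in> \<int>" by (metis Ints_of_int)
        moreover have "0 \<le> ?\<psi> t \<and> ?\<psi> t \<le> 1" by (auto simp: clamp01_def)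
        then have "\<bar>?\<psi> t - 1/2\<bar> < 1" unfolding abs_less_iff by linarith
        ultimately have "?\<psi> t - 1/2 = 0" by (rule small_Ints)
        then have "?\<psi> t = 1/2" by simp
        then have "t = 1/2" by (auto simp: clamp01_def max_def min_def split: if_splits)
        then have "cos (2 * pi * t) = -1" by (simp only: mult.assoc) simp
        then show False using one by simp
      qed
    qed (simp_all add: pathfinish_def pathstart_def clamp01_simps dual_3_torus_cover complex_eq_iff cos_plus_int)
    then show "winding_number (dual 3 \<circ> (torus_cover \<circ> ?l)) 0 = of_int (vector [-1, 1, -1 :: int] $ (3::3))"
      using winding_number_sphere_lift[OF p\<psi>] by (simp add: clamp01_simps)
  qed (simp_all add: clamp01_simps)
  finally show "winding_vector (twist_c \<circ> curve_b) = vector [-1, 1, -1]" .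
qed

text \<open>Each dual map turns the involution into complex conjugation, which changes the sign of
  winding numbers.\<close>

lemma homology_matrix_involution: "homology_matrix involution = block_matrix (-1) 0 0 (-1) 0 0 (-1)"
proof -
  have "winding_number (dual i \<circ> (involution \<circ> g)) 0 = - winding_number (dual i \<circ> g) 0" if g: "loop_in punctured_torus g" for g i
  proof -
    have "winding_number (dual i \<circ> (involution \<circ> g)) 0 = winding_number (cnj \<circ> (dual i \<circ> g)) 0"
    proof (rule winding_number_cong)
      fix t :: real assume "0 \<le> t" "t \<le> 1"
      then have "g t \<in> torus" using loop_in_point[OF g] punctured_subset_torus by auto
      then show "(dual i \<circ> (involution \<circ> g)) t = (cnj \<circ> (dual i \<circ> g)) t"
        using exhaust_3[of i] by (auto simp: dual_simps)
    qed
    also have "\<dots> = - cnj (winding_number (dual i \<circ> g) 0)"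
      using winding_number_cnj[OF dual_path(1,3)[OF g], of i] by simp
    also have "\<dots> = - winding_number (dual i \<circ> g) 0"
      unfolding winding_vector_nth[OF g, symmetric] by simp
    finally show ?thesis .
  qed
  then have "winding_vector (involution \<circ> g) = - winding_vector g" if "loop_in punctured_torus g" for g
    using that by (intro winding_vector_eqI) (simp add: winding_vector_nth)
  then show ?thesis
    by (intro homology_matrix_eqI) (auto simp: loop_in_curves winding_vector_curves vec_eq_iff forall_3 axis_def)
qed

section \<open>The image of the liftable mapping class group\<close>

lemma carrier_homeo_group:
  "carrier homeo_group = {f \<in> marked_homeos. block_det (homology_matrix f) = 1}"
  by (auto simp: homeo_group_def orientation_preserving_iff)

lemma mult_homeo_group: "f \<otimes>\<^bsub>homeo_group\<^esub> g = compose torus f g"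
  by (simp add: homeo_group_def)

text \<open>The zeros in the third column of the left factor make the block of the product the
  product of the blocks.\<close>

lemma block_det_mult:
  fixes A B :: "int ^ 3 ^ 3"
  assumes "A $ 1 $ 3 = 0" "A $ 2 $ 3 = 0"
  shows "block_det (A ** B) = block_det A * block_det B"
  using assms by (simp add: block_det_def matrix_matrix_mult_def sum_3 algebra_simps)

lemma homeo_group_compose:
  assumes "f \<in> carrier homeo_group" "g \<in> carrier homeo_group"
  shows "compose torus f g \<in> carrier homeo_group"
  using assms homology_matrix_third_column
  by (simp add: carrier_homeo_group marked_homeos_compose homology_matrix_compose block_det_mult)

lemma homeo_group_torus_inv:
  assumes "f \<in> carrier homeo_group"
  shows "torus_inv f \<in> carrier homeo_group"
proof -
  have f: "f \<in> marked_homeos" "block_det (homology_matrix f) = 1" using assms by (auto simp: carrier_homeo_group)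
  have "block_det (mat 1) = 1" by (simp add: block_det_def mat_def)
  then have "block_det (homology_matrix f) * block_det (homology_matrix (torus_inv f)) = 1"
    using homology_matrix_torus_inv(1)[OF f(1)] block_det_mult[OF homology_matrix_third_column[OF f(1)]] by metis
  then show ?thesis using f torus_inv(1)[OF f(1)] by (simp add: carrier_homeo_group)
qed

lemma mapping_class_refl:
  assumes "f \<in> carrier homeo_group"
  shows "f \<in> mapping_class f"
proof -
  have f: "f \<in> marked_homeos" using assms by (simp add: carrier_homeo_group)
  have "continuous_on ({0..1::real} \<times> torus) (\<lambda>x. f (snd x))"
    by (rule continuous_on_compose2[OF marked_homeosD(1)[OF f]]) (auto intro: continuous_intros)
  moreover have "(\<lambda>q\<in>torus. f q) = f" using marked_homeosD(7)[OF f] by (rule extensional_restrict)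
  ultimately show ?thesis
    using assms f unfolding mapping_class_def isotopy_rel_def
    by (auto intro!: exI[of _ "\<lambda>x. f (snd x)"])
qed

lemma isotopic_compose:
  assumes "(f, f') \<in> isotopy_rel" "(g, g') \<in> isotopy_rel"
  shows "(compose torus f g, compose torus f' g') \<in> isotopy_rel"
proof -
  obtain h where h: "continuous_on ({0..1::real} \<times> torus) h" "\<And>t. t \<in> {0..1} \<Longrightarrow> (\<lambda>q\<in>torus. h (t, q)) \<in> marked_homeos"
    "\<And>q. q \<in> torus \<Longrightarrow> h (0, q) = f q \<and> h (1, q) = f' q"
    using assms(1) by (auto simp: isotopy_rel_def)
  obtain k where k: "continuous_on ({0..1::real} \<times> torus) k" "\<And>t. t \<in> {0..1} \<Longrightarrow> (\<lambda>q\<in>torus. k (t, q)) \<in> marked_homeos"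
    "\<And>q. q \<in> torus \<Longrightarrow> k (0, q) = g q \<and> k (1, q) = g' q"
    using assms(2) by (auto simp: isotopy_rel_def)
  have kt: "k (t, q) \<in> torus" if "t \<in> {0..1}" "q \<in> torus" for t q
  proof -
    have "(\<lambda>q\<in>torus. k (t, q)) ` torus = torus" using marked_homeosD(2) k(2)[OF that(1)] by blast
    then show ?thesis using that(2) by force
  qed
  define H where "H x = h (fst x, k x)" for x
  have "continuous_on ({0..1} \<times> torus) H"
    unfolding H_def by (intro continuous_on_compose2[OF h(1)] continuous_intros k(1)) (auto simp: kt)
  moreover have "(\<lambda>q\<in>torus. H (t, q)) \<in> marked_homeos" if "t \<in> {0..1}" for t
  proof -
    have "(\<lambda>q\<in>torus. H (t, q)) = compose torus (\<lambda>q\<in>torus. h (t, q)) (\<lambda>q\<in>torus. k (t, q))"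
      using kt[OF that] by (auto simp: compose_def H_def restrict_def fun_eq_iff)
    then show ?thesis using marked_homeos_compose h(2) k(2) that by simp
  qed
  moreover have "H (0, q) = compose torus f g q \<and> H (1, q) = compose torus f' g' q" if "q \<in> torus" for q
    using that h(3) k(3) kt[of 0 q] kt[of 1 q] by (simp add: H_def compose_def)
  moreover have "f \<in> carrier homeo_group" "f' \<in> carrier homeo_group" "g \<in> carrier homeo_group" "g' \<in> carrier homeo_group"
    using assms by (auto simp: isotopy_rel_def)
  ultimately show ?thesis
    unfolding isotopy_rel_def by (auto intro!: exI[of _ H] homeo_group_compose)
qed

lemma Mod_group_mult_subset:
  assumes "\<phi> \<subseteq> mapping_class f" "\<psi> \<subseteq> mapping_class g"
  shows "\<phi> \<otimes>\<^bsub>Mod_group\<^esub> \<psi> \<subseteq> mapping_class (compose torus f g)"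
  using assms isotopic_compose
  by (auto simp: Mod_group_def set_mult_def mult_homeo_group mapping_class_def) blast

lemma Mod_group_mult_nonempty: "\<phi> \<noteq> {} \<Longrightarrow> \<psi> \<noteq> {} \<Longrightarrow> \<phi> \<otimes>\<^bsub>Mod_group\<^esub> \<psi> \<noteq> {}"
  by (auto simp: Mod_group_def set_mult_def)

section \<open>Block matrices and the images of the generators\<close>

lemma block_matrix_mult:
  "block_matrix a b c d x y e ** block_matrix a' b' c' d' x' y' e' =
    block_matrix (a * a' + b * c') (a * b' + b * d') (c * a' + d * c') (c * b' + d * d')
      (x * a' + y * c' + e * x') (x * b' + y * d' + e * y') (e * e')"
  by (rule matrix_3_eqI) (simp_all add: matrix_matrix_mult_def sum_3)

lemma block_matrix_1: "block_matrix 1 0 0 1 0 0 1 = mat 1"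
  by (rule matrix_3_eqI) (simp_all add: mat_def)

lemma block_det_block_matrix: "block_det (block_matrix a b c d x y e) = a * d - b * c"
  by (simp add: block_det_def)

lemma identity_homeo_group: "(\<lambda>q\<in>torus. q) \<in> carrier homeo_group" "homology_matrix (\<lambda>q\<in>torus. q) = mat 1"
proof -
  show m: "homology_matrix (\<lambda>q\<in>torus. q) = mat 1"
    unfolding homology_matrix_id[symmetric] using punctured_subset_torus by (intro homology_matrix_cong) auto
  have "(\<lambda>q\<in>torus. q) \<in> marked_homeos"
    by (rule marked_homeosI[of _ "\<lambda>q. q"]) (use marked_subset_torus in \<open>auto simp: image_iff cong: continuous_on_cong\<close>)
  then show "(\<lambda>q\<in>torus. q) \<in> carrier homeo_group"
    using m by (simp add: carrier_homeo_group block_det_def mat_def)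
qed

lemma generators_homeo_group:
  "twist_a \<in> carrier homeo_group" "twist_b \<in> carrier homeo_group" "twist_c \<in> carrier homeo_group"
  "involution \<in> carrier homeo_group"
  by (simp_all add: carrier_homeo_group twists_marked_homeos involution_marked_homeo homology_matrix_twist_a
    homology_matrix_twist_b homology_matrix_twist_c homology_matrix_involution block_det_block_matrix)

text \<open>The power is followed as a nonempty subset of the class of an explicit composite, the
  form that \<open>Psi_eq\<close> takes as input.\<close>

lemma T_c_power:
  "\<exists>f\<in>carrier homeo_group. T_c [^]\<^bsub>Mod_group\<^esub> (n::nat) \<noteq> {} \<and> T_c [^]\<^bsub>Mod_group\<^esub> n \<subseteq> mapping_class f \<and>
    homology_matrix f = block_matrix 1 (- int n) 0 1 0 (- int n) 1"
proof (induction n)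
  case 0
  have "T_c [^]\<^bsub>Mod_group\<^esub> (0::nat) = mapping_class (\<lambda>q\<in>torus. q)"
    by (simp add: Mod_group_def homeo_group_def)
  then have "T_c [^]\<^bsub>Mod_group\<^esub> (0::nat) \<noteq> {}" "T_c [^]\<^bsub>Mod_group\<^esub> (0::nat) \<subseteq> mapping_class (\<lambda>q\<in>torus. q)"
    using mapping_class_refl[OF identity_homeo_group(1)] by blast+
  moreover have "homology_matrix (\<lambda>q\<in>torus. q) = block_matrix 1 (- int 0) 0 1 0 (- int 0) 1"
    unfolding identity_homeo_group(2) by (simp add: block_matrix_1)
  ultimately show ?case using identity_homeo_group(1) by blast
next
  case (Suc n)
  then obtain f where f: "f \<in> carrier homeo_group" "T_c [^]\<^bsub>Mod_group\<^esub> n \<noteq> {}" "T_c [^]\<^bsub>Mod_group\<^esub> n \<subseteq> mapping_class f"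
    "homology_matrix f = block_matrix 1 (- int n) 0 1 0 (- int n) 1" by blast
  note c = generators_homeo_group(3)
  have "T_c \<noteq> {}" "T_c \<subseteq> mapping_class twist_c" using mapping_class_refl[OF c] by (auto simp: T_c_def)
  moreover have "homology_matrix (compose torus f twist_c) = block_matrix 1 (- int (Suc n)) 0 1 0 (- int (Suc n)) 1"
    using f(1) c by (simp add: carrier_homeo_group homology_matrix_compose f(4) homology_matrix_twist_c block_matrix_mult algebra_simps)
  ultimately show ?case
    using f homeo_group_compose[OF f(1) c] Mod_group_mult_subset Mod_group_mult_nonempty
    by (intro bexI[of _ "compose torus f twist_c"]) (auto simp: nat_pow_Suc)
qed

lemma Psi_generators:
  "Psi T_a = block_matrix 1 (-1) 0 1 0 0 1" "Psi T_b = block_matrix 1 0 1 1 0 0 1"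
  "Psi (T_c [^]\<^bsub>Mod_group\<^esub> (n::nat)) = block_matrix 1 (- int n) 0 1 0 (- int n) 1"
  "Psi hyperelliptic = block_matrix (-1) 0 0 (-1) 0 0 (-1)"
proof -
  have "Psi (mapping_class f) = homology_matrix f" if "f \<in> carrier homeo_group" for f
    using mapping_class_refl[OF that] by (intro Psi_eq) auto
  then show "Psi T_a = block_matrix 1 (-1) 0 1 0 0 1" "Psi T_b = block_matrix 1 0 1 1 0 0 1"
    "Psi hyperelliptic = block_matrix (-1) 0 0 (-1) 0 0 (-1)"
    using generators_homeo_group homology_matrix_twist_a homology_matrix_twist_b homology_matrix_involution
    by (simp_all add: T_a_def T_b_def hyperelliptic_def)
  show "Psi (T_c [^]\<^bsub>Mod_group\<^esub> n) = block_matrix 1 (- int n) 0 1 0 (- int n) 1"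
    using T_c_power[of n] Psi_eq by metis
qed

section \<open>Generation of the group of liftable matrices\<close>

lemma group_GL3Z: "group GL3Z"
proof (rule groupI)
  show "x \<otimes>\<^bsub>GL3Z\<^esub> y \<in> carrier GL3Z" if xy: "x \<in> carrier GL3Z" "y \<in> carrier GL3Z" for x y
  proof -
    obtain x' where x: "x ** x' = mat 1" "x' ** x = mat 1" using xy(1) by (auto simp: GL3Z_def invertible_def)
    obtain y' where y: "y ** y' = mat 1" "y' ** y = mat 1" using xy(2) by (auto simp: GL3Z_def invertible_def)
    have "(x ** y) ** (y' ** x') = x ** (y ** y') ** x'" "(y' ** x') ** (x ** y) = y' ** (x' ** x) ** y"
      by (simp_all add: matrix_mul_assoc)
    then have "(x ** y) ** (y' ** x') = mat 1 \<and> (y' ** x') ** (x ** y) = mat 1" by (simp add: x y)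
    then show ?thesis unfolding GL3Z_def invertible_def by auto
  qed
  show "\<exists>y\<in>carrier GL3Z. y \<otimes>\<^bsub>GL3Z\<^esub> x = \<one>\<^bsub>GL3Z\<^esub>" if "x \<in> carrier GL3Z" for x
    using that by (auto simp: GL3Z_def invertible_def)
qed (auto simp: GL3Z_def invertible_def matrix_mul_assoc intro!: exI[of _ "mat 1"])

text \<open>Column operations by the first two generators carry out the Euclidean algorithm on the first row.\<close>

lemma SL2_in_subgroup:
  assumes mult: "\<And>A B. A \<in> H \<Longrightarrow> B \<in> H \<Longrightarrow> A ** B \<in> H"
    and gens: "block_matrix 1 1 0 1 0 0 1 \<in> H" "block_matrix 1 (-1) 0 1 0 0 1 \<in> H"
      "block_matrix 1 0 1 1 0 0 1 \<in> H" "block_matrix 1 0 (-1) 1 0 0 1 \<in> H"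
    and det: "a * d - b * c = 1"
  shows "block_matrix a b c d 0 0 1 \<in> H"
proof -
  \<comment> \<open>Each of the four rules undoes a column operation: membership follows from
    membership after the operation.\<close>
  have add1: "block_matrix a b c d 0 0 1 \<in> H" if "block_matrix (a + b) b (c + d) d 0 0 1 \<in> H" for a b c d
    using mult[OF that gens(4)] by (simp add: block_matrix_mult)
  have sub1: "block_matrix a b c d 0 0 1 \<in> H" if "block_matrix (a - b) b (c - d) d 0 0 1 \<in> H" for a b c d
    using mult[OF that gens(3)] by (simp add: block_matrix_mult)
  have add2: "block_matrix a b c d 0 0 1 \<in> H" if "block_matrix a (b + a) c (d + c) 0 0 1 \<in> H" for a b c d
    using mult[OF that gens(2)] by (simp add: block_matrix_mult)
  have sub2: "block_matrix a b c d 0 0 1 \<in> H" if "block_matrix a (b - a) c (d - c) 0 0 1 \<in> H" for a b c d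
    using mult[OF that gens(1)] by (simp add: block_matrix_mult)
  have one: "block_matrix 1 0 c 1 0 0 1 \<in> H" for c
  proof (induction c rule: int_induct[of _ 0])
    case base
    show ?case using mult[OF gens(1,2)] by (simp add: block_matrix_mult)
  next
    case (step1 i)
    show ?case using mult[OF step1(2) gens(3)] by (simp add: block_matrix_mult)
  next
    case (step2 i)
    show ?case using mult[OF step2(2) gens(4)] by (simp add: block_matrix_mult)
  qed
  have zero: "block_matrix a 0 c d 0 0 1 \<in> H" if ad: "a * d = 1" for a c d
  proof -
    from ad consider "a = 1" "d = 1" | "a = -1" "d = -1" by (auto simp: zmult_eq_1_iff)
    then show ?thesis
    proof cases
      case 1
      then show ?thesis using one by simp
    next
      case 2
      \<comment> \<open>Read backwards, the first row passes from \<open>(-1, 0)\<close> through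
        \<open>(-1, 1)\<close>, \<open>(0, 1)\<close>, \<open>(1, 1)\<close> to
        \<open>(1, 0)\<close>.\<close>
      have "block_matrix 1 1 (- 2 - c) (- 1 - c) 0 0 1 \<in> H" using sub2[of 1 1 "- 2 - c" "- 1 - c"] one by simp
      then have "block_matrix 0 1 (-1) (- 1 - c) 0 0 1 \<in> H" using add1[of 0 1 "-1" "- 1 - c"] by simp
      then have "block_matrix (-1) 1 c (- 1 - c) 0 0 1 \<in> H" using add1[of "-1" 1 c "- 1 - c"] by simp
      then have "block_matrix (-1) 0 c (-1) 0 0 1 \<in> H" using sub2[of "-1" 0 c "-1"] by simp
      then show ?thesis using 2 by simp
    qed
  qed
  show ?thesis using det
  proof (induction "nat (\<bar>a\<bar> + \<bar>b\<bar>)" arbitrary: a b c d rule: less_induct)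
    case less
    consider "b = 0" | "a = 0" "b \<noteq> 0" | "a \<noteq> 0" "b \<noteq> 0" by blast
    then show ?case
    proof cases
      case 1
      then show ?thesis using zero less(2) by simp
    next
      case 2
      \<comment> \<open>The measure cannot be lowered when \<open>a = 0\<close>; instead the first
        row \<open>(0, b)\<close> is brought to \<open>(b, 0)\<close> through
        \<open>(b, b)\<close>.\<close>
      then have "b * - c = 1" using less(2) by simp
      then have "block_matrix b 0 (c + d) (- c) 0 0 1 \<in> H" by (rule zero)
      then have "block_matrix b b (c + d) d 0 0 1 \<in> H" using sub2[of b b "c + d" d] by (simp add: algebra_simps)
      then show ?thesis unfolding 2(1) using add1[of 0 b c d] by (simp add: algebra_simps)
    next
      case 3
      \<comment> \<open>Adding or subtracting an entry of no larger absolute value moves the other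
        entry closer to 0.\<close>
      consider "\<bar>a - b\<bar> < \<bar>a\<bar>" | "\<bar>a + b\<bar> < \<bar>a\<bar>" | "\<bar>b - a\<bar> < \<bar>b\<bar>" | "\<bar>b + a\<bar> < \<bar>b\<bar>"
        using 3 by linarith
      then show ?thesis
      proof cases
        case 1 then show ?thesis using less(1)[of "a - b" b "d" "c - d"] less(2) sub1[of a b c d] by (simp add: algebra_simps)
      next
        case 2 then show ?thesis using less(1)[of "a + b" b "d" "c + d"] less(2) add1[of a b c d] by (simp add: algebra_simps)
      next
        case 3 then show ?thesis using less(1)[of a "b - a" "d - c" c] less(2) sub2[of a b c d] by (simp add: algebra_simps)
      next
        case 4 then show ?thesis using less(1)[of a "b + a" "d + c" c] less(2) add2[of a b c d] by (simp add: algebra_simps)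
      qed
    qed
  qed
qed

text \<open>The matrix factors into the diagonal matrix of the sign \<open>e\<close>, the block, and
  two shears in the third row. The block acts on the row vectors of shears by conjugation, so one
  shear of length \<open>k\<close> yields all those that are needed.\<close>

lemma block_matrix_in_generate:
  assumes det: "a * d - b * c = 1" and e: "e = 1 \<or> e = -1" and xy: "int k dvd x" "int k dvd y"
  shows "block_matrix a b c d x y e \<in> generate GL3Z {Psi T_a, Psi T_b, Psi (T_c [^]\<^bsub>Mod_group\<^esub> k), Psi hyperelliptic}"
    (is "_ \<in> ?H")
proof -
  interpret group GL3Z by (rule group_GL3Z)
  have GL: "\<one>\<^bsub>GL3Z\<^esub> = mat 1" "\<And>A B. A \<otimes>\<^bsub>GL3Z\<^esub> B = A ** B" by (simp_all add: GL3Z_def)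
  have mult: "A ** B \<in> ?H" if "A \<in> ?H" "B \<in> ?H" for A B
    using generate.eng[OF that] by (simp add: GL)
  have gen: "block_matrix 1 (-1) 0 1 0 0 1 \<in> ?H" "block_matrix 1 0 1 1 0 0 1 \<in> ?H"
    "block_matrix 1 (- int k) 0 1 0 (- int k) 1 \<in> ?H" "block_matrix (-1) 0 0 (-1) 0 0 (-1) \<in> ?H"
    by (rule generate.incl; simp add: Psi_generators)+
  have inv: "A' \<in> ?H" if "A \<in> {Psi T_a, Psi T_b, Psi (T_c [^]\<^bsub>Mod_group\<^esub> k), Psi hyperelliptic}"
    "A' ** A = mat 1" "A ** A' = mat 1" for A A'
  proof -
    have "inv\<^bsub>GL3Z\<^esub> A = A'"
      by (rule inv_equality) (use that in \<open>auto simp: GL3Z_def invertible_def\<close>)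
    then show ?thesis using generate.inv[OF that(1)] by metis
  qed
  have inva: "block_matrix 1 1 0 1 0 0 1 \<in> ?H"
    by (rule inv[of "Psi T_a"]) (simp_all add: Psi_generators block_matrix_mult block_matrix_1)
  have invb: "block_matrix 1 0 (-1) 1 0 0 1 \<in> ?H"
    by (rule inv[of "Psi T_b"]) (simp_all add: Psi_generators block_matrix_mult block_matrix_1)
  have SL2: "block_matrix a b c d 0 0 1 \<in> ?H" if "a * d - b * c = 1" for a b c d
    by (rule SL2_in_subgroup[of ?H, OF mult inva gen(1) gen(2) invb that])
  \<comment> \<open>The left factor cancels the block of the power of \<open>T_c\<close> and leaves
    its third row.\<close>
  have y1: "block_matrix 1 0 0 1 0 (- int k) 1 \<in> ?H"
    using mult[OF SL2[of 1 1 "int k" 0] gen(3)] by (simp add: block_matrix_mult)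
  \<comment> \<open>Conjugation by quarter turns carries the row \<open>(0, - k)\<close> to
    \<open>(k, 0)\<close> or \<open>(- k, 0)\<close>, and conjugation by the block \<open>-1\<close>
    reverses its sign.\<close>
  have x1: "block_matrix 1 0 0 1 (int k) 0 1 \<in> ?H"
    using mult[OF mult[OF SL2[of 0 0 "-1" 1] y1] SL2[of 0 0 1 "-1"]] by (simp add: block_matrix_mult)
  have x1': "block_matrix 1 0 0 1 (- int k) 0 1 \<in> ?H"
    using mult[OF mult[OF SL2[of 0 0 1 "-1"] y1] SL2[of 0 0 "-1" 1]] by (simp add: block_matrix_mult)
  have y1': "block_matrix 1 0 0 1 0 (int k) 1 \<in> ?H"
    using mult[OF mult[OF SL2[of "-1" "-1" 0 0] y1] SL2[of "-1" "-1" 0 0]] by (simp add: block_matrix_mult)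
  have xm: "block_matrix 1 0 0 1 (int k * m) 0 1 \<in> ?H" for m
  proof (induction m rule: int_induct[of _ 0])
    case base
    show ?case using SL2[of 1 1 0 0] by simp
  next
    case (step1 i)
    show ?case using mult[OF step1(2) x1] by (simp add: block_matrix_mult distrib_left)
  next
    case (step2 i)
    show ?case using mult[OF step2(2) x1'] by (simp add: block_matrix_mult right_diff_distrib)
  qed
  have ym: "block_matrix 1 0 0 1 0 (int k * m) 1 \<in> ?H" for m
  proof (induction m rule: int_induct[of _ 0])
    case base
    show ?case using SL2[of 1 1 0 0] by simp
  next
    case (step1 i)
    show ?case using mult[OF step1(2) y1'] by (simp add: block_matrix_mult distrib_left)
  next
    case (step2 i)
    show ?case using mult[OF step2(2) y1] by (simp add: block_matrix_mult right_diff_distrib)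
  qed
  have em: "block_matrix 1 0 0 1 0 0 e \<in> ?H"
  proof -
    have "block_matrix 1 0 0 1 0 0 (-1) \<in> ?H"
      using mult[OF SL2[of "-1" "-1" 0 0] gen(4)] by (simp add: block_matrix_mult)
    then show ?thesis using e SL2[of 1 1 0 0] by auto
  qed
  obtain m n where mn: "x = int k * m" "y = int k * n" using xy by (auto elim!: dvdE)
  \<comment> \<open>The shears contain an extra factor \<open>e\<close> because the leftmost matrix
    multiplies the third row by \<open>e\<close>, and \<open>e * e = 1\<close>.\<close>
  have "block_matrix 1 0 0 1 0 0 e ** block_matrix a b c d 0 0 1 **
     (block_matrix 1 0 0 1 (int k * (e * m)) 0 1 ** block_matrix 1 0 0 1 0 (int k * (e * n)) 1) \<in> ?H"
    using mult em SL2[OF det] xm ym by blast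
  also have "block_matrix 1 0 0 1 0 0 e ** block_matrix a b c d 0 0 1 **
     (block_matrix 1 0 0 1 (int k * (e * m)) 0 1 ** block_matrix 1 0 0 1 0 (int k * (e * n)) 1)
     = block_matrix a b c d x y e"
    using e unfolding block_matrix_mult by (auto simp: mn)
  finally show ?thesis .
qed

text \<open>By \<open>lifts_iff\<close> liftability depends only on the homology matrix, which is
  constant on isotopy classes; so classes may be replaced by their representatives.\<close>

lemma Psi_LMod:
  assumes "cyclic_branched_cover k S p"
  shows "Psi ` LMod S p = homology_matrix ` {f \<in> carrier homeo_group. preserves_eta k (homology_matrix f)}"
proof (intro equalityI subsetI)
  fix A assume "A \<in> Psi ` LMod S p"
  then obtain \<phi> f where \<phi>: "A = Psi \<phi>" "\<phi> \<in> carrier Mod_group" "f \<in> \<phi>" "lifts S p f" by (auto simp: LMod_def)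
  then obtain g where g: "\<phi> = mapping_class g"
    by (auto simp: Mod_group_def quotient_def mapping_class_def)
  have gf: "(g, f) \<in> isotopy_rel" using \<phi>(3) by (simp add: g mapping_class_def)
  then have f: "f \<in> carrier homeo_group" "homology_matrix g = homology_matrix f"
    using isotopic_homology_matrix by (auto simp: isotopy_rel_def)
  have "A = homology_matrix f"
    unfolding \<phi>(1) f(2)[symmetric] by (rule Psi_eq) (use \<phi>(3) g in auto)
  moreover have "preserves_eta k (homology_matrix f)"
    using lifts_iff[OF assms] \<phi>(4) f(1) by (simp add: carrier_homeo_group)
  ultimately show "A \<in> homology_matrix ` {f \<in> carrier homeo_group. preserves_eta k (homology_matrix f)}"
    using f(1) by blast
next
  fix A assume "A \<in> homology_matrix ` {f \<in> carrier homeo_group. preserves_eta k (homology_matrix f)}"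
  then obtain f where f: "f \<in> carrier homeo_group" "preserves_eta k (homology_matrix f)" "A = homology_matrix f" by blast
  note r = mapping_class_refl[OF f(1)]
  have "mapping_class f \<in> carrier Mod_group"
    using f(1) by (auto simp: Mod_group_def mapping_class_def intro: quotientI)
  moreover have "lifts S p f" using lifts_iff[OF assms] f by (simp add: carrier_homeo_group)
  ultimately have "mapping_class f \<in> LMod S p" using r by (auto simp: LMod_def)
  moreover have "Psi (mapping_class f) = A" unfolding f(3) by (rule Psi_eq) (use r in auto)
  ultimately show "A \<in> Psi ` LMod S p" by blast
qed

lemma preserves_eta_mult:
  assumes "preserves_eta k A" "preserves_eta k B"
  shows "preserves_eta k (A ** B)"
  using assms by (simp add: preserves_eta_def matrix_matrix_mult_def sum_3)

theorem proposition1: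
  fixes k :: nat and S :: "'a::real_normed_vector set" and p :: "'a \<Rightarrow> complex \<times> complex"
  assumes "k \<ge> 2"
    and "cyclic_branched_cover k S p"
  shows "Psi ` LMod S p =
    generate GL3Z {Psi T_a, Psi T_b, Psi (T_c [^]\<^bsub>Mod_group\<^esub> k), Psi hyperelliptic}"
proof -
  let ?X = "{Psi T_a, Psi T_b, Psi (T_c [^]\<^bsub>Mod_group\<^esub> k), Psi hyperelliptic}"
  let ?M = "homology_matrix ` {f \<in> carrier homeo_group. preserves_eta k (homology_matrix f)}"
  have "?M \<subseteq> generate GL3Z ?X"
  proof
    fix A assume "A \<in> ?M"
    then obtain f where f: "f \<in> marked_homeos" "block_det (homology_matrix f) = 1" "preserves_eta k (homology_matrix f)"
      "A = homology_matrix f" by (auto simp: carrier_homeo_group)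
    \<comment> \<open>The vanishing third column puts \<open>A\<close> into block form, so the
      arithmetic conditions can be passed on.\<close>
    have "A = block_matrix (A $ 1 $ 1) (A $ 1 $ 2) (A $ 2 $ 1) (A $ 2 $ 2) (A $ 3 $ 1) (A $ 3 $ 2) (A $ 3 $ 3)"
      by (rule matrix_3_eqI) (simp_all add: f(4) homology_matrix_third_column[OF f(1)])
    also have "\<dots> \<in> generate GL3Z ?X"
      using f homology_matrix_units(2)[OF f(1)]
      by (intro block_matrix_in_generate) (auto simp: block_det_def preserves_eta_def)
    finally show "A \<in> generate GL3Z ?X" .
  qed
  \<comment> \<open>The set \<open>?M\<close> contains the generators and is closed under products
    and inverses, which are realised by \<open>compose torus\<close> and
    \<open>torus_inv\<close>.\<close>
  moreover have "generate GL3Z ?X \<subseteq> ?M"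
  proof
    have gens: "A \<in> ?M" if "A \<in> ?X" for A
    proof -
      obtain g where g: "g \<in> carrier homeo_group" "homology_matrix g = Psi (T_c [^]\<^bsub>Mod_group\<^esub> k)"
        using T_c_power[of k] Psi_generators(3)[of k] by auto
      have "A \<in> homology_matrix ` {twist_a, twist_b, g, involution}"
        using that g(2) by (auto simp: Psi_generators homology_matrix_twist_a homology_matrix_twist_b homology_matrix_involution)
      moreover have "preserves_eta k A" using that by (auto simp: Psi_generators preserves_eta_def)
      ultimately show ?thesis using generators_homeo_group g(1) by auto
    qed
    have inv: "inv\<^bsub>GL3Z\<^esub> A \<in> ?M" if A: "A \<in> ?M" for A
    proof -
      interpret group GL3Z by (rule group_GL3Z)
      obtain f where f: "f \<in> carrier homeo_group" "preserves_eta k (homology_matrix f)" "A = homology_matrix f"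
        using A by blast
      then have m: "f \<in> marked_homeos" by (simp add: carrier_homeo_group)
      have "inv\<^bsub>GL3Z\<^esub> A = homology_matrix (torus_inv f)"
        by (rule inv_equality) (use homology_matrix_torus_inv[OF m] f(3) in \<open>auto simp: GL3Z_def invertible_def\<close>)
      then show ?thesis using homeo_group_torus_inv[OF f(1)] preserves_eta_torus_inv[OF m f(2)] by auto
    qed
    fix A assume "A \<in> generate GL3Z ?X"
    then show "A \<in> ?M"
    proof (induction rule: generate.induct)
      case one
      have "preserves_eta k (mat 1)" by (simp add: preserves_eta_def mat_def)
      then show ?case using identity_homeo_group by (auto simp: GL3Z_def image_iff intro!: bexI[of _ "\<lambda>q\<in>torus. q"])
    next
      case (incl h)
      then show ?case by (rule gens)
    next
      case (inv h)
      then show ?case using gens \<open>\<And>A. A \<in> ?M \<Longrightarrow> inv\<^bsub>GL3Z\<^esub> A \<in> ?M\<close> by blast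
    next
      case (eng A B)
      then obtain f g where f: "f \<in> carrier homeo_group" "preserves_eta k (homology_matrix f)" "A = homology_matrix f"
        and g: "g \<in> carrier homeo_group" "preserves_eta k (homology_matrix g)" "B = homology_matrix g" by blast
      have "A \<otimes>\<^bsub>GL3Z\<^esub> B = homology_matrix (compose torus f g)"
        using f g by (simp add: GL3Z_def homology_matrix_compose carrier_homeo_group)
      moreover have "preserves_eta k (homology_matrix (compose torus f g))"
        using f g preserves_eta_mult by (simp add: homology_matrix_compose carrier_homeo_group)
      ultimately show ?case using homeo_group_compose[OF f(1) g(1)] by auto
    qed
  qed
  ultimately show ?thesis unfolding Psi_LMod[OF assms(2)] by (rule equalityI)
qed

end
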